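(* Let $\Omega\subset\mathbb{R}^2$ be an open, simply connected, bounded set and let $\alpha\in(0,1)$. For every integer $j\ge 1$, the function $a\in\Omega\mapsto\lambda_j^a\in\mathbb{R}$ admits a continuous extension to $\overline{\Omega}$. More precisely, as $a\to\partial\Omega$, $\lambda_j^a$ converges to $\lambda_j$, the $j$-th eigenvalue of $-\Delta$ in $H^1_0(\Omega)$.
   Context: For $a=(a_1,a_2)\in\Omega$, the Aharonov-Bohm potential with pole $a$ and circulation $\alpha$ is $A_a(x)=\alpha\left(-\frac{x_2-a_2}{|x-a|^2},\frac{x_1-a_1}{|x-a|^2}\right)$, $x\in\Omega\setminus\{a\}$. The space $H^1_{A_a}(\Omega)$ is the completion of $C_0^\infty(\Omega\setminus\{a\})$ (complex-valued functions) with respect to the norm $\|u\|_{H^1_{A_a}(\Omega)}=\|(i\nabla+A_a)u\|_{L^2(\Omega)}$; equivalently $H^1_{A_a}(\Omega)=\{u\in H^1_0(\Omega): u/|x-a|\in L^2(\Omega)\}$. The operator $(i\nabla+A_a)^2$ with zero boundary conditions on $\partial\Omega$ is the operator associated with the quadratic form $\|(i\nabla+A_a)u\|_{L^2(\Omega)}^2$ on $H^1_{A_a}(\Omega)$. Its spectrum is a diverging sequence of positive eigenvalues $\lambda_1^a\le\lambda_2^a\le\dots$, counted with multiplicity, given by $$\lambda_j^a=\inf_{W\subset H^1_{A_a}(\Omega),\ \dim W=j}\ \sup_{\Phi\in W\setminus\{0\}}\frac{\|\Phi\|^2_{H^1_{A_a}(\Omega)}}{\|\Phi\|^2_{L^2(\Omega)}}.$$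 The eigenvalues $\lambda_1\le\lambda_2\le\dots$ of $-\Delta$ in $H^1_0(\Omega)$ are also counted with multiplicity. *)

theory Defs
  imports "HOL-Analysis.Analysis"
begin

fun C_k :: "nat \<Rightarrow> (real^2 \<Rightarrow> complex) \<Rightarrow> bool" where
  "C_k 0 f \<longleftrightarrow> continuous_on UNIV f"
| "C_k (Suc k) f \<longleftrightarrow> (\<forall>x. f differentiable (at x)) \<and>
     (\<forall>i. C_k k (\<lambda>x. frechet_derivative f (at x) (axis i 1)))"

text \<open>The space \<open>C\<^sub>0\<^sup>\<infinity>(U)\<close>; its elements are extended by zero to the whole plane.\<close>

definition test_functions :: "(real^2) set \<Rightarrow> (real^2 \<Rightarrow> complex) set" where
  "test_functions U = {\<phi>. (\<forall>k. C_k k \<phi>) \<and>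
     compact (closure {x. \<phi> x \<noteq> 0}) \<and> closure {x. \<phi> x \<noteq> 0} \<subseteq> U}"

text \<open>The value at the pole itself is 0 (division by zero) and is never relevant.\<close>

definition AB_potential :: "real \<Rightarrow> real^2 \<Rightarrow> real^2 \<Rightarrow> real^2" where
  "AB_potential \<alpha> a x =
     \<alpha> *\<^sub>R vector [- (x$2 - a$2) / (norm (x - a))\<^sup>2, (x$1 - a$1) / (norm (x - a))\<^sup>2]"

text \<open>\<open>(i\<nabla> + A)\<phi>\<close> for classically differentiable \<open>\<phi>\<close>.\<close>

definition mgrad :: "(real^2 \<Rightarrow> real^2) \<Rightarrow> (real^2 \<Rightarrow> complex) \<Rightarrow> real^2 \<Rightarrow> complex^2" where
  "mgrad A \<phi> x =
     (\<chi> i. \<i> * frechet_derivative \<phi> (at x) (axis i 1) + complex_of_real (A x $ i) * \<phi> x)"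

definition sq_integrable :: "(real^2) set \<Rightarrow> (real^2 \<Rightarrow> 'b::euclidean_space) \<Rightarrow> bool" where
  "sq_integrable U f \<longleftrightarrow>
     f \<in> borel_measurable (lebesgue_on U) \<and> integrable (lebesgue_on U) (\<lambda>x. (norm (f x))\<^sup>2)"

definition L2_sq :: "(real^2) set \<Rightarrow> (real^2 \<Rightarrow> 'b::euclidean_space) \<Rightarrow> real" where
  "L2_sq U f = (LINT x|lebesgue_on U. (norm (f x))\<^sup>2)"

definition ae_zero :: "(real^2) set \<Rightarrow> (real^2 \<Rightarrow> complex) \<Rightarrow> bool" where
  "ae_zero U u \<longleftrightarrow> (AE x in lebesgue_on U. u x = 0)"

text \<open>
  The completion of \<open>C\<^sub>0\<^sup>\<infinity>(U)\<close> with respect to \<open>\<parallel>(i\<nabla> + A)\<phi>\<parallel>\<close> in \<open>L\<^sup>2(U)\<close>, realised inside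
  \<open>L\<^sup>2(U)\<close>: by the diamagnetic and Poincare inequalities (\<open>U\<close> is bounded) a Cauchy sequence for
  this norm also converges in \<open>L\<^sup>2(U)\<close>, and its class is determined by the \<open>L\<^sup>2\<close> limit \<open>u\<close>. The
  limit \<open>F\<close> of the magnetic gradients is then \<open>(i\<nabla> + A)u\<close>. For a pole \<open>a\<close> one
  takes \<open>U = \<Omega> - {a}\<close>, and \<open>L\<^sup>2(U)\<close> is the same as \<open>L\<^sup>2(\<Omega>)\<close>.
\<close>

definition form_limit ::
  "(real^2 \<Rightarrow> real^2) \<Rightarrow> (real^2) set \<Rightarrow> (real^2 \<Rightarrow> complex) \<Rightarrow> (real^2 \<Rightarrow> complex^2) \<Rightarrow> bool" where
  "form_limit A U u F \<longleftrightarrow> sq_integrable U u \<and> sq_integrable U F \<and>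
     (\<exists>\<phi> :: nat \<Rightarrow> real^2 \<Rightarrow> complex. (\<forall>n. \<phi> n \<in> test_functions U) \<and>
        (\<lambda>n. L2_sq U (\<lambda>x. \<phi> n x - u x)) \<longlonglongrightarrow> 0 \<and>
        (\<lambda>n. L2_sq U (\<lambda>x. mgrad A (\<phi> n) x - F x)) \<longlonglongrightarrow> 0)"

definition form_domain ::
  "(real^2 \<Rightarrow> real^2) \<Rightarrow> (real^2) set \<Rightarrow> (real^2 \<Rightarrow> complex) set" where
  "form_domain A U = {u. \<exists>F. form_limit A U u F}"

text \<open>\<open>(i\<nabla> + A)u\<close> for \<open>u\<close> in the form domain; it is unique up to a null set.\<close>

definition mgrad_ext ::
  "(real^2 \<Rightarrow> real^2) \<Rightarrow> (real^2) set \<Rightarrow> (real^2 \<Rightarrow> complex) \<Rightarrow> real^2 \<Rightarrow> complex^2" where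
  "mgrad_ext A U u = (SOME F. form_limit A U u F)"

definition form_norm_sq ::
  "(real^2 \<Rightarrow> real^2) \<Rightarrow> (real^2) set \<Rightarrow> (real^2 \<Rightarrow> complex) \<Rightarrow> real" where
  "form_norm_sq A U u = L2_sq U (mgrad_ext A U u)"

text \<open>Linear independence over the complex numbers of the almost-everywhere classes.\<close>

definition ae_independent :: "(real^2) set \<Rightarrow> nat \<Rightarrow> (nat \<Rightarrow> real^2 \<Rightarrow> complex) \<Rightarrow> bool" where
  "ae_independent U j w \<longleftrightarrow>
     (\<forall>c :: nat \<Rightarrow> complex. ae_zero U (\<lambda>x. \<Sum>k<j. c k * w k x) \<longrightarrow> (\<forall>k<j. c k = 0))"

text \<open>The complex \<open>j\<close>-dimensional subspaces of the form domain, each given by the span of a basis.\<close>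

definition form_subspaces ::
  "(real^2 \<Rightarrow> real^2) \<Rightarrow> (real^2) set \<Rightarrow> nat \<Rightarrow> (real^2 \<Rightarrow> complex) set set" where
  "form_subspaces A U j =
     {W. \<exists>w. (\<forall>k<j. w k \<in> form_domain A U) \<and> ae_independent U j w \<and>
           W = range (\<lambda>(c :: nat \<Rightarrow> complex) x. \<Sum>k<j. c k * w k x)}"

definition AB_eigenvalue :: "real \<Rightarrow> (real^2) set \<Rightarrow> nat \<Rightarrow> real^2 \<Rightarrow> real" where
  "AB_eigenvalue \<alpha> \<Omega> j a =
     (INF W\<in>form_subspaces (AB_potential \<alpha> a) (\<Omega> - {a}) j.
        SUP \<Phi>\<in>{\<Phi>\<in>W. \<not> ae_zero (\<Omega> - {a}) \<Phi>}.
          form_norm_sq (AB_potential \<alpha> a) (\<Omega> - {a}) \<Phi> / L2_sq (\<Omega> - {a}) \<Phi>)"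

text \<open>
  For \<open>A = 0\<close> the form domain is the complex space \<open>H\<^sup>1\<^sub>0(\<Omega>)\<close> and the extended gradient is \<open>i\<nabla>u\<close>;
  the two factors \<open>i\<close> and \<open>-i\<close> below cancel, so the left-hand side is the integral of
  \<open>\<nabla>u \<cdot> cnj (\<nabla>v)\<close>.
\<close>

definition dirichlet_eigenfunction ::
  "(real^2) set \<Rightarrow> real \<Rightarrow> (real^2 \<Rightarrow> complex) \<Rightarrow> bool" where
  "dirichlet_eigenfunction \<Omega> \<mu> u \<longleftrightarrow>
     u \<in> form_domain (\<lambda>_. 0) \<Omega> \<and> \<not> ae_zero \<Omega> u \<and>
     (\<forall>v\<in>form_domain (\<lambda>_. 0) \<Omega>.
        (LINT x|lebesgue_on \<Omega>.
           (\<Sum>i\<in>UNIV. mgrad_ext (\<lambda>_. 0) \<Omega> u x $ i * cnj (mgrad_ext (\<lambda>_. 0) \<Omega> v x $ i)))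
        = complex_of_real \<mu> * (LINT x|lebesgue_on \<Omega>. u x * cnj (v x)))"

text \<open>
  The \<open>j\<close>-th term (\<open>j \<ge> 1\<close>) of the nondecreasing list of eigenvalues, each repeated according to
  the dimension of its eigenspace: the least \<open>t\<close> for which the eigenspaces of the eigenvalues
  \<open>\<le> t\<close> have total dimension at least \<open>j\<close>.
\<close>

definition dirichlet_eigenvalue :: "(real^2) set \<Rightarrow> nat \<Rightarrow> real" where
  "dirichlet_eigenvalue \<Omega> j =
     Inf {t. \<exists>u. (\<forall>k<j. \<exists>\<mu>\<le>t. dirichlet_eigenfunction \<Omega> \<mu> (u k)) \<and> ae_independent \<Omega> j u}"

text \<open>The filter \<open>a \<rightarrow> \<partial>\<Omega>\<close>: \<open>a\<close> stays in \<open>\<Omega>\<close> and its distance to the boundary tends to 0.\<close>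

definition to_boundary :: "(real^2) set \<Rightarrow> (real^2) filter" where
  "to_boundary \<Omega> =
     inf (filtercomap (\<lambda>a. infdist a (frontier \<Omega>)) (nhds 0)) (principal \<Omega>)"

end

theory Submission
  imports Defs "HOL-Complex_Analysis.Complex_Analysis"
begin

text \<open>
  For a pole \<open>a\<close> anywhere in the plane, also outside \<open>\<Omega>\<close>, let \<open>\<lambda>\<^sub>j(a)\<close> be the min-max value of the
  magnetic form with potential \<open>A\<^sub>a\<close> on \<open>\<Omega> - {a}\<close>. The theorem is a consequence of two facts: \<open>\<lambda>\<^sub>j\<close> is
  continuous on the whole plane, and \<open>\<lambda>\<^sub>j(b)\<close> is the Dirichlet eigenvalue for every \<open>b\<close> outside \<open>\<Omega>\<close>.
  So \<open>\<lambda>\<^sub>j\<close> itself is the continuous extension, and compactness of the closure of \<open>\<Omega>\<close> makes the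
  convergence at the boundary uniform.

  Continuity rests on a Hardy inequality \<open>\<parallel>u / |x - a|\<parallel> \<le> C \<parallel>(i\<nabla> + A\<^sub>a)u\<parallel>\<close> whose constant depends on the
  circulation only (\<open>circle_bound\<close>, \<open>AB_hardy\<close>): after one turn around the pole the phase
  \<open>e\<^sup>-\<^sup>2\<^sup>\<pi>\<^sup>i\<^sup>\<alpha>\<close> differs from \<open>1\<close>, so the derivative along a circle controls the function on it. On the
  other hand a point of the plane has zero capacity: there is a cutoff that vanishes near \<open>a\<close>, equals \<open>1\<close>
  outside a small disc and has gradient at most \<open>\<epsilon> / |x - a|\<close> (\<open>logarithmic_cutoff\<close>). Multiplying by it
  costs little energy and little mass by the Hardy inequality, and on its support the potentials of \<open>a\<close>
  and of a nearby pole \<open>a'\<close> differ by at most \<open>\<epsilon> / |x - a|\<close> as well. Hence the cutoff carries subspaces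
  of the form domain for \<open>a\<close> to subspaces for \<open>a'\<close> with almost the same Rayleigh quotients
  (\<open>pole_move\<close>, \<open>minmax_transfer\<close>), with bounds that are uniform in the position of \<open>a\<close>.

  If \<open>b\<close> lies outside the simply connected set \<open>\<Omega>\<close>, a holomorphic logarithm of \<open>z - b\<close> gives a smooth angle
  whose gradient is \<open>A\<^sub>b / \<alpha>\<close>, and the corresponding gauge transformation identifies the magnetic form with
  the form of the Dirichlet Laplacian (\<open>gauge_function\<close>, \<open>gauge_minmax_le\<close>).

  It remains to see that the eigenvalues of the Dirichlet Laplacian, listed by their eigenfunctions, are the
  min-max values. This is done for an abstract pair of Hermitian forms by successive minimisation
  (\<open>constrained_minimiser\<close>, \<open>eigenvalue_eq_minmax\<close>). Its hypotheses are Rellich's compactness theorem, which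
  follows from a comparison with the means of a function over finitely many discs
  (\<open>finite_means_bound\<close>), and the completeness of the form domain. That the extended gradient is
  well defined is the closability of the form (\<open>form_limit_zero\<close>).
\<close>

section \<open>Square-integrable functions\<close>

definition sqint :: "'a measure \<Rightarrow> ('a \<Rightarrow> 'b::euclidean_space) \<Rightarrow> bool" where
  "sqint M f \<longleftrightarrow> f \<in> borel_measurable M \<and> integrable M (\<lambda>x. (norm (f x))\<^sup>2)"

definition l2norm :: "'a measure \<Rightarrow> ('a \<Rightarrow> 'b::euclidean_space) \<Rightarrow> real" where
  "l2norm M f = sqrt (LINT x|M. (norm (f x))\<^sup>2)"

lemma sqint_measurable [measurable_dest]: "sqint M f \<Longrightarrow> f \<in> borel_measurable M"
  by (simp add: sqint_def)

lemma sqint_integrable: "sqint M f \<Longrightarrow> integrable M (\<lambda>x. (norm (f x))\<^sup>2)"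
  by (simp add: sqint_def)

lemma l2norm_nonneg [simp]: "0 \<le> l2norm M f"
  by (simp add: l2norm_def)

lemma l2norm_sq: "(l2norm M f)\<^sup>2 = (LINT x|M. (norm (f x))\<^sup>2)"
  by (simp add: l2norm_def)

lemma sqint_dominated:
  fixes f :: "'a \<Rightarrow> 'b::euclidean_space" and g :: "'a \<Rightarrow> 'c::euclidean_space"
  assumes f: "sqint M f" and g: "g \<in> borel_measurable M"
    and le: "AE x in M. norm (g x) \<le> B * norm (f x)"
  shows "sqint M g"
proof -
  have "integrable M (\<lambda>x. (norm (g x))\<^sup>2)"
  proof (rule Bochner_Integration.integrable_bound)
    show "integrable M (\<lambda>x. B\<^sup>2 * (norm (f x))\<^sup>2)"
      using sqint_integrable[OF f] by simp
    show "(\<lambda>x. (norm (g x))\<^sup>2) \<in> borel_measurable M" using g by measurable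
    show "AE x in M. norm ((norm (g x))\<^sup>2) \<le> norm (B\<^sup>2 * (norm (f x))\<^sup>2)"
      using le
    proof eventually_elim
      case (elim x)
      then have "(norm (g x))\<^sup>2 \<le> (B * norm (f x))\<^sup>2" by (intro power_mono) auto
      then show ?case by (simp add: power_mult_distrib abs_mult)
    qed
  qed
  with g show ?thesis by (simp add: sqint_def)
qed

lemma l2norm_dominated:
  fixes f :: "'a \<Rightarrow> 'b::euclidean_space" and g :: "'a \<Rightarrow> 'c::euclidean_space"
  assumes f: "sqint M f" and g: "g \<in> borel_measurable M"
    and le: "AE x in M. norm (g x) \<le> B * norm (f x)" and B: "0 \<le> B"
  shows "l2norm M g \<le> B * l2norm M f"
proof -
  have "(LINT x|M. (norm (g x))\<^sup>2) \<le> (LINT x|M. B\<^sup>2 * (norm (f x))\<^sup>2)"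
  proof (rule integral_mono_AE)
    show "integrable M (\<lambda>x. (norm (g x))\<^sup>2)"
      using sqint_dominated[OF f g le] by (rule sqint_integrable)
    show "integrable M (\<lambda>x. B\<^sup>2 * (norm (f x))\<^sup>2)"
      using sqint_integrable[OF f] by simp
    show "AE x in M. (norm (g x))\<^sup>2 \<le> B\<^sup>2 * (norm (f x))\<^sup>2"
      using le
    proof eventually_elim
      case (elim x)
      then have "(norm (g x))\<^sup>2 \<le> (B * norm (f x))\<^sup>2" by (intro power_mono) auto
      then show ?case by (simp add: power_mult_distrib abs_mult)
    qed
  qed
  also have "\<dots> = B\<^sup>2 * (l2norm M f)\<^sup>2" by (simp add: l2norm_sq)
  finally have "(l2norm M g)\<^sup>2 \<le> (B * l2norm M f)\<^sup>2"
    by (simp add: l2norm_sq power_mult_distrib)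
  then show ?thesis by (rule power2_le_imp_le) (simp add: B)
qed

lemma l2norm_cong_AE:
  fixes f :: "'a \<Rightarrow> 'b::euclidean_space" and g :: "'a \<Rightarrow> 'c::euclidean_space"
  assumes "f \<in> borel_measurable M" "g \<in> borel_measurable M" "AE x in M. norm (f x) = norm (g x)"
  shows "l2norm M f = l2norm M g"
proof -
  have "(LINT x|M. (norm (f x))\<^sup>2) = (LINT x|M. (norm (g x))\<^sup>2)"
    by (rule integral_cong_AE) (use assms in auto)
  then show ?thesis by (simp add: l2norm_def)
qed

lemma sqint_zero [simp]: "sqint M (\<lambda>x. 0)"
  by (simp add: sqint_def)

lemma l2norm_zero [simp]: "l2norm M (\<lambda>x. 0) = 0"
  by (simp add: l2norm_def)

lemma sqint_add:
  fixes f g :: "'a \<Rightarrow> 'b::euclidean_space"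
  assumes f: "sqint M f" and g: "sqint M g"
  shows "sqint M (\<lambda>x. f x + g x)"
proof -
  have [measurable]: "f \<in> borel_measurable M" "g \<in> borel_measurable M"
    using f g by (auto simp: sqint_def)
  have "integrable M (\<lambda>x. (norm (f x + g x))\<^sup>2)"
  proof (rule Bochner_Integration.integrable_bound)
    show "integrable M (\<lambda>x. 2 * (norm (f x))\<^sup>2 + 2 * (norm (g x))\<^sup>2)"
      using sqint_integrable[OF f] sqint_integrable[OF g] by simp
    show "AE x in M. norm ((norm (f x + g x))\<^sup>2) \<le> norm (2 * (norm (f x))\<^sup>2 + 2 * (norm (g x))\<^sup>2)"
    proof (intro AE_I2)
      fix x
      have "(norm (f x + g x))\<^sup>2 \<le> (norm (f x) + norm (g x))\<^sup>2"
        by (intro power_mono norm_triangle_ineq) auto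
      also have "\<dots> \<le> 2 * (norm (f x))\<^sup>2 + 2 * (norm (g x))\<^sup>2"
        using sum_squares_bound[of "norm (f x)" "norm (g x)"] by (simp add: power2_sum)
      finally show "norm ((norm (f x + g x))\<^sup>2) \<le> norm (2 * (norm (f x))\<^sup>2 + 2 * (norm (g x))\<^sup>2)"
        by simp
    qed
  qed auto
  then show ?thesis by (simp add: sqint_def)
qed

lemma sqint_uminus: "sqint M f \<Longrightarrow> sqint M (\<lambda>x. - f x)"
  by (rule sqint_dominated[where B=1 and f=f]) auto

lemma sqint_diff: "sqint M f \<Longrightarrow> sqint M g \<Longrightarrow> sqint M (\<lambda>x. f x - g x)"
  using sqint_add[of M f "\<lambda>x. - g x"] sqint_uminus[of M g] by simp

lemma integrable_inner_sqint:
  fixes f g :: "'a \<Rightarrow> 'b::euclidean_space"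
  assumes f: "sqint M f" and g: "sqint M g"
  shows "integrable M (\<lambda>x. f x \<bullet> g x)"
proof (rule Bochner_Integration.integrable_bound)
  have [measurable]: "f \<in> borel_measurable M" "g \<in> borel_measurable M"
    using f g by (auto simp: sqint_def)
  show "integrable M (\<lambda>x. (norm (f x))\<^sup>2 + (norm (g x))\<^sup>2)"
    using sqint_integrable[OF f] sqint_integrable[OF g] by simp
  show "(\<lambda>x. f x \<bullet> g x) \<in> borel_measurable M" by measurable
  show "AE x in M. norm (f x \<bullet> g x) \<le> norm ((norm (f x))\<^sup>2 + (norm (g x))\<^sup>2)"
  proof (intro AE_I2)
    fix x
    have "\<bar>f x \<bullet> g x\<bar> \<le> norm (f x) * norm (g x)" by (rule Cauchy_Schwarz_ineq2)
    also have "\<dots> \<le> (norm (f x))\<^sup>2 + (norm (g x))\<^sup>2"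
    proof -
      have "0 \<le> norm (f x) * norm (g x)" by simp
      then show ?thesis using sum_squares_bound[of "norm (f x)" "norm (g x)"] by linarith
    qed
    finally show "norm (f x \<bullet> g x) \<le> norm ((norm (f x))\<^sup>2 + (norm (g x))\<^sup>2)" by simp
  qed
qed

text \<open>Take \<open>t = - b / c\<close>; for \<open>c = 0\<close> a nonnegative linear function is constant. Both Cauchy-Schwarz
  inequalities below are obtained in this way.\<close>

lemma quadratic_nonneg_imp:
  fixes a b c :: real
  assumes nn: "\<And>t. 0 \<le> a + 2 * t * b + t\<^sup>2 * c" and c: "0 \<le> c"
  shows "b\<^sup>2 \<le> a * c"
proof (cases "c = 0")
  case True
  have "b = 0"
  proof (rule ccontr)
    assume "b \<noteq> 0"
    then show False using nn[of "- (a + 1) / (2 * b)"] True by (simp add: field_simps)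
  qed
  then show ?thesis using True by simp
next
  case False
  have "0 \<le> c * (a + 2 * (- b / c) * b + (- b / c)\<^sup>2 * c)"
    using nn[of "- b / c"] c by simp
  also have "\<dots> = a * c - b\<^sup>2" using False by (simp add: field_simps power2_eq_square)
  finally show ?thesis by simp
qed

lemma l2norm_add_sq:
  fixes f g :: "'a \<Rightarrow> 'b::euclidean_space"
  assumes f: "sqint M f" and g: "sqint M g"
  shows "(l2norm M (\<lambda>x. f x + g x))\<^sup>2 =
    (l2norm M f)\<^sup>2 + 2 * (LINT x|M. f x \<bullet> g x) + (l2norm M g)\<^sup>2"
proof -
  have "(LINT x|M. (norm (f x + g x))\<^sup>2) =
      (LINT x|M. (norm (f x))\<^sup>2 + 2 * (f x \<bullet> g x) + (norm (g x))\<^sup>2)"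
    by (rule Bochner_Integration.integral_cong)
       (simp_all add: power2_norm_eq_inner inner_add_left inner_add_right inner_commute algebra_simps)
  also have "\<dots> = (LINT x|M. (norm (f x))\<^sup>2) + 2 * (LINT x|M. f x \<bullet> g x) + (LINT x|M. (norm (g x))\<^sup>2)"
    using sqint_integrable[OF f] sqint_integrable[OF g] integrable_inner_sqint[OF f g] by simp
  finally show ?thesis by (simp add: l2norm_sq)
qed

lemma sqint_scaleR: "sqint M f \<Longrightarrow> sqint M (\<lambda>x. c *\<^sub>R f x)"
  by (rule sqint_dominated[where B="\<bar>c\<bar>" and f=f]) auto

lemma l2norm_scaleR: "l2norm M (\<lambda>x. c *\<^sub>R f x) = \<bar>c\<bar> * l2norm M f"
  by (simp add: l2norm_def power_mult_distrib real_sqrt_mult)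

lemma l2norm_Cauchy_Schwarz:
  fixes f g :: "'a \<Rightarrow> 'b::euclidean_space"
  assumes f: "sqint M f" and g: "sqint M g"
  shows "\<bar>LINT x|M. f x \<bullet> g x\<bar> \<le> l2norm M f * l2norm M g"
proof -
  have "0 \<le> (l2norm M f)\<^sup>2 + 2 * t * (LINT x|M. f x \<bullet> g x) + t\<^sup>2 * (l2norm M g)\<^sup>2" for t
    using l2norm_add_sq[OF f sqint_scaleR[OF g, of t]] zero_le_power2[of "l2norm M (\<lambda>x. f x + t *\<^sub>R g x)"]
    by (simp add: l2norm_scaleR power_mult_distrib algebra_simps)
  from quadratic_nonneg_imp[OF this]
  have "(LINT x|M. f x \<bullet> g x)\<^sup>2 \<le> (l2norm M f * l2norm M g)\<^sup>2"
    by (simp add: power_mult_distrib)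
  then show ?thesis by (metis abs_le_square_iff abs_of_nonneg l2norm_nonneg mult_nonneg_nonneg)
qed

lemma l2norm_triangle:
  fixes f g :: "'a \<Rightarrow> 'b::euclidean_space"
  assumes f: "sqint M f" and g: "sqint M g"
  shows "l2norm M (\<lambda>x. f x + g x) \<le> l2norm M f + l2norm M g"
proof -
  have "(l2norm M (\<lambda>x. f x + g x))\<^sup>2 \<le> (l2norm M f + l2norm M g)\<^sup>2"
    using l2norm_add_sq[OF f g] l2norm_Cauchy_Schwarz[OF f g] by (simp add: power2_sum)
  then show ?thesis by (rule power2_le_imp_le) simp
qed

lemma l2norm_minus_commute: "l2norm M (\<lambda>x. f x - g x) = l2norm M (\<lambda>x. g x - f x)"
  by (simp add: l2norm_def norm_minus_commute)

lemma l2norm_triangle_via: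
  fixes f g h :: "'a \<Rightarrow> 'b::euclidean_space"
  assumes "sqint M f" "sqint M g" "sqint M h"
  shows "l2norm M (\<lambda>x. f x - h x) \<le> l2norm M (\<lambda>x. f x - g x) + l2norm M (\<lambda>x. g x - h x)"
  using l2norm_triangle[OF sqint_diff[OF assms(1,2)] sqint_diff[OF assms(2,3)]] by simp

lemma l2norm_diff_le:
  fixes f g :: "'a \<Rightarrow> 'b::euclidean_space"
  assumes "sqint M f" "sqint M g"
  shows "\<bar>l2norm M f - l2norm M g\<bar> \<le> l2norm M (\<lambda>x. f x - g x)"
  using l2norm_triangle[OF sqint_diff[OF assms(1,2)] assms(2)]
    l2norm_triangle[OF sqint_diff[OF assms(2,1)] assms(1)] l2norm_minus_commute[of M f g]
  by simp

lemma l2norm_eq_0_imp_AE: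
  assumes f: "sqint M f" and 0: "l2norm M f = 0"
  shows "AE x in M. f x = 0"
proof -
  have "(LINT x|M. (norm (f x))\<^sup>2) = 0" using 0 l2norm_sq[of M f] by simp
  then have "AE x in M. (norm (f x))\<^sup>2 = 0"
    using integral_nonneg_eq_0_iff_AE[OF sqint_integrable[OF f]] by simp
  then show ?thesis by simp
qed

lemma l2norm_tendsto:
  fixes f :: "'i \<Rightarrow> 'a \<Rightarrow> 'b::euclidean_space"
  assumes "\<And>n. sqint M (f n)" "sqint M g" "((\<lambda>n. l2norm M (\<lambda>x. f n x - g x)) \<longlongrightarrow> 0) F"
  shows "((\<lambda>n. l2norm M (f n)) \<longlongrightarrow> l2norm M g) F"
proof -
  have "((\<lambda>n. l2norm M (f n) - l2norm M g) \<longlongrightarrow> 0) F"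
    by (rule Lim_null_comparison[OF _ assms(3)])
       (use l2norm_diff_le[OF assms(1,2)] in auto)
  then show ?thesis by (simp add: LIM_zero_iff)
qed

lemma inner_integral_tendsto:
  fixes f :: "'i \<Rightarrow> 'a \<Rightarrow> 'b::euclidean_space"
  assumes f: "\<And>n. sqint M (f n)" and g: "sqint M g" and h: "sqint M h"
    and lim: "((\<lambda>n. l2norm M (\<lambda>x. f n x - g x)) \<longlongrightarrow> 0) F"
  shows "((\<lambda>n. LINT x|M. f n x \<bullet> h x) \<longlongrightarrow> (LINT x|M. g x \<bullet> h x)) F"
proof -
  have "((\<lambda>n. (LINT x|M. f n x \<bullet> h x) - (LINT x|M. g x \<bullet> h x)) \<longlongrightarrow> 0) F"
  proof (rule Lim_null_comparison)
    show "((\<lambda>n. l2norm M (\<lambda>x. f n x - g x) * l2norm M h) \<longlongrightarrow> 0) F"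
      using tendsto_mult_left_zero[OF lim] by simp
    show "\<forall>\<^sub>F n in F. norm ((LINT x|M. f n x \<bullet> h x) - (LINT x|M. g x \<bullet> h x))
        \<le> l2norm M (\<lambda>x. f n x - g x) * l2norm M h"
      using l2norm_Cauchy_Schwarz[OF sqint_diff[OF f g] h]
        integrable_inner_sqint[OF f h] integrable_inner_sqint[OF g h]
      by (auto simp: inner_diff_left)
  qed
  then show ?thesis by (simp add: LIM_zero_iff)
qed

text \<open>The Riesz-Fischer argument. Passing to a subsequence with \<open>\<parallel>f\<^sub>n\<^sub>+\<^sub>1 - f\<^sub>n\<parallel> \<le> 2\<^sup>-\<^sup>n\<close>, the function
  \<open>\<Sum>n. 2\<^sup>n |f\<^sub>n\<^sub>+\<^sub>1 - f\<^sub>n|\<^sup>2\<close> is integrable, so almost everywhere the increments decay geometrically;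
  the pointwise limit is the \<open>L\<^sup>2\<close> limit by Fatou's lemma.\<close>

lemma l2_complete:
  fixes f :: "nat \<Rightarrow> 'a \<Rightarrow> 'b::euclidean_space"
  assumes f: "\<And>n. sqint M (f n)"
    and C: "\<And>e. e > 0 \<Longrightarrow> \<exists>N. \<forall>m\<ge>N. \<forall>n\<ge>N. l2norm M (\<lambda>x. f m x - f n x) < e"
  obtains g where "sqint M g" "(\<lambda>n. l2norm M (\<lambda>x. f n x - g x)) \<longlonglongrightarrow> 0"
proof -
  have [measurable]: "\<And>n. f n \<in> borel_measurable M" using f by (auto simp: sqint_def)
  have "\<forall>k. \<exists>N. \<forall>m\<ge>N. \<forall>n\<ge>N. l2norm M (\<lambda>x. f m x - f n x) < (1/2)^k"
    using C by simp
  then obtain N where N: "\<And>k m n. m \<ge> N k \<Longrightarrow> n \<ge> N k \<Longrightarrow> l2norm M (\<lambda>x. f m x - f n x) < (1/2)^k"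
    by metis
  define s where "s k = (\<Sum>i\<le>k. N i) + k" for k
  have s_mono: "s k \<le> s (Suc k)" for k by (simp add: s_def)
  have sN: "N k \<le> s k" for k
    unfolding s_def using member_le_sum[of k "{..k}" N] by simp
  have s_ge: "k \<le> s k" for k by (simp add: s_def)
  define d where "d k x = norm (f (s (Suc k)) x - f (s k) x)" for k x
  have [measurable]: "d k \<in> borel_measurable M" for k unfolding d_def by measurable
  have dint: "integrable M (\<lambda>x. (d k x)\<^sup>2)" for k
    unfolding d_def by (rule sqint_integrable[OF sqint_diff[OF f f]])
  have dle: "(LINT x|M. (d k x)\<^sup>2) \<le> (1/4)^k" for k
  proof -
    have "l2norm M (\<lambda>x. f (s (Suc k)) x - f (s k) x) \<le> (1/2)^k"
      using N[of k "s (Suc k)" "s k"] sN[of k] s_mono[of k] by simp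
    then have "(l2norm M (\<lambda>x. f (s (Suc k)) x - f (s k) x))\<^sup>2 \<le> ((1/2)^k)\<^sup>2"
      by (intro power_mono) auto
    moreover have "((1/2)^k)\<^sup>2 = (1/4::real)^k"
      by (simp add: power2_eq_square power_mult_distrib[symmetric])
    ultimately show ?thesis by (simp add: l2norm_sq d_def)
  qed
  have "(\<integral>\<^sup>+x. (\<Sum>k. ennreal (2^k * (d k x)\<^sup>2)) \<partial>M) = (\<Sum>k. \<integral>\<^sup>+x. ennreal (2^k * (d k x)\<^sup>2) \<partial>M)"
    by (rule nn_integral_suminf) simp
  also have "\<dots> \<le> (\<Sum>k. ennreal ((1/2)^k))"
  proof (intro suminf_le)
    fix k
    have "(\<integral>\<^sup>+x. ennreal (2^k * (d k x)\<^sup>2) \<partial>M) = ennreal (LINT x|M. 2^k * (d k x)\<^sup>2)"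
      by (rule nn_integral_eq_integral) (use dint in auto)
    also have "(LINT x|M. 2^k * (d k x)\<^sup>2) \<le> 2^k * (1/4)^k"
      using dle[of k] by simp
    also have "2^k * (1/4)^k = (1/2::real)^k" by (simp add: power_mult_distrib[symmetric])
    finally show "(\<integral>\<^sup>+x. ennreal (2^k * (d k x)\<^sup>2) \<partial>M) \<le> ennreal ((1/2)^k)"
      by (simp add: ennreal_leI)
  qed auto
  also have "\<dots> = ennreal (\<Sum>k. (1/2)^k)"
    by (rule suminf_ennreal2) (auto intro: summable_geometric)
  also have "\<dots> < \<infinity>" by simp
  finally have fin: "(\<integral>\<^sup>+x. (\<Sum>k. ennreal (2^k * (d k x)\<^sup>2)) \<partial>M) \<noteq> \<infinity>" by simp
  have AEfin: "AE x in M. (\<Sum>k. ennreal (2^k * (d k x)\<^sup>2)) \<noteq> \<infinity>"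
    by (rule nn_integral_noteq_infinite[OF _ fin]) simp
  have conv: "AE x in M. convergent (\<lambda>k. f (s k) x)"
    using AEfin
  proof eventually_elim
    case (elim x)
    have sm: "summable (\<lambda>k. 2^k * (d k x)\<^sup>2)"
      by (rule summable_suminf_not_top) (use elim in auto)
    have "\<exists>B. \<forall>k. 2^k * (d k x)\<^sup>2 \<le> B"
    proof -
      have "Bseq (\<lambda>k. 2^k * (d k x)\<^sup>2)"
        using summable_LIMSEQ_zero[OF sm] by (rule convergent_imp_Bseq[OF convergentI])
      then show ?thesis by (auto simp: Bseq_def)
    qed
    then obtain B where B: "\<And>k. 2^k * (d k x)\<^sup>2 \<le> B" by blast
    have B0: "0 \<le> B" using B[of 0] by (rule order_trans[rotated]) simp
    have "d k x \<le> sqrt B * (sqrt (1/2))^k" for k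
    proof -
      have "(d k x)\<^sup>2 \<le> B * (1/2)^k"
        using B[of k] by (simp add: power_divide field_simps)
      then have "sqrt ((d k x)\<^sup>2) \<le> sqrt (B * (1/2)^k)" by (rule real_sqrt_le_mono)
      then show ?thesis by (simp add: d_def real_sqrt_mult real_sqrt_power)
    qed
    then have "summable (\<lambda>k. f (s (Suc k)) x - f (s k) x)"
      by (intro summable_comparison_test[OF _ summable_mult[OF summable_geometric[of "sqrt (1/2)"]], of _ "sqrt B"])
         (auto simp: d_def real_sqrt_lt_1_iff)
    then have "convergent (\<lambda>n. \<Sum>k<n. f (s (Suc k)) x - f (s k) x)"
      by (simp add: summable_iff_convergent)
    moreover have "(\<lambda>n. \<Sum>k<n. f (s (Suc k)) x - f (s k) x) = (\<lambda>n. f (s n) x - f (s 0) x)"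
      using sum_lessThan_telescope[of "\<lambda>k. f (s k) x"] by simp
    ultimately have "convergent (\<lambda>n. f (s n) x - f (s 0) x)" by simp
    then have "convergent (\<lambda>n. (f (s n) x - f (s 0) x) + f (s 0) x)"
      by (intro convergent_add convergent_const)
    then show ?case by simp
  qed
  define g where "g x = lim (\<lambda>k. f (s k) x)" for x
  have gm[measurable]: "g \<in> borel_measurable M"
    unfolding g_def by (rule borel_measurable_lim_metric) simp
  have lim: "AE x in M. (\<lambda>k. f (s k) x) \<longlonglongrightarrow> g x"
    using conv by eventually_elim (simp add: g_def convergent_LIMSEQ_iff)
  have fatou: "(\<integral>\<^sup>+x. ennreal ((norm (f n x - g x))\<^sup>2) \<partial>M) \<le> ennreal (e\<^sup>2)"
    if e: "e > 0" and n: "\<forall>m\<ge>K. l2norm M (\<lambda>x. f n x - f m x) < e" for n e K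
  proof -
    have "(\<integral>\<^sup>+x. ennreal ((norm (f n x - g x))\<^sup>2) \<partial>M)
        = (\<integral>\<^sup>+x. liminf (\<lambda>k. ennreal ((norm (f n x - f (s k) x))\<^sup>2)) \<partial>M)"
    proof (rule nn_integral_cong_AE)
      show "AE x in M. ennreal ((norm (f n x - g x))\<^sup>2) = liminf (\<lambda>k. ennreal ((norm (f n x - f (s k) x))\<^sup>2))"
        using lim
      proof eventually_elim
        case (elim x)
        have "(\<lambda>k. ennreal ((norm (f n x - f (s k) x))\<^sup>2)) \<longlonglongrightarrow> ennreal ((norm (f n x - g x))\<^sup>2)"
          by (intro tendsto_intros elim)
        from lim_imp_Liminf[OF sequentially_bot this] show ?case by (rule sym)
      qed
    qed
    also have "\<dots> \<le> liminf (\<lambda>k. \<integral>\<^sup>+x. ennreal ((norm (f n x - f (s k) x))\<^sup>2) \<partial>M)"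
      by (rule nn_integral_liminf) simp
    also have "\<dots> \<le> ennreal (e\<^sup>2)"
    proof (rule Liminf_le)
      show "\<forall>\<^sub>F k in sequentially. (\<integral>\<^sup>+x. ennreal ((norm (f n x - f (s k) x))\<^sup>2) \<partial>M) \<le> ennreal (e\<^sup>2)"
        using eventually_ge_at_top[of K]
      proof eventually_elim
        case (elim k)
        have "(\<integral>\<^sup>+x. ennreal ((norm (f n x - f (s k) x))\<^sup>2) \<partial>M) = ennreal ((l2norm M (\<lambda>x. f n x - f (s k) x))\<^sup>2)"
          unfolding l2norm_sq
          by (rule nn_integral_eq_integral) (use sqint_integrable[OF sqint_diff[OF f f]] in auto)
        also have "\<dots> \<le> ennreal (e\<^sup>2)"
        proof (intro ennreal_leI power_mono)
          show "l2norm M (\<lambda>x. f n x - f (s k) x) \<le> e" using n[rule_format, of "s k"] s_ge[of k] elim by simp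
        qed simp
        finally show ?case .
      qed
    qed simp
    finally show ?thesis .
  qed
  have sq_of: "integrable M (\<lambda>x. (norm (f n x - g x))\<^sup>2) \<and> l2norm M (\<lambda>x. f n x - g x) \<le> e"
    if e: "e > 0" and n: "\<forall>m\<ge>K. l2norm M (\<lambda>x. f n x - f m x) < e" for n e K
  proof
    note F = fatou[OF that]
    show i: "integrable M (\<lambda>x. (norm (f n x - g x))\<^sup>2)"
    proof (rule integrableI_nonneg)
      show "(\<integral>\<^sup>+x. ennreal ((norm (f n x - g x))\<^sup>2) \<partial>M) < \<infinity>"
        using F by (rule le_less_trans) simp
    qed simp_all
    have "(LINT x|M. (norm (f n x - g x))\<^sup>2) \<le> e\<^sup>2"
      using F unfolding nn_integral_eq_integral[OF i AE_I2[OF zero_le_power2]]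
      by (simp add: ennreal_le_iff)
    then have "(l2norm M (\<lambda>x. f n x - g x))\<^sup>2 \<le> e\<^sup>2" by (simp add: l2norm_sq)
    then show "l2norm M (\<lambda>x. f n x - g x) \<le> e"
      by (rule power2_le_imp_le) (use e in simp)
  qed
  have tend: "(\<lambda>n. l2norm M (\<lambda>x. f n x - g x)) \<longlonglongrightarrow> 0"
  proof (rule LIMSEQ_I)
    fix r :: real assume "r > 0"
    then obtain K where "\<forall>m\<ge>K. \<forall>n\<ge>K. l2norm M (\<lambda>x. f m x - f n x) < r/2" using C[of "r/2"] by auto
    then have "l2norm M (\<lambda>x. f n x - g x) \<le> r/2" if "n \<ge> K" for n
      using sq_of[of "r/2" K n] that \<open>r > 0\<close> by simp
    then show "\<exists>no. \<forall>n\<ge>no. norm (l2norm M (\<lambda>x. f n x - g x) - 0) < r"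
      using \<open>r > 0\<close> by (intro exI[of _ K] allI impI) (simp add: le_less_trans[of _ "r/2"])
  qed
  obtain K where K: "\<forall>m\<ge>K. \<forall>n\<ge>K. l2norm M (\<lambda>x. f m x - f n x) < 1" using C[of 1] by auto
  then have "integrable M (\<lambda>x. (norm (f K x - g x))\<^sup>2)" using sq_of[of 1 K K] by simp
  then have "sqint M (\<lambda>x. f K x - g x)" by (simp add: sqint_def)
  from sqint_diff[OF f[of K] this] have "sqint M g" by simp
  with tend that show ?thesis by blast
qed

section \<open>Functions of class \<open>C\<^sup>k\<close> on an open set\<close>

definition pd :: "2 \<Rightarrow> (real^2 \<Rightarrow> complex) \<Rightarrow> real^2 \<Rightarrow> complex" where
  "pd i f x = frechet_derivative f (at x) (axis i 1)"

text \<open>The recursion of \<open>C_k\<close>, relative to an open set: test functions are multiplied by factors such as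
  \<open>|x - a|\<^sup>-\<^sup>2\<close> that are smooth away from one point only.\<close>

fun Ck_on :: "nat \<Rightarrow> (real^2) set \<Rightarrow> (real^2 \<Rightarrow> complex) \<Rightarrow> bool" where
  "Ck_on 0 U f \<longleftrightarrow> continuous_on U f"
| "Ck_on (Suc k) U f \<longleftrightarrow> (\<forall>x\<in>U. f differentiable (at x)) \<and> (\<forall>i. Ck_on k U (pd i f))"

definition smooth_on :: "(real^2) set \<Rightarrow> (real^2 \<Rightarrow> complex) \<Rightarrow> bool" where
  "smooth_on U f \<longleftrightarrow> (\<forall>k. Ck_on k U f)"

definition rsmooth_on :: "(real^2) set \<Rightarrow> (real^2 \<Rightarrow> real) \<Rightarrow> bool" where
  "rsmooth_on U f \<longleftrightarrow> smooth_on U (\<lambda>x. complex_of_real (f x))"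

lemma C_k_eq_Ck_on: "C_k k f \<longleftrightarrow> Ck_on k UNIV f"
  by (induction k arbitrary: f) (auto simp: pd_def[abs_def])

lemma pd_eq: "(f has_derivative D) (at x) \<Longrightarrow> pd i f x = D (axis i 1)"
  unfolding pd_def by (metis frechet_derivative_at)

lemma pd_cong_open:
  assumes "open U" "x \<in> U" "\<And>y. y \<in> U \<Longrightarrow> f y = g y"
  shows "pd i f x = pd i g x"
proof -
  have "(f has_derivative D) (at x) \<longleftrightarrow> (g has_derivative D) (at x)" for D
    using assms has_derivative_transform_within_open[of f D x UNIV U g]
      has_derivative_transform_within_open[of g D x UNIV U f] by auto
  then show ?thesis by (simp add: pd_def frechet_derivative_def)
qed

lemma differentiable_cong_open:
  assumes "open U" "x \<in> U" "\<And>y. y \<in> U \<Longrightarrow> f y = g y" "f differentiable (at x)"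
  shows "g differentiable (at x)"
  using assms has_derivative_transform_within_open[of f _ x UNIV U g]
  unfolding differentiable_def by blast

lemma Ck_on_cong:
  assumes "open U" "\<And>x. x \<in> U \<Longrightarrow> f x = g x" "Ck_on k U f"
  shows "Ck_on k U g"
  using assms(2,3)
proof (induction k arbitrary: f g)
  case 0
  then show ?case using continuous_on_cong[of U U f g] by simp
next
  case (Suc k)
  have "Ck_on k U (pd i g)" for i
  proof (rule Suc.IH)
    show "pd i f x = pd i g x" if "x \<in> U" for x
      using pd_cong_open[OF assms(1) that] Suc.prems(1) by blast
    show "Ck_on k U (pd i f)" using Suc.prems by simp
  qed
  moreover have "g differentiable (at x)" if "x \<in> U" for x
    using differentiable_cong_open[OF assms(1) that, of f g] Suc.prems that by simp
  ultimately show ?case by simp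
qed

lemma Ck_on_subset: "Ck_on k U f \<Longrightarrow> V \<subseteq> U \<Longrightarrow> Ck_on k V f"
  by (induction k arbitrary: f) (auto intro: continuous_on_subset)

lemma Ck_on_Un: "open U \<Longrightarrow> open V \<Longrightarrow> Ck_on k U f \<Longrightarrow> Ck_on k V f \<Longrightarrow> Ck_on k (U \<union> V) f"
  by (induction k arbitrary: f) (auto intro: continuous_on_open_Un)

lemma Ck_on_0: "Ck_on k U f \<Longrightarrow> Ck_on 0 U f"
  by (cases k) (auto intro!: continuous_at_imp_continuous_on differentiable_imp_continuous_within)

lemma Ck_on_SucD: "Ck_on (Suc k) U f \<Longrightarrow> Ck_on k U f"
proof (induction k arbitrary: f)
  case 0
  then show ?case by (rule Ck_on_0)
next
  case (Suc k)
  then show ?case by (metis Ck_on.simps(2))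
qed

lemma Ck_on_SucI:
  assumes "open U" "\<And>x. x \<in> U \<Longrightarrow> (f has_derivative D x) (at x)"
    and "\<And>i. Ck_on k U (\<lambda>x. D x (axis i 1))"
  shows "Ck_on (Suc k) U f"
proof -
  have "Ck_on k U (pd i f)" for i
    by (rule Ck_on_cong[OF assms(1) _ assms(3)[of i]]) (use pd_eq[OF assms(2)] in simp)
  moreover have "f differentiable (at x)" if "x \<in> U" for x
    using assms(2)[OF that] unfolding differentiable_def by blast
  ultimately show ?thesis by simp
qed

lemma has_derivative_frechet:
  "Ck_on (Suc k) U f \<Longrightarrow> x \<in> U \<Longrightarrow> (f has_derivative frechet_derivative f (at x)) (at x)"
  by (simp add: frechet_derivative_works)

lemma Ck_on_const: "open U \<Longrightarrow> Ck_on k U (\<lambda>x. c)"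
proof (induction k arbitrary: c)
  case (Suc k)
  show ?case by (rule Ck_on_SucI[where D="\<lambda>x h. 0"]) (use Suc in auto)
qed auto

lemma Ck_on_coord: "open U \<Longrightarrow> Ck_on k U (\<lambda>x. complex_of_real (x $ i))"
proof (cases k)
  case (Suc m)
  assume U: "open U"
  have "((\<lambda>x::real^2. complex_of_real (x $ i)) has_derivative (\<lambda>h. complex_of_real (h $ i))) (at x)" for x
    by (intro derivative_intros bounded_linear_imp_has_derivative bounded_linear_compose[OF bounded_linear_of_real] bounded_linear_vec_nth)
  then show ?thesis unfolding Suc
    by (rule Ck_on_SucI[OF U]) (rule Ck_on_const[OF U])
qed (auto intro!: continuous_intros)

lemma Ck_on_add:
  assumes "open U" "Ck_on k U f" "Ck_on k U g"
  shows "Ck_on k U (\<lambda>x. f x + g x)"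
  using assms(2,3)
proof (induction k arbitrary: f g)
  case 0 then show ?case by (auto intro: continuous_on_add)
next
  case (Suc k)
  show ?case
  proof (rule Ck_on_SucI[OF assms(1)])
    fix x assume "x \<in> U"
    then show "((\<lambda>x. f x + g x) has_derivative
        (\<lambda>h. frechet_derivative f (at x) h + frechet_derivative g (at x) h)) (at x)"
      by (intro has_derivative_add has_derivative_frechet[OF Suc.prems(1)] has_derivative_frechet[OF Suc.prems(2)])
  next
    fix i show "Ck_on k U (\<lambda>x. frechet_derivative f (at x) (axis i 1) + frechet_derivative g (at x) (axis i 1))"
      using Suc unfolding pd_def[symmetric] by simp
  qed
qed

lemma Ck_on_mult:
  assumes "open U" "Ck_on k U f" "Ck_on k U g"
  shows "Ck_on k U (\<lambda>x. f x * g x)"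
  using assms(2,3)
proof (induction k arbitrary: f g)
  case 0 then show ?case by (auto intro: continuous_on_mult)
next
  case (Suc k)
  show ?case
  proof (rule Ck_on_SucI[OF assms(1)])
    fix x assume "x \<in> U"
    then show "((\<lambda>x. f x * g x) has_derivative
        (\<lambda>h. f x * frechet_derivative g (at x) h + frechet_derivative f (at x) h * g x)) (at x)"
      by (intro has_derivative_mult has_derivative_frechet[OF Suc.prems(1)] has_derivative_frechet[OF Suc.prems(2)])
  next
    fix i
    have "Ck_on k U f" "Ck_on k U g" using Suc.prems Ck_on_SucD by blast+
    then show "Ck_on k U (\<lambda>x. f x * frechet_derivative g (at x) (axis i 1) + frechet_derivative f (at x) (axis i 1) * g x)"
      using Suc unfolding pd_def[symmetric] by (intro Ck_on_add[OF assms(1)] Suc.IH) auto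
  qed
qed

text \<open>The outer function is taken from a family that is closed under differentiation, because the
  induction on the order replaces it by its derivative. Such a family can be written down even where
  the higher derivatives have no convenient closed form.\<close>

lemma Ck_on_compose:
  fixes g :: "real^2 \<Rightarrow> real"
  assumes U: "open U" and g: "Ck_on k U (\<lambda>x. complex_of_real (g x))"
    and fam: "\<And>G. G \<in> \<G> \<Longrightarrow> \<exists>G'\<in>\<G>. \<forall>t\<in>T. (G has_real_derivative G' t) (at t)"
    and T: "\<And>x. x \<in> U \<Longrightarrow> g x \<in> T" and G: "G \<in> \<G>"
  shows "Ck_on k U (\<lambda>x. complex_of_real (G (g x)))"
  using g G
proof (induction k arbitrary: G)
  case 0
  obtain G' where "\<forall>t\<in>T. (G has_real_derivative G' t) (at t)" using fam[OF 0(2)] by blast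
  then have "continuous_on T G"
    by (meson DERIV_isCont continuous_at_imp_continuous_on)
  moreover have "continuous_on U g"
    using continuous_on_Re[of U "\<lambda>x. complex_of_real (g x)"] 0(1) by simp
  ultimately have "continuous_on U (\<lambda>x. G (g x))"
    using T by (intro continuous_on_compose2[of T G U g]) auto
  then show ?case by (auto intro: continuous_intros)
next
  case (Suc k)
  obtain G' where G': "G' \<in> \<G>" "\<forall>t\<in>T. (G has_real_derivative G' t) (at t)"
    using fam[OF Suc.prems(2)] by blast
  let ?g = "\<lambda>x. complex_of_real (g x)"
  have d: "((\<lambda>x. complex_of_real (G (g x))) has_derivative
      (\<lambda>h. frechet_derivative ?g (at x) h * complex_of_real (G' (g x)))) (at x)" if "x \<in> U" for x
  proof -
    let ?D = "frechet_derivative ?g (at x)"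
    have D: "(?g has_derivative ?D) (at x)"
      using has_derivative_frechet[OF Suc.prems(1) that] .
    have "((\<lambda>x. Re (?g x)) has_derivative (\<lambda>h. Re (?D h))) (at x)"
      by (rule has_derivative_Re[OF D])
    then have Dg: "(g has_derivative (\<lambda>h. Re (?D h))) (at x)" by simp
    have "(?g has_derivative (\<lambda>h. complex_of_real (Re (?D h)))) (at x)"
      by (rule has_derivative_of_real[OF Dg])
    then have e: "?D = (\<lambda>h. complex_of_real (Re (?D h)))"
      using D has_derivative_unique by blast
    have "((\<lambda>x. G (g x)) has_derivative (\<lambda>h. Re (?D h) * G' (g x))) (at x)"
      by (rule DERIV_compose_FDERIV[OF _ Dg]) (use G' T that in auto)
    then have "((\<lambda>x. complex_of_real (G (g x))) has_derivative (\<lambda>h. complex_of_real (Re (?D h) * G' (g x)))) (at x)"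
      by (rule has_derivative_of_real)
    then show ?thesis using e by (metis (no_types, lifting) ext of_real_mult)
  qed
  show ?case
  proof (rule Ck_on_SucI[OF U d])
    fix i
    show "Ck_on k U (\<lambda>x. frechet_derivative ?g (at x) (axis i 1) * complex_of_real (G' (g x)))"
      using Suc.prems(1) Suc.IH[OF Ck_on_SucD[OF Suc.prems(1)] G'(1)]
      unfolding pd_def[symmetric] by (intro Ck_on_mult[OF U]) auto
  qed
qed

lemma smooth_on_cong: "open U \<Longrightarrow> (\<And>x. x \<in> U \<Longrightarrow> f x = g x) \<Longrightarrow> smooth_on U f \<Longrightarrow> smooth_on U g"
  unfolding smooth_on_def using Ck_on_cong by blast

lemma smooth_on_subset: "smooth_on U f \<Longrightarrow> V \<subseteq> U \<Longrightarrow> smooth_on V f"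
  unfolding smooth_on_def using Ck_on_subset by blast

lemma smooth_on_Un: "open U \<Longrightarrow> open V \<Longrightarrow> smooth_on U f \<Longrightarrow> smooth_on V f \<Longrightarrow> smooth_on (U \<union> V) f"
  unfolding smooth_on_def using Ck_on_Un by blast

lemma smooth_on_const: "open U \<Longrightarrow> smooth_on U (\<lambda>x. c)"
  unfolding smooth_on_def using Ck_on_const by blast

lemma smooth_on_add: "open U \<Longrightarrow> smooth_on U f \<Longrightarrow> smooth_on U g \<Longrightarrow> smooth_on U (\<lambda>x. f x + g x)"
  unfolding smooth_on_def using Ck_on_add by blast

lemma smooth_on_mult: "open U \<Longrightarrow> smooth_on U f \<Longrightarrow> smooth_on U g \<Longrightarrow> smooth_on U (\<lambda>x. f x * g x)"
  unfolding smooth_on_def using Ck_on_mult by blast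

lemma smooth_on_pd: "smooth_on U f \<Longrightarrow> smooth_on U (pd i f)"
  unfolding smooth_on_def by (metis Ck_on.simps(2))

lemma smooth_on_has_derivative:
  "smooth_on U f \<Longrightarrow> x \<in> U \<Longrightarrow> (f has_derivative frechet_derivative f (at x)) (at x)"
  unfolding smooth_on_def using has_derivative_frechet by blast

lemma smooth_on_continuous: "smooth_on U f \<Longrightarrow> continuous_on U f"
  unfolding smooth_on_def by (metis Ck_on.simps(1))

lemma rsmooth_on_const: "open U \<Longrightarrow> rsmooth_on U (\<lambda>x. c)"
  unfolding rsmooth_on_def by (rule smooth_on_const)

lemma rsmooth_on_coord: "open U \<Longrightarrow> rsmooth_on U (\<lambda>x. x $ i)"
  unfolding rsmooth_on_def smooth_on_def using Ck_on_coord by blast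

lemma rsmooth_on_add: "open U \<Longrightarrow> rsmooth_on U f \<Longrightarrow> rsmooth_on U g \<Longrightarrow> rsmooth_on U (\<lambda>x. f x + g x)"
  unfolding rsmooth_on_def using smooth_on_add[of U "\<lambda>x. complex_of_real (f x)" "\<lambda>x. complex_of_real (g x)"] by simp

lemma rsmooth_on_mult: "open U \<Longrightarrow> rsmooth_on U f \<Longrightarrow> rsmooth_on U g \<Longrightarrow> rsmooth_on U (\<lambda>x. f x * g x)"
  unfolding rsmooth_on_def using smooth_on_mult[of U "\<lambda>x. complex_of_real (f x)" "\<lambda>x. complex_of_real (g x)"] by simp

lemma rsmooth_on_diff: "open U \<Longrightarrow> rsmooth_on U f \<Longrightarrow> rsmooth_on U g \<Longrightarrow> rsmooth_on U (\<lambda>x. f x - g x)"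
  using rsmooth_on_add[of U f "\<lambda>x. (-1) * g x"] rsmooth_on_mult[of U "\<lambda>x. -1" g] rsmooth_on_const[of U "-1"]
  by simp

lemma rsmooth_on_compose:
  assumes "open U" "rsmooth_on U g"
    and "\<And>G. G \<in> \<G> \<Longrightarrow> \<exists>G'\<in>\<G>. \<forall>t\<in>T. (G has_real_derivative G' t) (at t)"
    and "\<And>x. x \<in> U \<Longrightarrow> g x \<in> T" and "G \<in> \<G>"
  shows "rsmooth_on U (\<lambda>x. G (g x))"
  unfolding rsmooth_on_def smooth_on_def
proof
  fix k
  have "Ck_on k U (\<lambda>x. complex_of_real (g x))"
    using assms(2) unfolding rsmooth_on_def smooth_on_def by blast
  then show "Ck_on k U (\<lambda>x. complex_of_real (G (g x)))"
    by (rule Ck_on_compose[OF assms(1) _ assms(3,4,5)])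
qed

section \<open>Smooth functions of one variable\<close>

text \<open>Families closed under differentiation on the positive half line: the logarithm together with the
  multiples of inverse powers, and below the functions \<open>p(1/t) e\<^sup>-\<^sup>1\<^sup>/\<^sup>t\<close> with a polynomial \<open>p\<close>.\<close>

definition ipow_family :: "(real \<Rightarrow> real) set" where
  "ipow_family = insert ln {\<lambda>t. c * inverse t ^ n |c n. True}"

lemma ipow_family_mem: "(\<lambda>t. c * inverse t ^ n) \<in> ipow_family"
  by (auto simp: ipow_family_def)

lemma ipow_family_deriv:
  assumes "G \<in> ipow_family"
  shows "\<exists>G'\<in>ipow_family. \<forall>t\<in>{0<..}. (G has_real_derivative G' t) (at t)"
proof (cases "G = ln")
  case True
  have "(ln has_real_derivative 1 * inverse t ^ 1) (at t)" if "t > 0" for t :: real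
    using that by (auto intro!: derivative_eq_intros simp: field_simps)
  then show ?thesis using True by (intro bexI[OF _ ipow_family_mem[of 1 1]]) blast
next
  case False
  then obtain c n where G: "G = (\<lambda>t. c * inverse t ^ n)" using assms by (auto simp: ipow_family_def)
  have "((\<lambda>t. c * inverse t ^ n) has_real_derivative (- c * real n) * inverse t ^ (n + 1)) (at t)" if "t > 0" for t :: real
    using DERIV_cmult[OF DERIV_power[OF DERIV_inverse[of t UNIV], of n], of c] that
    by (cases n) (simp_all add: algebra_simps)
  then show ?thesis unfolding G
    by (intro bexI[OF _ ipow_family_mem[of "- c * real n" "n + 1"]]) auto
qed

lemma rsmooth_on_ln:
  assumes "open U" "rsmooth_on U g" "\<And>x. x \<in> U \<Longrightarrow> 0 < g x"
  shows "rsmooth_on U (\<lambda>x. ln (g x))"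
  by (rule rsmooth_on_compose[OF assms(1,2) ipow_family_deriv]) (use assms(3) in \<open>auto simp: ipow_family_def\<close>)

lemma rsmooth_on_inverse:
  assumes "open U" "rsmooth_on U g" "\<And>x. x \<in> U \<Longrightarrow> 0 < g x"
  shows "rsmooth_on U (\<lambda>x. inverse (g x))"
proof -
  have "rsmooth_on U (\<lambda>x. 1 * inverse (g x) ^ 1)"
    by (rule rsmooth_on_compose[OF assms(1,2) ipow_family_deriv _ ipow_family_mem[of 1 1]])
       (use assms(3) in auto)
  then show ?thesis by simp
qed

definition expinv :: "real poly \<Rightarrow> real \<Rightarrow> real" where
  "expinv p t = (if 0 < t then poly p (inverse t) * exp (- inverse t) else 0)"

definition flat :: "real \<Rightarrow> real" where
  "flat t = (if 0 < t then exp (- inverse t) else 0)"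

lemma flat_eq: "flat = expinv 1"
  by (auto simp: flat_def expinv_def)

lemma poly_exp_tendsto_0: "((\<lambda>s. poly p s * exp (- s)) \<longlongrightarrow> 0) (at_top :: real filter)"
proof -
  have "((\<lambda>s. \<Sum>i\<le>degree p. coeff p i * (s ^ i / exp s)) \<longlongrightarrow> (\<Sum>i\<le>degree p. coeff p i * 0)) (at_top :: real filter)"
    by (intro tendsto_sum tendsto_mult tendsto_const tendsto_power_div_exp_0)
  moreover have "(\<lambda>s::real. \<Sum>i\<le>degree p. coeff p i * (s ^ i / exp s)) = (\<lambda>s. poly p s * exp (- s))"
    by (simp add: poly_altdef sum_distrib_right exp_minus divide_inverse mult.assoc)
  ultimately show ?thesis by simp
qed

lemma expinv_deriv:
  "(expinv p has_real_derivative expinv ([:0, 0, 1:] * (p - pderiv p)) t) (at t)"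
proof -
  consider "t > 0" | "t < 0" | "t = 0" by linarith
  then show ?thesis
  proof cases
    case 1
    have "((\<lambda>t. poly p (inverse t) * exp (- inverse t)) has_real_derivative
        expinv ([:0, 0, 1:] * (p - pderiv p)) t) (at t)"
      unfolding expinv_def using 1
      by (auto intro!: derivative_eq_intros poly_DERIV[THEN DERIV_chain2] simp: algebra_simps power2_eq_square)
    then show ?thesis
      by (rule has_field_derivative_transform_within_open[where S="{0<..}"]) (use 1 in \<open>auto simp: expinv_def\<close>)
  next
    case 2
    have "((\<lambda>t. 0) has_real_derivative expinv ([:0, 0, 1:] * (p - pderiv p)) t) (at t)"
      using 2 by (simp add: expinv_def)
    then show ?thesis
      by (rule has_field_derivative_transform_within_open[where S="{..<0}"]) (use 2 in \<open>auto simp: expinv_def\<close>)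
  next
    case 3
    have L: "((\<lambda>h. expinv p h / h) \<longlongrightarrow> 0) (at_left 0)"
      by (rule tendsto_eventually) (auto simp: eventually_at_left_field expinv_def intro!: exI[of _ "-1"])
    have "((\<lambda>h. poly ([:0, 1:] * p) (inverse h) * exp (- inverse h)) \<longlongrightarrow> 0) (at_right (0::real))"
      using filterlim_compose[OF poly_exp_tendsto_0[of "[:0,1:] * p"] filterlim_inverse_at_top_right] .
    then have R: "((\<lambda>h. expinv p h / h) \<longlongrightarrow> 0) (at_right 0)"
      by (rule Lim_transform_eventually)
         (auto simp: eventually_at_right_field expinv_def divide_inverse intro!: exI[of _ 1])
    have "((\<lambda>h. expinv p h / h) \<longlongrightarrow> 0) (at 0)"
      using L R by (simp add: filterlim_split_at)
    moreover have "expinv q 0 = 0" for q by (simp add: expinv_def)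
    ultimately show ?thesis using 3 by (simp add: DERIV_def)
  qed
qed

lemma rsmooth_on_flat:
  assumes "open U" "rsmooth_on U g"
  shows "rsmooth_on U (\<lambda>x. flat (g x))"
  unfolding flat_eq
  by (rule rsmooth_on_compose[OF assms, where \<G>="range expinv" and T=UNIV]) (use expinv_deriv in blast)+

text \<open>With \<open>s = 1/t\<close> the derivative is \<open>s\<^sup>2 e\<^sup>-\<^sup>s\<close>, and \<open>e\<^sup>s \<ge> s\<^sup>2/2\<close>.\<close>

lemma flat_deriv_bound:
  "\<exists>d. (flat has_real_derivative d) (at t) \<and> \<bar>d\<bar> \<le> 2"
proof (intro exI conjI)
  show "(flat has_real_derivative expinv ([:0, 0, 1:] * (1 - pderiv 1)) t) (at t)"
    unfolding flat_eq by (rule expinv_deriv)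
  show "\<bar>expinv ([:0, 0, 1:] * (1 - pderiv 1)) t\<bar> \<le> 2"
  proof (cases "t > 0")
    case True
    let ?s = "inverse t"
    have "1 + ?s + ?s\<^sup>2 / 2 \<le> exp ?s" by (rule exp_lower_Taylor_quadratic) (use True in simp)
    moreover have "0 < ?s" using True by simp
    ultimately have "?s\<^sup>2 \<le> 2 * exp ?s" by linarith
    then have "?s\<^sup>2 * exp (- ?s) \<le> (2 * exp ?s) * exp (- ?s)" by (rule mult_right_mono) simp
    also have "(2 * exp ?s) * exp (- ?s) = 2" by (simp add: mult.assoc flip: exp_add)
    finally have "?s\<^sup>2 * exp (- ?s) \<le> 2" .
    then show ?thesis using True by (simp add: expinv_def power2_eq_square algebra_simps pderiv_1)
  qed (simp add: expinv_def)
qed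

lemma flat_mono: "s \<le> t \<Longrightarrow> flat s \<le> flat t"
  by (auto simp: flat_def le_imp_inverse_le)

lemma flat_nonneg: "0 \<le> flat t" and flat_pos: "0 < t \<Longrightarrow> 0 < flat t" and flat_zero: "t \<le> 0 \<Longrightarrow> flat t = 0"
  by (auto simp: flat_def)

text \<open>The function \<open>flat\<close> never reaches a constant value on the right. But it vanishes on the left, so
  \<open>flat (flat 1 - flat t)\<close> is constant for \<open>t \<le> 0\<close> and zero for \<open>t \<ge> 1\<close>: a composition alone gives
  a smooth step with a bounded derivative.\<close>

definition step :: "real \<Rightarrow> real" where
  "step t = 1 - flat (flat 1 - flat t) / flat (flat 1)"

lemma step_zero: "t \<le> 0 \<Longrightarrow> step t = 0"
  using flat_pos[OF flat_pos[of 1]] by (simp add: step_def flat_zero)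

lemma step_one: "1 \<le> t \<Longrightarrow> step t = 1"
  using flat_mono[of 1 t] by (simp add: step_def flat_zero)

lemma step_range: "0 \<le> step t" "step t \<le> 1"
proof -
  have p: "0 < flat (flat 1)" by (intro flat_pos) simp
  have "flat (flat 1 - flat t) \<le> flat (flat 1)" by (intro flat_mono) (simp add: flat_nonneg)
  then show "0 \<le> step t" using p by (simp add: step_def field_simps)
  show "step t \<le> 1" using p flat_nonneg by (simp add: step_def)
qed

lemma step_deriv_bound:
  "\<exists>d. (step has_real_derivative d) (at t) \<and> \<bar>d\<bar> \<le> 4 / flat (flat 1)"
proof -
  have p: "0 < flat (flat 1)" by (intro flat_pos) simp
  obtain d1 where d1: "(flat has_real_derivative d1) (at t)" "\<bar>d1\<bar> \<le> 2" using flat_deriv_bound by blast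
  obtain d2 where d2: "(flat has_real_derivative d2) (at (flat 1 - flat t))" "\<bar>d2\<bar> \<le> 2" using flat_deriv_bound by blast
  have "((\<lambda>t. flat 1 - flat t) has_real_derivative (0 - d1)) (at t)"
    by (intro derivative_intros d1)
  from DERIV_chain2[OF d2(1) this]
  have "((\<lambda>t. flat (flat 1 - flat t)) has_real_derivative d2 * (0 - d1)) (at t)" .
  then have "((\<lambda>t. 1 - flat (flat 1 - flat t) / flat (flat 1)) has_real_derivative (0 - d2 * (0 - d1) / flat (flat 1))) (at t)"
    by (intro DERIV_diff DERIV_const DERIV_cdivide)
  then have "(step has_real_derivative (d2 * d1 / flat (flat 1))) (at t)"
    unfolding step_def[abs_def] by simp
  moreover have "\<bar>d2 * d1\<bar> \<le> 2 * 2" unfolding abs_mult by (intro mult_mono d1 d2) auto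
  then have "\<bar>d2 * d1 / flat (flat 1)\<bar> \<le> 4 / flat (flat 1)"
    using p by (simp add: divide_right_mono)
  ultimately show ?thesis by blast
qed

lemma rsmooth_on_step:
  assumes "open U" "rsmooth_on U g"
  shows "rsmooth_on U (\<lambda>x. step (g x))"
  unfolding step_def divide_inverse
  by (intro rsmooth_on_diff rsmooth_on_mult rsmooth_on_const rsmooth_on_flat assms)

lemma norm_sq_real2: "(norm (x::real^2))\<^sup>2 = (x$1)\<^sup>2 + (x$2)\<^sup>2"
  by (simp add: norm_vec_def L2_set_def sum_2)

lemma rsmooth_on_dist_sq:
  assumes "open U"
  shows "rsmooth_on U (\<lambda>x. (norm (x - a))\<^sup>2)"
proof -
  have "(\<lambda>x. (norm (x - a))\<^sup>2) = (\<lambda>x. (x$1 - a$1) * (x$1 - a$1) + (x$2 - a$2) * (x$2 - a$2))"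
    by (simp only: norm_sq_real2 vector_minus_component) (simp only: power2_eq_square)
  moreover have "rsmooth_on U (\<lambda>x. (x$1 - a$1) * (x$1 - a$1) + (x$2 - a$2) * (x$2 - a$2))"
    by (intro rsmooth_on_add rsmooth_on_mult rsmooth_on_diff rsmooth_on_coord rsmooth_on_const assms)
  ultimately show ?thesis by simp
qed

section \<open>A logarithmic cutoff\<close>

text \<open>Points of the plane have zero capacity: a cutoff that depends on \<open>log |x - a|\<close> can vanish near
  \<open>a\<close>, equal \<open>1\<close> outside an arbitrarily small disc, and still have partial derivatives at most \<open>\<epsilon> / |x - a|\<close>.
  That is the size which the Hardy inequality absorbs. The inner radius \<open>\<delta>\<close> does not depend on \<open>a\<close>.\<close>

lemma logarithmic_cutoff:
  assumes eps: "0 < \<epsilon>" and R: "0 < R"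
  obtains \<delta> where "0 < \<delta>"
    "\<And>a. \<exists>\<zeta>. rsmooth_on UNIV \<zeta> \<and> (\<forall>x. 0 \<le> \<zeta> x \<and> \<zeta> x \<le> 1) \<and>
        (\<forall>x. norm (x - a) \<le> \<delta> \<longrightarrow> \<zeta> x = 0) \<and> (\<forall>x. R \<le> norm (x - a) \<longrightarrow> \<zeta> x = 1) \<and>
        (\<forall>x i. norm (x - a) * norm (pd i (\<lambda>x. complex_of_real (\<zeta> x)) x) \<le> \<epsilon>)"
proof -
  define K where "K = 4 / flat (flat 1)"
  have K: "0 < K" unfolding K_def by (intro divide_pos_pos flat_pos) auto
  define \<eta> where "\<eta> = \<epsilon> / (2 * K)"
  have \<eta>: "0 < \<eta>" using eps K by (simp add: \<eta>_def)
  \<comment> \<open>the inner radius for which the function \<open>g\<close> below runs from \<open>0\<close> to \<open>1\<close> between \<open>\<delta>\<close> and \<open>R\<close>\<close>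
  define \<delta> where "\<delta> = R * exp (- 1 / (2 * \<eta>))"
  have \<delta>: "0 < \<delta>" using R by (simp add: \<delta>_def)
  show thesis
  proof (rule that[OF \<delta>])
    fix a :: "real^2"
    define g where "g x = \<eta> * ln ((norm (x - a))\<^sup>2 * inverse (\<delta>\<^sup>2))" for x
    define \<zeta> where "\<zeta> x = step (g x)" for x
    have zero: "\<zeta> x = 0" if "norm (x - a) \<le> \<delta>" for x
    proof (cases "x = a")
      case True
      then show ?thesis by (simp add: \<zeta>_def g_def step_zero)
    next
      case False
      then have n: "0 < (norm (x - a))\<^sup>2" by simp
      have "(norm (x - a))\<^sup>2 \<le> \<delta>\<^sup>2" using that by (intro power_mono) auto
      then have "(norm (x - a))\<^sup>2 * inverse (\<delta>\<^sup>2) \<le> 1" using \<delta> by (simp add: field_simps)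
      then have "ln ((norm (x - a))\<^sup>2 * inverse (\<delta>\<^sup>2)) \<le> 0" using n \<delta> by (subst ln_le_zero_iff) auto
      then show ?thesis using \<eta> unfolding \<zeta>_def g_def by (intro step_zero mult_nonneg_nonpos) auto
    qed
    have one: "\<zeta> x = 1" if "R \<le> norm (x - a)" for x
    proof -
      have d2: "\<delta>\<^sup>2 = R\<^sup>2 * exp (- (1 / \<eta>))"
        by (simp add: \<delta>_def power_mult_distrib power2_eq_square flip: exp_add)
      have "R\<^sup>2 \<le> (norm (x - a))\<^sup>2" using that R by (intro power_mono) auto
      then have "R\<^sup>2 * inverse (\<delta>\<^sup>2) \<le> (norm (x - a))\<^sup>2 * inverse (\<delta>\<^sup>2)" by (rule mult_right_mono) simp
      moreover have "R\<^sup>2 * inverse (\<delta>\<^sup>2) = exp (1 / \<eta>)" using R by (simp add: d2 exp_minus)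
      ultimately have "exp (1 / \<eta>) \<le> (norm (x - a))\<^sup>2 * inverse (\<delta>\<^sup>2)" by simp
      then have "ln (exp (1 / \<eta>)) \<le> ln ((norm (x - a))\<^sup>2 * inverse (\<delta>\<^sup>2))"
        by (intro ln_mono) auto
      then have "1 \<le> g x" using \<eta> by (simp add: g_def field_simps)
      then show ?thesis unfolding \<zeta>_def by (rule step_one)
    qed
    have sm1: "rsmooth_on (- {a}) \<zeta>"
      unfolding \<zeta>_def g_def
      by (intro rsmooth_on_step rsmooth_on_mult rsmooth_on_const rsmooth_on_ln rsmooth_on_dist_sq)
         (use \<delta> in auto)
    have sm2: "rsmooth_on (ball a \<delta>) \<zeta>"
      unfolding rsmooth_on_def
      by (rule smooth_on_cong[OF _ _ smooth_on_const[of _ 0]])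
         (auto simp: zero dist_norm norm_minus_commute)
    have "- {a} \<union> ball a \<delta> = UNIV" using \<delta> by auto
    then have sm: "rsmooth_on UNIV \<zeta>"
      using sm1 sm2 smooth_on_Un[of "- {a}" "ball a \<delta>"] unfolding rsmooth_on_def by auto
    have grad: "norm (x - a) * norm (pd i (\<lambda>x. complex_of_real (\<zeta> x)) x) \<le> \<epsilon>" for x i
    proof (cases "x \<in> ball a \<delta>")
      case True
      have "pd i (\<lambda>x. complex_of_real (\<zeta> x)) x = pd i (\<lambda>x. 0) x"
        by (rule pd_cong_open[OF open_ball True]) (auto simp: zero dist_norm norm_minus_commute)
      also have "\<dots> = 0" by (rule pd_eq) (rule has_derivative_const)
      finally show ?thesis using eps by simp
    next
      case False
      then have n: "0 < norm (x - a)" using \<delta> by auto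
      let ?r = "(norm (x - a))\<^sup>2"
      have "((\<lambda>x. (norm (x - a))\<^sup>2) has_derivative (\<lambda>h. 2 * ((x - a) \<bullet> h))) (at x)"
        unfolding power2_norm_eq_inner
        by (auto intro!: derivative_eq_intros simp: inner_commute)
      moreover have "((\<lambda>s. \<eta> * ln (s * inverse (\<delta>\<^sup>2))) has_real_derivative \<eta> / ?r) (at ?r)"
        using n \<delta> by (auto intro!: derivative_eq_intros simp: field_simps)
      ultimately have "(g has_derivative (\<lambda>h. 2 * ((x - a) \<bullet> h) * (\<eta> / ?r))) (at x)"
        unfolding g_def by (rule DERIV_compose_FDERIV[rotated])
      then have dg: "(g has_derivative (\<lambda>h. \<eta> * (2 * ((x - a) \<bullet> h) / ?r))) (at x)"
        by (simp add: mult.commute)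
      obtain d where d: "(step has_real_derivative d) (at (g x))" "\<bar>d\<bar> \<le> K"
        using step_deriv_bound K_def by metis
      have "(\<zeta> has_derivative (\<lambda>h. \<eta> * (2 * ((x - a) \<bullet> h) / ?r) * d)) (at x)"
        unfolding \<zeta>_def by (rule DERIV_compose_FDERIV[OF d(1) dg])
      then have "pd i (\<lambda>x. complex_of_real (\<zeta> x)) x = complex_of_real (\<eta> * (2 * ((x - a) \<bullet> axis i 1) / ?r) * d)"
        by (intro pd_eq has_derivative_of_real)
      also have "norm \<dots> = \<eta> * (2 * \<bar>(x - a) $ i\<bar> / ?r) * \<bar>d\<bar>"
        using \<eta> by (simp add: inner_axis abs_mult del: of_real_mult of_real_divide vector_minus_component)
      also have "\<dots> \<le> \<eta> * (2 * norm (x - a) / ?r) * K"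
        using \<eta> component_le_norm_cart[of "x - a" i] d(2)
        by (intro mult_mono mult_left_mono divide_right_mono) auto
      finally have "norm (x - a) * norm (pd i (\<lambda>x. complex_of_real (\<zeta> x)) x)
          \<le> norm (x - a) * (\<eta> * (2 * norm (x - a) / ?r) * K)"
        by (intro mult_left_mono) auto
      also have "\<dots> = \<epsilon>" using n K by (simp add: \<eta>_def power2_eq_square)
      finally show ?thesis .
    qed
    show "\<exists>\<zeta>. rsmooth_on UNIV \<zeta> \<and> (\<forall>x. 0 \<le> \<zeta> x \<and> \<zeta> x \<le> 1) \<and>
        (\<forall>x. norm (x - a) \<le> \<delta> \<longrightarrow> \<zeta> x = 0) \<and> (\<forall>x. R \<le> norm (x - a) \<longrightarrow> \<zeta> x = 1) \<and>
        (\<forall>x i. norm (x - a) * norm (pd i (\<lambda>x. complex_of_real (\<zeta> x)) x) \<le> \<epsilon>)"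
      using sm zero one grad step_range by (intro exI[of _ \<zeta>]) (auto simp: \<zeta>_def)
  qed
qed

section \<open>Test functions\<close>

lemma test_functions_iff:
  "\<phi> \<in> test_functions U \<longleftrightarrow> smooth_on UNIV \<phi> \<and> compact (closure {x. \<phi> x \<noteq> 0}) \<and> closure {x. \<phi> x \<noteq> 0} \<subseteq> U"
  by (simp add: test_functions_def smooth_on_def C_k_eq_Ck_on)

lemma test_smooth: "\<phi> \<in> test_functions U \<Longrightarrow> smooth_on UNIV \<phi>"
  by (simp add: test_functions_iff)

lemma test_continuous: "\<phi> \<in> test_functions U \<Longrightarrow> continuous_on UNIV \<phi>"
  by (simp add: test_functions_iff smooth_on_continuous)

lemma test_has_derivative:
  "\<phi> \<in> test_functions U \<Longrightarrow> (\<phi> has_derivative frechet_derivative \<phi> (at x)) (at x)"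
  using test_smooth smooth_on_has_derivative by blast

lemma test_supportE:
  assumes "\<phi> \<in> test_functions U"
  obtains S where "compact S" "S \<subseteq> U" "\<And>x. x \<notin> S \<Longrightarrow> \<phi> x = 0"
  using assms closure_subset[of "{x. \<phi> x \<noteq> 0}"] unfolding test_functions_iff by blast

lemma test_functionsI:
  assumes "smooth_on UNIV \<phi>" "compact S" "S \<subseteq> U" "\<And>x. x \<notin> S \<Longrightarrow> \<phi> x = 0"
  shows "\<phi> \<in> test_functions U"
proof -
  have "{x. \<phi> x \<noteq> 0} \<subseteq> S" using assms(4) by auto
  then have "closure {x. \<phi> x \<noteq> 0} \<subseteq> S"
    using compact_imp_closed[OF assms(2)] by (rule closure_minimal)
  moreover have "compact (closure {x. \<phi> x \<noteq> 0})"
    using compact_closure bounded_subset[OF compact_imp_bounded[OF assms(2)] \<open>{x. \<phi> x \<noteq> 0} \<subseteq> S\<close>] by blast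
  ultimately show ?thesis using assms by (auto simp: test_functions_iff)
qed

lemma test_mono: "U \<subseteq> V \<Longrightarrow> \<phi> \<in> test_functions U \<Longrightarrow> \<phi> \<in> test_functions V"
  by (auto simp: test_functions_iff)

lemma test_zero: "(\<lambda>x. 0) \<in> test_functions U"
  by (rule test_functionsI[where S="{}"]) (auto intro: smooth_on_const)

lemma test_add:
  assumes "\<phi> \<in> test_functions U" "\<psi> \<in> test_functions U"
  shows "(\<lambda>x. \<phi> x + \<psi> x) \<in> test_functions U"
proof -
  obtain S where S: "compact S" "S \<subseteq> U" "\<And>x. x \<notin> S \<Longrightarrow> \<phi> x = 0" using test_supportE[OF assms(1)] by blast
  obtain T where T: "compact T" "T \<subseteq> U" "\<And>x. x \<notin> T \<Longrightarrow> \<psi> x = 0" using test_supportE[OF assms(2)] by blast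
  show ?thesis
    by (rule test_functionsI[where S="S \<union> T"])
       (use S T assms in \<open>auto intro: smooth_on_add test_smooth\<close>)
qed

lemma test_mult:
  assumes U: "open U" and \<phi>: "\<phi> \<in> test_functions U" and f: "smooth_on U f"
  shows "(\<lambda>x. f x * \<phi> x) \<in> test_functions U"
proof -
  obtain S where S: "compact S" "S \<subseteq> U" "\<And>x. x \<notin> S \<Longrightarrow> \<phi> x = 0" using test_supportE[OF \<phi>] by blast
  have oS: "open (- S)" using compact_imp_closed[OF S(1)] by auto
  have 1: "smooth_on U (\<lambda>x. f x * \<phi> x)"
    using smooth_on_mult[OF U f smooth_on_subset[OF test_smooth[OF \<phi>]]] by simp
  have 2: "smooth_on (- S) (\<lambda>x. f x * \<phi> x)"
    by (rule smooth_on_cong[OF oS _ smooth_on_const[OF oS, of 0]]) (use S in auto)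
  have "U \<union> - S = UNIV" using S by auto
  then have "smooth_on UNIV (\<lambda>x. f x * \<phi> x)" using smooth_on_Un[OF U oS 1 2] by simp
  then show ?thesis by (rule test_functionsI[OF _ S(1,2)]) (use S in auto)
qed

lemma test_cmult:
  assumes "\<phi> \<in> test_functions U"
  shows "(\<lambda>x. c * \<phi> x) \<in> test_functions U"
proof -
  obtain S where S: "compact S" "S \<subseteq> U" "\<And>x. x \<notin> S \<Longrightarrow> \<phi> x = 0" using test_supportE[OF assms] by blast
  have "smooth_on UNIV (\<lambda>x. c * \<phi> x)"
    by (intro smooth_on_mult smooth_on_const test_smooth[OF assms] open_UNIV)
  then show ?thesis by (rule test_functionsI[OF _ S(1,2)]) (simp add: S)
qed

lemma test_pd:
  assumes "\<phi> \<in> test_functions U"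
  shows "pd i \<phi> \<in> test_functions U"
proof -
  obtain S where S: "compact S" "S \<subseteq> U" "\<And>x. x \<notin> S \<Longrightarrow> \<phi> x = 0" using test_supportE[OF assms] by blast
  have oS: "open (- S)" using compact_imp_closed[OF S(1)] by auto
  have "pd i \<phi> x = 0" if "x \<notin> S" for x
  proof -
    have "pd i \<phi> x = pd i (\<lambda>x. 0) x" by (rule pd_cong_open[OF oS]) (use S that in auto)
    also have "\<dots> = 0" by (rule pd_eq) (rule has_derivative_const)
    finally show ?thesis .
  qed
  then show ?thesis
    by (rule test_functionsI[OF smooth_on_pd[OF test_smooth[OF assms]] S(1,2)])
qed

definition mpart :: "(real^2 \<Rightarrow> real^2) \<Rightarrow> 2 \<Rightarrow> (real^2 \<Rightarrow> complex) \<Rightarrow> real^2 \<Rightarrow> complex" where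
  "mpart A i \<phi> x = \<i> * pd i \<phi> x + complex_of_real (A x $ i) * \<phi> x"

lemma mgrad_nth: "mgrad A \<phi> x $ i = mpart A i \<phi> x"
  by (simp add: mgrad_def mpart_def pd_def)

definition smooth_pot :: "(real^2) set \<Rightarrow> (real^2 \<Rightarrow> real^2) \<Rightarrow> bool" where
  "smooth_pot U A \<longleftrightarrow> (\<forall>i. rsmooth_on U (\<lambda>x. A x $ i))"

lemma test_mpart:
  assumes "open U" "smooth_pot U A" "\<phi> \<in> test_functions U"
  shows "mpart A i \<phi> \<in> test_functions U"
  unfolding mpart_def
  by (intro test_add test_cmult test_pd test_mult assms) (use assms in \<open>auto simp: smooth_pot_def rsmooth_on_def\<close>)

lemma smooth_pot_zero: "open U \<Longrightarrow> smooth_pot U (\<lambda>_. 0)"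
  by (simp add: smooth_pot_def rsmooth_on_const)

lemma AB_potential_nth:
  "AB_potential \<alpha> a x $ 1 = \<alpha> * (- (x$2 - a$2) * inverse ((norm (x - a))\<^sup>2))"
  "AB_potential \<alpha> a x $ 2 = \<alpha> * ((x$1 - a$1) * inverse ((norm (x - a))\<^sup>2))"
  by (simp_all add: AB_potential_def divide_inverse)

lemma smooth_pot_AB: "smooth_pot (- {a}) (AB_potential \<alpha> a)"
proof -
  have n: "0 < (norm (x - a))\<^sup>2" if "x \<in> - {a}" for x using that by simp
  have inv: "rsmooth_on (- {a}) (\<lambda>x. inverse ((norm (x - a))\<^sup>2))"
    by (rule rsmooth_on_inverse[OF _ rsmooth_on_dist_sq n]) auto
  have co: "rsmooth_on (- {a}) (\<lambda>x. x $ i - a $ i)" for i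
    by (intro rsmooth_on_diff rsmooth_on_coord rsmooth_on_const) auto
  have "rsmooth_on (- {a}) (\<lambda>x. \<alpha> * (((-1) * (x$2 - a$2)) * inverse ((norm (x - a))\<^sup>2)))"
    by (intro rsmooth_on_mult rsmooth_on_const co inv) auto
  moreover have "rsmooth_on (- {a}) (\<lambda>x. \<alpha> * ((x$1 - a$1) * inverse ((norm (x - a))\<^sup>2)))"
    by (intro rsmooth_on_mult rsmooth_on_const co inv) auto
  ultimately show ?thesis
    unfolding smooth_pot_def forall_2 AB_potential_nth by simp
qed

lemma rsmooth_on_subset: "rsmooth_on U f \<Longrightarrow> V \<subseteq> U \<Longrightarrow> rsmooth_on V f"
  unfolding rsmooth_on_def by (rule smooth_on_subset)

lemma smooth_pot_subset: "smooth_pot U A \<Longrightarrow> V \<subseteq> U \<Longrightarrow> smooth_pot V A"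
  unfolding smooth_pot_def using rsmooth_on_subset by blast

section \<open>Integration by parts\<close>

lemma compact_support_integrable:
  fixes f :: "real^2 \<Rightarrow> 'b::euclidean_space"
  assumes f: "continuous_on UNIV f" and S: "compact S" "\<And>x. x \<notin> S \<Longrightarrow> f x = 0"
  shows "integrable lborel f"
proof -
  have "integrable lborel (\<lambda>x. indicator S x *\<^sub>R f x)"
    using S(1) by (rule borel_integrable_compact) (use f continuous_on_subset in blast)
  moreover have "(\<lambda>x. indicator S x *\<^sub>R f x) = f" using S(2) by (auto simp: indicator_def)
  ultimately show ?thesis by simp
qed

lemma compact_support_lebesgue_on:
  fixes f :: "real^2 \<Rightarrow> 'b::euclidean_space"
  assumes f: "continuous_on UNIV f" and S: "compact S" "S \<subseteq> U" "\<And>x. x \<notin> S \<Longrightarrow> f x = 0" and U: "open U"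
  shows "integrable (lebesgue_on U) f" "(LINT x|lebesgue_on U. f x) = (LINT x|lborel. f x)"
proof -
  have i: "integrable lborel f" by (rule compact_support_integrable[OF f S(1,3)])
  have e: "(\<lambda>x. indicator U x *\<^sub>R f x) = f" using S by (fastforce simp: indicator_def fun_eq_iff)
  have U': "U \<inter> space lebesgue \<in> sets lebesgue" using U by auto
  have m: "f \<in> borel_measurable lborel" using f by (simp add: borel_measurable_continuous_onI)
  show "integrable (lebesgue_on U) f"
    using i unfolding integrable_restrict_space[OF U'] e by (simp add: integrable_completion m)
  show "(LINT x|lebesgue_on U. f x) = (LINT x|lborel. f x)"
    unfolding integral_restrict_space[OF U'] e by (rule integral_completion[OF m])
qed

lemma integral_translation:
  fixes f :: "real^2 \<Rightarrow> real"
  assumes "f \<in> borel_measurable borel"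
  shows "(LINT x|lborel. f (x + v)) = (LINT x|lborel. f x)"
proof -
  have "(LINT x|lborel. f x) = (LINT x|distr lborel borel ((+) v). f x)"
    by (subst lborel_distr_plus) simp
  also have "\<dots> = (LINT x|lborel. f (v + x))"
    by (rule integral_distr) (use assms in auto)
  finally show ?thesis by (simp add: add.commute)
qed

text \<open>The difference quotients of \<open>\<Phi>\<close> have integral zero by translation invariance, and they
  converge boundedly to the partial derivative.\<close>

lemma integral_partial_derivative_eq_0:
  fixes \<Phi> :: "real^2 \<Rightarrow> real"
  assumes D: "\<And>x. (\<Phi> has_derivative D x) (at x)" and Dc: "continuous_on UNIV (\<lambda>x. D x v)"
    and S: "compact S" "\<And>x. x \<notin> S \<Longrightarrow> \<Phi> x = 0"
  shows "(LINT x|lborel. D x v) = 0"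
proof -
  have \<Phi>c: "continuous_on UNIV \<Phi>"
    by (intro continuous_at_imp_continuous_on ballI has_derivative_continuous[OF D])
  have D0: "D x v = 0" if "x \<notin> S" for x
  proof -
    have "((\<lambda>x. 0) has_derivative D x) (at x)"
      by (rule has_derivative_transform_within_open[OF D, of "- S"])
         (use compact_imp_closed[OF S(1)] S(2) that in auto)
    then have "D x = (\<lambda>h. 0)" using has_derivative_unique has_derivative_const by blast
    then show ?thesis by simp
  qed
  have "bounded ((\<lambda>x. D x v) ` S)"
    by (intro compact_imp_bounded compact_continuous_image S(1) continuous_on_subset[OF Dc]) auto
  then obtain B0 where B0: "\<And>x. x \<in> S \<Longrightarrow> norm (D x v) \<le> B0" by (auto simp: bounded_iff)
  define B where "B = max B0 0"
  have B: "norm (D x v) \<le> B" for x using B0[of x] D0[of x] by (cases "x \<in> S") (auto simp: B_def)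
  have line: "((\<lambda>t. \<Phi> (x + t *\<^sub>R v)) has_real_derivative D (x + t *\<^sub>R v) v) (at t)" for x t
  proof -
    have "((\<lambda>t. x + t *\<^sub>R v) has_derivative (\<lambda>h. h *\<^sub>R v)) (at t)"
      by (auto intro!: derivative_eq_intros)
    from has_derivative_compose[OF this D]
    have "((\<lambda>t. \<Phi> (x + t *\<^sub>R v)) has_derivative (\<lambda>h. D (x + t *\<^sub>R v) (h *\<^sub>R v))) (at t)" .
    moreover have "(\<lambda>h. D (x + t *\<^sub>R v) (h *\<^sub>R v)) = (\<lambda>h. D (x + t *\<^sub>R v) v * h)"
      using linear_cmul[OF has_derivative_linear[OF D]] by auto
    ultimately show ?thesis by (simp add: has_field_derivative_def)
  qed
  have lip: "\<bar>\<Phi> (x + h *\<^sub>R v) - \<Phi> x\<bar> \<le> B * h" if h: "0 < h" for x h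
  proof -
    obtain z where "\<Phi> (x + h *\<^sub>R v) - \<Phi> (x + 0 *\<^sub>R v) = (h - 0) * D (x + z *\<^sub>R v) v"
      using MVT2[OF h, of "\<lambda>t. \<Phi> (x + t *\<^sub>R v)" "\<lambda>t. D (x + t *\<^sub>R v) v"] line by blast
    then show ?thesis using B[of "x + z *\<^sub>R v"] h by (simp add: abs_mult mult.commute)
  qed
  obtain r where r: "\<And>x. x \<in> S \<Longrightarrow> norm x \<le> r" using compact_imp_bounded[OF S(1)] by (auto simp: bounded_iff)
  define h where "h n = 1 / real (Suc n)" for n
  have h: "0 < h n" "h n \<le> 1" for n by (auto simp: h_def)
  have h0: "h \<longlonglongrightarrow> 0" unfolding h_def by (rule LIMSEQ_Suc[OF lim_1_over_n])
  define q where "q n x = (\<Phi> (x + h n *\<^sub>R v) - \<Phi> x) / h n" for n x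
  define T where "T = cball (0::real^2) (r + norm v)"
  have q_bd: "norm (q n x) \<le> indicator T x * B" for n x
  proof (cases "x \<in> T")
    case True
    have "norm (q n x) = \<bar>\<Phi> (x + h n *\<^sub>R v) - \<Phi> x\<bar> / h n"
      unfolding q_def real_norm_def abs_divide using h(1)[of n] by (simp only: abs_of_pos)
    also have "\<dots> \<le> B"
      unfolding pos_divide_le_eq[OF h(1)] by (rule lip[OF h(1)])
    finally show ?thesis using True by simp
  next
    case False
    have "norm (h n *\<^sub>R v) \<le> norm v" using h[of n] by (simp add: mult_left_le_one_le)
    then have "r < norm (x + h n *\<^sub>R v)"
      using False norm_triangle_ineq4[of "x + h n *\<^sub>R v" "h n *\<^sub>R v"] by (simp add: T_def)
    moreover have "r < norm x" using False norm_ge_zero[of v] unfolding T_def mem_cball_0 by linarith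
    ultimately have "x \<notin> S" "x + h n *\<^sub>R v \<notin> S" using r by force+
    then show ?thesis using S(2) False by (simp add: q_def)
  qed
  have \<Phi>m: "\<Phi> \<in> borel_measurable borel" using \<Phi>c by (rule borel_measurable_continuous_onI)
  have \<Phi>tc: "continuous_on UNIV (\<lambda>x. \<Phi> (x + w))" for w
    by (rule continuous_on_compose2[OF \<Phi>c]) (auto intro!: continuous_intros)
  have q0: "(LINT x|lborel. q n x) = 0" for n
  proof -
    have "integrable lborel (\<lambda>x. \<Phi> (x + h n *\<^sub>R v))"
    proof (rule compact_support_integrable[OF \<Phi>tc, where S="(\<lambda>x. x - h n *\<^sub>R v) ` S"])
      show "compact ((\<lambda>x. x - h n *\<^sub>R v) ` S)" by (rule compact_translation_subtract[OF S(1)])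
      show "\<Phi> (x + h n *\<^sub>R v) = 0" if "x \<notin> (\<lambda>x. x - h n *\<^sub>R v) ` S" for x
      proof (rule S(2), rule)
        assume "x + h n *\<^sub>R v \<in> S"
        then have "x + h n *\<^sub>R v - h n *\<^sub>R v \<in> (\<lambda>x. x - h n *\<^sub>R v) ` S" by (rule imageI)
        then show False using that by simp
      qed
    qed
    then show ?thesis
      using compact_support_integrable[OF \<Phi>c S] integral_translation[OF \<Phi>m, of "h n *\<^sub>R v"]
      by (simp add: q_def)
  qed
  have "(\<lambda>n. LINT x|lborel. q n x) \<longlonglongrightarrow> (LINT x|lborel. D x v)"
  proof (rule integral_dominated_convergence[where w="\<lambda>x. indicator T x * B"])
    show "(\<lambda>x. D x v) \<in> borel_measurable lborel"
      using borel_measurable_continuous_onI[OF Dc] by simp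
    show "q n \<in> borel_measurable lborel" for n
      unfolding q_def using borel_measurable_continuous_onI[OF \<Phi>tc] \<Phi>m by auto
    have "emeasure lborel T < \<infinity>"
      unfolding T_def using emeasure_bounded_finite[OF bounded_cball] by (simp add: less_top)
    then show "integrable lborel (\<lambda>x. indicator T x * B)"
      by (auto simp: T_def)
    show "AE x in lborel. (\<lambda>n. q n x) \<longlonglongrightarrow> D x v"
    proof (rule AE_I2)
      fix x
      have "((\<lambda>t. \<Phi> (x + t *\<^sub>R v)) has_real_derivative D x v) (at 0)" using line[of x 0] by simp
      then have "((\<lambda>t. (\<Phi> (x + t *\<^sub>R v) - \<Phi> x) / t) \<longlongrightarrow> D x v) (at 0)" by (simp add: DERIV_def)
      moreover have "filterlim h (at 0) sequentially"
        using h0 h(1) by (auto simp: filterlim_at less_imp_neq[symmetric])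
      ultimately show "(\<lambda>n. q n x) \<longlonglongrightarrow> D x v"
        unfolding q_def by (rule filterlim_compose)
    qed
    show "AE x in lborel. norm (q n x) \<le> indicator T x * B" for n using q_bd by simp
  qed
  then show ?thesis using q0 LIMSEQ_unique by (simp add: LIMSEQ_const_iff)
qed

text \<open>The difference of the two integrands is the partial derivative of \<open>(i\<phi>) \<bullet> \<psi>\<close>, because \<open>A\<close> is real.\<close>

lemma mpart_symmetric:
  assumes U: "open U" and A: "smooth_pot U A" and \<phi>: "\<phi> \<in> test_functions U" and \<psi>: "\<psi> \<in> test_functions U"
  shows "(LINT x|lebesgue_on U. mpart A i \<phi> x \<bullet> \<psi> x) = (LINT x|lebesgue_on U. \<phi> x \<bullet> mpart A i \<psi> x)"
proof -
  obtain S where S: "compact S" "S \<subseteq> U" "\<And>x. x \<notin> S \<Longrightarrow> \<phi> x = 0" using test_supportE[OF \<phi>] by blast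
  obtain T where T: "compact T" "T \<subseteq> U" "\<And>x. x \<notin> T \<Longrightarrow> \<psi> x = 0" using test_supportE[OF \<psi>] by blast
  have c: "continuous_on UNIV \<phi>" "continuous_on UNIV \<psi>" "continuous_on UNIV (mpart A i \<phi>)" "continuous_on UNIV (mpart A i \<psi>)"
    using test_continuous \<phi> \<psi> test_mpart[OF U A] by blast+
  let ?D = "\<lambda>x h. (\<i> * \<phi> x) \<bullet> frechet_derivative \<psi> (at x) h + (\<i> * frechet_derivative \<phi> (at x) h) \<bullet> \<psi> x"
  have der: "((\<lambda>x. (\<i> * \<phi> x) \<bullet> \<psi> x) has_derivative ?D x) (at x)" for x
    by (intro has_derivative_inner has_derivative_mult_right test_has_derivative[OF \<phi>] test_has_derivative[OF \<psi>])
  have De: "?D x (axis i 1) = mpart A i \<phi> x \<bullet> \<psi> x - \<phi> x \<bullet> mpart A i \<psi> x" for x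
    unfolding pd_def[symmetric] mpart_def by (simp add: inner_complex_def algebra_simps)
  have i1: "integrable lborel (\<lambda>x. mpart A i \<phi> x \<bullet> \<psi> x)"
    by (rule compact_support_integrable[OF _ T(1)]) (auto intro!: continuous_intros c simp: T)
  have i2: "integrable lborel (\<lambda>x. \<phi> x \<bullet> mpart A i \<psi> x)"
    by (rule compact_support_integrable[OF _ S(1)]) (auto intro!: continuous_intros c simp: S)
  have "(LINT x|lborel. ?D x (axis i 1)) = 0"
    by (rule integral_partial_derivative_eq_0[OF der _ S(1)])
       (auto simp: De S intro!: continuous_intros c)
  then have "(LINT x|lborel. mpart A i \<phi> x \<bullet> \<psi> x) = (LINT x|lborel. \<phi> x \<bullet> mpart A i \<psi> x)"
    unfolding De using i1 i2 by simp
  moreover have "(LINT x|lebesgue_on U. mpart A i \<phi> x \<bullet> \<psi> x) = (LINT x|lborel. mpart A i \<phi> x \<bullet> \<psi> x)"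
    by (rule compact_support_lebesgue_on(2)[OF _ T(1,2) _ U]) (auto intro!: continuous_intros c simp: T)
  moreover have "(LINT x|lebesgue_on U. \<phi> x \<bullet> mpart A i \<psi> x) = (LINT x|lborel. \<phi> x \<bullet> mpart A i \<psi> x)"
    by (rule compact_support_lebesgue_on(2)[OF _ S(1,2) _ U]) (auto intro!: continuous_intros c simp: S)
  ultimately show ?thesis by simp
qed

section \<open>The magnetic form and its closability\<close>

lemma sq_integrable_iff: "sq_integrable U f \<longleftrightarrow> sqint (lebesgue_on U) f"
  by (simp add: sq_integrable_def sqint_def)

lemma L2_sq_eq: "L2_sq U f = (l2norm (lebesgue_on U) f)\<^sup>2"
  by (simp add: L2_sq_def l2norm_sq)

lemma null_sq_iff:
  fixes f :: "nat \<Rightarrow> real"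
  assumes "\<And>n. 0 \<le> f n"
  shows "(\<lambda>n. (f n)\<^sup>2) \<longlonglongrightarrow> 0 \<longleftrightarrow> f \<longlonglongrightarrow> 0"
proof
  assume "(\<lambda>n. (f n)\<^sup>2) \<longlonglongrightarrow> 0"
  from tendsto_real_sqrt[OF this] show "f \<longlonglongrightarrow> 0" using assms by simp
next
  assume "f \<longlonglongrightarrow> 0"
  from tendsto_power[OF this, of 2] show "(\<lambda>n. (f n)\<^sup>2) \<longlonglongrightarrow> 0" by simp
qed

lemma form_limit_iff:
  "form_limit A U u F \<longleftrightarrow> sqint (lebesgue_on U) u \<and> sqint (lebesgue_on U) F \<and>
     (\<exists>\<phi>. (\<forall>n. \<phi> n \<in> test_functions U) \<and>
        (\<lambda>n. l2norm (lebesgue_on U) (\<lambda>x. \<phi> n x - u x)) \<longlonglongrightarrow> 0 \<and>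
        (\<lambda>n. l2norm (lebesgue_on U) (\<lambda>x. mgrad A (\<phi> n) x - F x)) \<longlonglongrightarrow> 0)"
  unfolding form_limit_def sq_integrable_iff L2_sq_eq
  by (simp add: null_sq_iff)

lemma compact_support_sqint:
  fixes f :: "real^2 \<Rightarrow> 'b::euclidean_space"
  assumes "continuous_on UNIV f" "compact S" "S \<subseteq> U" "\<And>x. x \<notin> S \<Longrightarrow> f x = 0" "open U"
  shows "sqint (lebesgue_on U) f"
  unfolding sqint_def
proof
  show "f \<in> borel_measurable (lebesgue_on U)"
    using compact_support_lebesgue_on(1)[OF assms] by simp
  show "integrable (lebesgue_on U) (\<lambda>x. (norm (f x))\<^sup>2)"
    by (rule compact_support_lebesgue_on(1)[OF _ assms(2,3) _ assms(5)])
       (use assms in \<open>auto intro!: continuous_intros\<close>)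
qed

lemma test_sqint: "open U \<Longrightarrow> \<phi> \<in> test_functions U \<Longrightarrow> sqint (lebesgue_on U) \<phi>"
  by (metis compact_support_sqint test_continuous test_supportE)

lemma mgrad_eq: "mgrad A \<phi> x = (\<chi> i. mpart A i \<phi> x)"
  by (simp add: vec_eq_iff mgrad_nth)

lemma mgrad_continuous:
  "open U \<Longrightarrow> smooth_pot U A \<Longrightarrow> \<phi> \<in> test_functions U \<Longrightarrow> continuous_on UNIV (mgrad A \<phi>)"
  unfolding mgrad_eq[abs_def] by (intro continuous_on_vec_lambda test_continuous[OF test_mpart])

lemma mgrad_supportE:
  assumes "open U" "smooth_pot U A" "\<phi> \<in> test_functions U"
  obtains S where "compact S" "S \<subseteq> U" "\<And>x. x \<notin> S \<Longrightarrow> mgrad A \<phi> x = 0" "\<And>x. x \<notin> S \<Longrightarrow> \<phi> x = 0"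
proof -
  obtain S where S: "compact S" "S \<subseteq> U" "\<And>x. x \<notin> S \<Longrightarrow> \<phi> x = 0"
    using test_supportE[OF assms(3)] by blast
  have oS: "open (- S)" using compact_imp_closed[OF S(1)] by auto
  have "pd i \<phi> x = 0" if "x \<notin> S" for x i
  proof -
    have "pd i \<phi> x = pd i (\<lambda>x. 0) x" by (rule pd_cong_open[OF oS]) (use S that in auto)
    also have "\<dots> = 0" by (rule pd_eq) (rule has_derivative_const)
    finally show ?thesis .
  qed
  then have "mgrad A \<phi> x = 0" if "x \<notin> S" for x
    using that S(3) by (simp add: mgrad_eq mpart_def vec_eq_iff)
  then show ?thesis using that S by blast
qed

lemma mgrad_sqint: "open U \<Longrightarrow> smooth_pot U A \<Longrightarrow> \<phi> \<in> test_functions U \<Longrightarrow> sqint (lebesgue_on U) (mgrad A \<phi>)"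
  by (metis compact_support_sqint mgrad_continuous mgrad_supportE)

lemma norm_vector_smult: "norm (c *s v :: complex^2) = norm c * norm v"
  by (simp add: norm_vec_def vector_scalar_mult_def norm_mult L2_set_right_distrib)

lemma measurable_smult [measurable]:
  fixes F :: "'a \<Rightarrow> complex^2"
  assumes [measurable]: "c \<in> borel_measurable M" "F \<in> borel_measurable M"
  shows "(\<lambda>x. c x *s F x) \<in> borel_measurable M"
proof (rule borel_measurable_continuous_Pair[OF assms])
  show "continuous_on UNIV (\<lambda>x::complex \<times> (complex^2). fst x *s snd x)"
    unfolding vector_scalar_mult_def by (intro continuous_on_vec_lambda continuous_intros)
qed

lemma measurable_nth [measurable]:
  fixes F :: "'a \<Rightarrow> complex^2"
  assumes "F \<in> borel_measurable M"
  shows "(\<lambda>x. F x $ i) \<in> borel_measurable M"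
  by (rule measurable_compose[OF assms]) (auto intro!: borel_measurable_continuous_onI continuous_intros)

lemma sqint_smult: "sqint M F \<Longrightarrow> sqint M (\<lambda>x. c *s F x :: complex^2)"
  by (rule sqint_dominated[where B="norm c" and f=F]) (auto simp: norm_vector_smult sqint_def)

lemma l2norm_smult: "l2norm M (\<lambda>x. c *s F x :: complex^2) = norm c * l2norm M F"
  by (simp add: l2norm_def norm_vector_smult power_mult_distrib real_sqrt_mult)

lemma sqint_cmult: "sqint M f \<Longrightarrow> sqint M (\<lambda>x. c * f x :: complex)"
  by (rule sqint_dominated[where B="norm c" and f=f]) (auto simp: norm_mult sqint_def)

lemma l2norm_cmult: "l2norm M (\<lambda>x. c * f x :: complex) = norm c * l2norm M f"
  by (simp add: l2norm_def norm_mult power_mult_distrib real_sqrt_mult)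

lemma mpart_lin:
  assumes "\<phi> \<in> test_functions U" "\<psi> \<in> test_functions V"
  shows "mpart A i (\<lambda>x. \<phi> x + c * \<psi> x) x = mpart A i \<phi> x + c * mpart A i \<psi> x"
proof -
  have "((\<lambda>x. \<phi> x + c * \<psi> x) has_derivative
      (\<lambda>h. frechet_derivative \<phi> (at x) h + c * frechet_derivative \<psi> (at x) h)) (at x)"
    by (intro has_derivative_add has_derivative_mult_right test_has_derivative[OF assms(1)] test_has_derivative[OF assms(2)])
  then have "pd i (\<lambda>x. \<phi> x + c * \<psi> x) x = pd i \<phi> x + c * pd i \<psi> x"
    by (simp add: pd_eq) (simp add: pd_def)
  then show ?thesis by (simp add: mpart_def algebra_simps)
qed

lemma mgrad_lin:
  assumes "\<phi> \<in> test_functions U" "\<psi> \<in> test_functions V"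
  shows "mgrad A (\<lambda>x. \<phi> x + c * \<psi> x) x = mgrad A \<phi> x + c *s mgrad A \<psi> x"
  by (simp add: vec_eq_iff mgrad_eq mpart_lin[OF assms])

lemma form_limit_test:
  "open U \<Longrightarrow> smooth_pot U A \<Longrightarrow> \<phi> \<in> test_functions U \<Longrightarrow> form_limit A U \<phi> (mgrad A \<phi>)"
  unfolding form_limit_iff by (auto intro!: test_sqint mgrad_sqint exI[of _ "\<lambda>n. \<phi>"])

lemma form_limit_lin:
  assumes U: "open U" and A: "smooth_pot U A" and u: "form_limit A U u F" and v: "form_limit A U v G"
  shows "form_limit A U (\<lambda>x. u x + c * v x) (\<lambda>x. F x + c *s G x)"
proof -
  let ?M = "lebesgue_on U"
  obtain \<phi> where \<phi>: "\<And>n. \<phi> n \<in> test_functions U" "(\<lambda>n. l2norm ?M (\<lambda>x. \<phi> n x - u x)) \<longlonglongrightarrow> 0"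
      "(\<lambda>n. l2norm ?M (\<lambda>x. mgrad A (\<phi> n) x - F x)) \<longlonglongrightarrow> 0"
    and uF: "sqint ?M u" "sqint ?M F" using u unfolding form_limit_iff by blast
  obtain \<psi> where \<psi>: "\<And>n. \<psi> n \<in> test_functions U" "(\<lambda>n. l2norm ?M (\<lambda>x. \<psi> n x - v x)) \<longlonglongrightarrow> 0"
      "(\<lambda>n. l2norm ?M (\<lambda>x. mgrad A (\<psi> n) x - G x)) \<longlonglongrightarrow> 0"
    and vG: "sqint ?M v" "sqint ?M G" using v unfolding form_limit_iff by blast
  have s\<phi>: "sqint ?M (\<phi> n)" "sqint ?M (mgrad A (\<phi> n))" for n
    using test_sqint[OF U \<phi>(1)] mgrad_sqint[OF U A \<phi>(1)] by auto
  have s\<psi>: "sqint ?M (\<psi> n)" "sqint ?M (mgrad A (\<psi> n))" for n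
    using test_sqint[OF U \<psi>(1)] mgrad_sqint[OF U A \<psi>(1)] by auto
  have 1: "l2norm ?M (\<lambda>x. (\<phi> n x + c * \<psi> n x) - (u x + c * v x))
      \<le> l2norm ?M (\<lambda>x. \<phi> n x - u x) + norm c * l2norm ?M (\<lambda>x. \<psi> n x - v x)" for n
  proof -
    have "l2norm ?M (\<lambda>x. (\<phi> n x - u x) + c * (\<psi> n x - v x))
      \<le> l2norm ?M (\<lambda>x. \<phi> n x - u x) + l2norm ?M (\<lambda>x. c * (\<psi> n x - v x))"
      by (intro l2norm_triangle sqint_cmult sqint_diff s\<phi> s\<psi> uF vG)
    moreover have "(\<phi> n x + c * \<psi> n x) - (u x + c * v x) = (\<phi> n x - u x) + c * (\<psi> n x - v x)" for x
      by (simp add: algebra_simps)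
    ultimately show ?thesis by (simp only: l2norm_cmult)
  qed
  have 2: "l2norm ?M (\<lambda>x. mgrad A (\<lambda>x. \<phi> n x + c * \<psi> n x) x - (F x + c *s G x))
      \<le> l2norm ?M (\<lambda>x. mgrad A (\<phi> n) x - F x) + norm c * l2norm ?M (\<lambda>x. mgrad A (\<psi> n) x - G x)" for n
  proof -
    have "l2norm ?M (\<lambda>x. (mgrad A (\<phi> n) x - F x) + c *s (mgrad A (\<psi> n) x - G x))
      \<le> l2norm ?M (\<lambda>x. mgrad A (\<phi> n) x - F x) + l2norm ?M (\<lambda>x. c *s (mgrad A (\<psi> n) x - G x))"
      by (intro l2norm_triangle sqint_smult sqint_diff s\<phi> s\<psi> uF vG)
    moreover have "mgrad A (\<lambda>x. \<phi> n x + c * \<psi> n x) x - (F x + c *s G x)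
        = (mgrad A (\<phi> n) x - F x) + c *s (mgrad A (\<psi> n) x - G x)" for x
      unfolding mgrad_lin[OF \<phi>(1) \<psi>(1)] by (simp add: vec_eq_iff algebra_simps)
    ultimately show ?thesis by (simp only: l2norm_smult)
  qed
  show ?thesis unfolding form_limit_iff
  proof (intro conjI exI[of _ "\<lambda>n x. \<phi> n x + c * \<psi> n x"] allI)
    show "(\<lambda>n. l2norm ?M (\<lambda>x. (\<phi> n x + c * \<psi> n x) - (u x + c * v x))) \<longlonglongrightarrow> 0"
      by (rule Lim_null_comparison[OF _ tendsto_add_zero[OF \<phi>(2) tendsto_mult_right_zero[OF \<psi>(2), of "norm c"]]])
         (use 1 in simp)
    show "(\<lambda>n. l2norm ?M (\<lambda>x. mgrad A (\<lambda>x. \<phi> n x + c * \<psi> n x) x - (F x + c *s G x))) \<longlonglongrightarrow> 0"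
      by (rule Lim_null_comparison[OF _ tendsto_add_zero[OF \<phi>(3) tendsto_mult_right_zero[OF \<psi>(3), of "norm c"]]])
         (use 2 in simp)
  qed (intro sqint_add sqint_cmult sqint_smult uF vG test_add test_cmult \<phi> \<psi>)+
qed

text \<open>Closability of the form: if \<open>w\<^sub>n \<rightarrow> 0\<close> and \<open>(i\<nabla> + A)w\<^sub>n \<rightarrow> H\<close>, then \<open>(i\<nabla> + A)w\<^sub>m\<close> is itself a
  vector of test functions, so symmetry gives \<open>\<langle>H, (i\<nabla> + A)w\<^sub>m\<rangle> = lim \<langle>w\<^sub>n, (i\<nabla> + A)\<^sup>2 w\<^sub>m\<rangle> = 0\<close>;
  now let \<open>m\<close> tend to infinity.\<close>

lemma form_limit_zero:
  assumes U: "open U" and A: "smooth_pot U A" and H: "form_limit A U (\<lambda>x. 0) H"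
  shows "AE x in lebesgue_on U. H x = 0"
proof -
  let ?M = "lebesgue_on U"
  obtain w where w: "\<And>n. w n \<in> test_functions U" and w0: "(\<lambda>n. l2norm ?M (\<lambda>x. w n x - 0)) \<longlonglongrightarrow> 0"
      and wH: "(\<lambda>n. l2norm ?M (\<lambda>x. mgrad A (w n) x - H x)) \<longlonglongrightarrow> 0"
    and sH: "sqint ?M H" using H unfolding form_limit_iff by blast
  note mp = test_mpart[OF U A]
  have sw: "sqint ?M (w n)" "sqint ?M (mgrad A (w n))" for n
    using test_sqint[OF U w] mgrad_sqint[OF U A w] by auto
  have "(LINT x|?M. H x \<bullet> mgrad A (w m) x) = 0" for m
  proof -
    let ?k = "\<lambda>x. \<Sum>i\<in>UNIV. mpart A i (mpart A i (w m)) x"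
    have sk: "sqint ?M ?k"
      unfolding sum_2 by (intro sqint_add test_sqint[OF U] mp w)
    have "(LINT x|?M. mgrad A (w n) x \<bullet> mgrad A (w m) x) = (LINT x|?M. w n x \<bullet> ?k x)" for n
    proof -
      have i: "integrable ?M (\<lambda>x. mpart A i (w n) x \<bullet> mpart A i (w m) x)" for i
        by (intro integrable_inner_sqint test_sqint[OF U] mp w)
      have i': "integrable ?M (\<lambda>x. w n x \<bullet> mpart A i (mpart A i (w m)) x)" for i
        by (intro integrable_inner_sqint test_sqint[OF U] mp w)
      have "(LINT x|?M. mgrad A (w n) x \<bullet> mgrad A (w m) x) = (LINT x|?M. (\<Sum>i\<in>UNIV. mpart A i (w n) x \<bullet> mpart A i (w m) x))"
        by (simp add: inner_vec_def mgrad_nth)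
      also have "\<dots> = (\<Sum>i\<in>UNIV. (LINT x|?M. mpart A i (w n) x \<bullet> mpart A i (w m) x))"
        by (rule Bochner_Integration.integral_sum) (rule i)
      also have "\<dots> = (\<Sum>i\<in>UNIV. (LINT x|?M. w n x \<bullet> mpart A i (mpart A i (w m)) x))"
        by (intro sum.cong refl mpart_symmetric U A w mp)
      also have "\<dots> = (LINT x|?M. (\<Sum>i\<in>UNIV. w n x \<bullet> mpart A i (mpart A i (w m)) x))"
        by (rule Bochner_Integration.integral_sum[symmetric]) (rule i')
      finally show ?thesis by (simp add: inner_sum_right)
    qed
    moreover have "(\<lambda>n. LINT x|?M. w n x \<bullet> ?k x) \<longlonglongrightarrow> (LINT x|?M. 0 \<bullet> ?k x)"
      by (rule inner_integral_tendsto[OF sw(1) sqint_zero sk w0])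
    moreover have "(\<lambda>n. LINT x|?M. mgrad A (w n) x \<bullet> mgrad A (w m) x) \<longlonglongrightarrow> (LINT x|?M. H x \<bullet> mgrad A (w m) x)"
      by (rule inner_integral_tendsto[OF sw(2) sH sw(2) wH])
    ultimately show ?thesis using LIMSEQ_unique by fastforce
  qed
  moreover have "(\<lambda>m. LINT x|?M. mgrad A (w m) x \<bullet> H x) \<longlonglongrightarrow> (LINT x|?M. H x \<bullet> H x)"
    by (rule inner_integral_tendsto[OF sw(2) sH sH wH])
  ultimately have "(LINT x|?M. H x \<bullet> H x) = 0"
    by (simp add: inner_commute LIMSEQ_const_iff)
  then have "l2norm ?M H = 0" by (simp add: l2norm_def power2_norm_eq_inner)
  then show ?thesis by (rule l2norm_eq_0_imp_AE[OF sH])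
qed

lemma form_limit_unique:
  assumes U: "open U" and A: "smooth_pot U A" and "form_limit A U u F" "form_limit A U u G"
  shows "AE x in lebesgue_on U. F x = G x"
proof -
  have "form_limit A U (\<lambda>x. u x + (-1) * u x) (\<lambda>x. F x + (-1) *s G x)"
    by (rule form_limit_lin[OF assms])
  then have "AE x in lebesgue_on U. F x + (-1) *s G x = 0"
    by (intro form_limit_zero[OF U A]) simp
  then show ?thesis by eventually_elim (simp add: vec_eq_iff)
qed

lemma form_limit_sqint: "form_limit A U u F \<Longrightarrow> sqint (lebesgue_on U) u" "form_limit A U u F \<Longrightarrow> sqint (lebesgue_on U) F"
  by (auto simp: form_limit_iff)

lemma form_limit_approx:
  assumes "form_limit A U u F" "0 < e"
  obtains \<phi> where "\<phi> \<in> test_functions U" "l2norm (lebesgue_on U) (\<lambda>x. \<phi> x - u x) < e"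
    "l2norm (lebesgue_on U) (\<lambda>x. mgrad A \<phi> x - F x) < e"
proof -
  obtain \<phi> where \<phi>: "\<And>n. \<phi> n \<in> test_functions U"
     "(\<lambda>n. l2norm (lebesgue_on U) (\<lambda>x. \<phi> n x - u x)) \<longlonglongrightarrow> 0"
     "(\<lambda>n. l2norm (lebesgue_on U) (\<lambda>x. mgrad A (\<phi> n) x - F x)) \<longlonglongrightarrow> 0"
    using assms(1) unfolding form_limit_iff by blast
  have "\<forall>\<^sub>F n in sequentially. l2norm (lebesgue_on U) (\<lambda>x. \<phi> n x - u x) < e \<and>
      l2norm (lebesgue_on U) (\<lambda>x. mgrad A (\<phi> n) x - F x) < e"
    using order_tendstoD(2)[OF \<phi>(2) assms(2)] order_tendstoD(2)[OF \<phi>(3) assms(2)]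
    by eventually_elim simp
  then obtain n where "l2norm (lebesgue_on U) (\<lambda>x. \<phi> n x - u x) < e \<and>
      l2norm (lebesgue_on U) (\<lambda>x. mgrad A (\<phi> n) x - F x) < e"
    using eventually_happens'[OF sequentially_bot] by blast
  then show ?thesis using that[OF \<phi>(1)] by blast
qed

text \<open>A diagonal choice of test functions: the completion is complete.\<close>

lemma form_limit_closed:
  assumes U: "open U" and A: "smooth_pot U A" and uF: "\<And>n. form_limit A U (u n) (F n)"
    and s: "sqint (lebesgue_on U) v" "sqint (lebesgue_on U) G"
    and lim: "(\<lambda>n. l2norm (lebesgue_on U) (\<lambda>x. u n x - v x)) \<longlonglongrightarrow> 0"
      "(\<lambda>n. l2norm (lebesgue_on U) (\<lambda>x. F n x - G x)) \<longlonglongrightarrow> 0"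
  shows "form_limit A U v G"
proof -
  let ?M = "lebesgue_on U"
  have ex: "\<exists>\<phi>. \<phi> \<in> test_functions U \<and> l2norm ?M (\<lambda>x. \<phi> x - u n x) < 1 / real (Suc n) \<and>
      l2norm ?M (\<lambda>x. mgrad A \<phi> x - F n x) < 1 / real (Suc n)" for n
    by (rule form_limit_approx[OF uF[of n], of "1 / real (Suc n)"], simp) blast
  define \<phi> where "\<phi> n = (SOME \<phi>. \<phi> \<in> test_functions U \<and> l2norm ?M (\<lambda>x. \<phi> x - u n x) < 1 / real (Suc n) \<and>
      l2norm ?M (\<lambda>x. mgrad A \<phi> x - F n x) < 1 / real (Suc n))" for n
  have \<phi>: "\<phi> n \<in> test_functions U"
    "l2norm ?M (\<lambda>x. \<phi> n x - u n x) < 1 / real (Suc n)"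
    "l2norm ?M (\<lambda>x. mgrad A (\<phi> n) x - F n x) < 1 / real (Suc n)" for n
    using someI_ex[OF ex[of n]] unfolding \<phi>_def by blast+
  have z: "(\<lambda>n. 1 / real (Suc n)) \<longlonglongrightarrow> 0" by (rule LIMSEQ_Suc[OF lim_1_over_n])
  have "(\<lambda>n. l2norm ?M (\<lambda>x. \<phi> n x - v x)) \<longlonglongrightarrow> 0"
  proof (rule Lim_null_comparison[OF _ tendsto_add_zero[OF z lim(1)]], rule always_eventually, rule allI)
    fix n
    show "norm (l2norm ?M (\<lambda>x. \<phi> n x - v x)) \<le> 1 / real (Suc n) + l2norm ?M (\<lambda>x. u n x - v x)"
      using l2norm_triangle_via[OF test_sqint[OF U \<phi>(1)] form_limit_sqint(1)[OF uF] s(1), of n n] \<phi>(2)[of n] by simp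
  qed
  moreover have "(\<lambda>n. l2norm ?M (\<lambda>x. mgrad A (\<phi> n) x - G x)) \<longlonglongrightarrow> 0"
  proof (rule Lim_null_comparison[OF _ tendsto_add_zero[OF z lim(2)]], rule always_eventually, rule allI)
    fix n
    show "norm (l2norm ?M (\<lambda>x. mgrad A (\<phi> n) x - G x)) \<le> 1 / real (Suc n) + l2norm ?M (\<lambda>x. F n x - G x)"
      using l2norm_triangle_via[OF mgrad_sqint[OF U A \<phi>(1)] form_limit_sqint(2)[OF uF] s(2), of n n] \<phi>(3)[of n] by simp
  qed
  ultimately show ?thesis unfolding form_limit_iff using s \<phi>(1) by blast
qed

lemma mgrad_ext_limit: "u \<in> form_domain A U \<Longrightarrow> form_limit A U u (mgrad_ext A U u)"
  unfolding form_domain_def mgrad_ext_def mem_Collect_eq by (rule someI_ex[of "form_limit A U u"])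

lemma form_limit_domain: "form_limit A U u F \<Longrightarrow> u \<in> form_domain A U"
  unfolding form_domain_def by blast

lemma mgrad_ext_eq:
  assumes "open U" "smooth_pot U A" "form_limit A U u F"
  shows "AE x in lebesgue_on U. mgrad_ext A U u x = F x"
  using form_limit_unique[OF assms(1,2) mgrad_ext_limit[OF form_limit_domain[OF assms(3)]] assms(3)] .

text \<open>Closability makes the arbitrarily chosen \<open>mgrad_ext\<close> interchangeable with any limit of gradients.\<close>

lemma form_norm_sq_eq:
  assumes "open U" "smooth_pot U A" "form_limit A U u F"
  shows "form_norm_sq A U u = (l2norm (lebesgue_on U) F)\<^sup>2"
proof -
  have "l2norm (lebesgue_on U) (mgrad_ext A U u) = l2norm (lebesgue_on U) F"
  proof (rule l2norm_cong_AE)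
    show "AE x in lebesgue_on U. norm (mgrad_ext A U u x) = norm (F x)"
      using mgrad_ext_eq[OF assms] by eventually_elim simp
  qed (use form_limit_sqint(2) assms(3) mgrad_ext_limit[OF form_limit_domain[OF assms(3)]] in \<open>auto simp: sqint_def\<close>)
  then show ?thesis by (simp add: form_norm_sq_def L2_sq_eq)
qed

section \<open>Hermitian products\<close>

definition cip :: "'a measure \<Rightarrow> ('a \<Rightarrow> complex) \<Rightarrow> ('a \<Rightarrow> complex) \<Rightarrow> complex" where
  "cip M f g = (LINT x|M. f x * cnj (g x))"

definition vip :: "'a measure \<Rightarrow> ('a \<Rightarrow> complex^2) \<Rightarrow> ('a \<Rightarrow> complex^2) \<Rightarrow> complex" where
  "vip M F G = (LINT x|M. (\<Sum>i\<in>UNIV. F x $ i * cnj (G x $ i)))"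

lemma integrable_cip:
  assumes f: "sqint M f" and g: "sqint M g"
  shows "integrable M (\<lambda>x. f x * cnj (g x))"
proof (rule Bochner_Integration.integrable_bound)
  have [measurable]: "f \<in> borel_measurable M" "g \<in> borel_measurable M"
    using f g by (auto simp: sqint_def)
  show "integrable M (\<lambda>x. (norm (f x))\<^sup>2 + (norm (g x))\<^sup>2)"
    using sqint_integrable[OF f] sqint_integrable[OF g] by simp
  have [measurable]: "cnj \<in> borel_measurable borel"
    by (intro borel_measurable_continuous_onI continuous_intros)
  show "(\<lambda>x. f x * cnj (g x)) \<in> borel_measurable M" by measurable
  show "AE x in M. norm (f x * cnj (g x)) \<le> norm ((norm (f x))\<^sup>2 + (norm (g x))\<^sup>2)"
  proof (intro AE_I2)
    fix x
    have "0 \<le> norm (f x) * norm (g x)" by simp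
    then have "norm (f x) * norm (g x) \<le> (norm (f x))\<^sup>2 + (norm (g x))\<^sup>2"
      using sum_squares_bound[of "norm (f x)" "norm (g x)"] by linarith
    then show "norm (f x * cnj (g x)) \<le> norm ((norm (f x))\<^sup>2 + (norm (g x))\<^sup>2)"
      by (simp add: norm_mult)
  qed
qed

lemma cip_lin_left:
  assumes "sqint M f" "sqint M g" "sqint M h"
  shows "cip M (\<lambda>x. f x + c * g x) h = cip M f h + c * cip M g h"
proof -
  have "cip M (\<lambda>x. f x + c * g x) h = (LINT x|M. f x * cnj (h x) + c * (g x * cnj (h x)))"
    unfolding cip_def by (rule Bochner_Integration.integral_cong) (simp_all add: algebra_simps)
  then show ?thesis
    using integrable_cip[OF assms(1,3)] integrable_cip[OF assms(2,3)] by (simp add: cip_def)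
qed

lemma cip_cnj: "cip M g f = cnj (cip M f g)"
proof -
  have "cip M g f = (LINT x|M. cnj (f x * cnj (g x)))"
    unfolding cip_def by (rule Bochner_Integration.integral_cong) simp_all
  then show ?thesis by (simp only: cip_def Bochner_Integration.integral_cnj)
qed

lemma cip_self: "cip M f f = complex_of_real ((l2norm M f)\<^sup>2)"
  unfolding cip_def l2norm_sq by (simp add: complex_norm_square[symmetric] flip: integral_complex_of_real)

lemma sqint_nth:
  fixes F :: "'a \<Rightarrow> complex^2"
  assumes "sqint M F"
  shows "sqint M (\<lambda>x. F x $ i)"
  by (rule sqint_dominated[OF assms, where B=1])
     (use assms in \<open>auto simp: sqint_def Finite_Cartesian_Product.norm_nth_le\<close>)

lemma vip_eq:
  assumes "sqint M F" "sqint M G"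
  shows "vip M F G = (\<Sum>i\<in>UNIV. cip M (\<lambda>x. F x $ i) (\<lambda>x. G x $ i))"
  unfolding vip_def cip_def
  by (rule Bochner_Integration.integral_sum) (intro integrable_cip sqint_nth assms)

lemma vip_lin_left:
  assumes "sqint M F" "sqint M G" "sqint M H"
  shows "vip M (\<lambda>x. F x + c *s G x) H = vip M F H + c * vip M G H"
proof -
  have "vip M (\<lambda>x. F x + c *s G x) H = (\<Sum>i\<in>UNIV. cip M (\<lambda>x. F x $ i + c * G x $ i) (\<lambda>x. H x $ i))"
    using vip_eq[OF sqint_add[OF assms(1) sqint_smult[OF assms(2)]] assms(3)] by simp
  also have "\<dots> = (\<Sum>i\<in>UNIV. cip M (\<lambda>x. F x $ i) (\<lambda>x. H x $ i) + c * cip M (\<lambda>x. G x $ i) (\<lambda>x. H x $ i))"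
    by (intro sum.cong refl cip_lin_left sqint_nth assms)
  finally show ?thesis
    by (simp add: vip_eq assms sum.distrib sum_distrib_left)
qed

lemma vip_cnj: "vip M G F = cnj (vip M F G)"
proof -
  have "vip M G F = (LINT x|M. cnj (\<Sum>i\<in>UNIV. F x $ i * cnj (G x $ i)))"
    unfolding vip_def by (rule Bochner_Integration.integral_cong) (simp_all add: mult.commute)
  then show ?thesis by (simp only: vip_def Bochner_Integration.integral_cnj)
qed

lemma vip_self: "vip M F F = complex_of_real ((l2norm M F)\<^sup>2)"
proof -
  have "(norm z)\<^sup>2 = (\<Sum>i\<in>UNIV. (norm (z $ i))\<^sup>2)" for z :: "complex^2"
    by (simp add: norm_vec_def L2_set_def sum_nonneg)
  then show ?thesis unfolding vip_def l2norm_sq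
    by (simp add: complex_norm_square[symmetric] flip: integral_complex_of_real)
qed

lemma vip_cong_AE:
  assumes "sqint M F" "sqint M G" "sqint M F'" "sqint M G'"
    "AE x in M. F x = F' x" "AE x in M. G x = G' x"
  shows "vip M F G = vip M F' G'"
proof -
  have [measurable]: "cnj \<in> borel_measurable borel"
    by (intro borel_measurable_continuous_onI continuous_intros)
  have [measurable]: "F \<in> borel_measurable M" "G \<in> borel_measurable M" "F' \<in> borel_measurable M" "G' \<in> borel_measurable M"
    using assms by (auto simp: sqint_def)
  have "AE x in M. (\<Sum>i\<in>UNIV. F x $ i * cnj (G x $ i)) = (\<Sum>i\<in>UNIV. F' x $ i * cnj (G' x $ i))"
    using assms(5,6) by eventually_elim simp
  then show ?thesis unfolding vip_def by (intro integral_cong_AE) measurable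
qed

lemma l2norm_eq_0_iff_AE: "sqint M f \<Longrightarrow> l2norm M f = 0 \<longleftrightarrow> (AE x in M. f x = 0)"
proof
  assume f: "sqint M f" and "AE x in M. f x = 0"
  then have "l2norm M f = l2norm M (\<lambda>x. 0::real)"
    by (intro l2norm_cong_AE) (auto simp: sqint_def)
  then show "l2norm M f = 0" by simp
qed (rule l2norm_eq_0_imp_AE)

section \<open>Averages along measure preserving orbits\<close>

lemma distr_lborel_orthogonal:
  fixes f :: "real^2 \<Rightarrow> real^2"
  assumes f: "orthogonal_transformation f"
  shows "distr lborel borel f = lborel"
proof (rule lborel_eqI[symmetric])
  have fm: "f \<in> borel_measurable borel"
    using orthogonal_transformation_linear[OF f]
    by (intro borel_measurable_continuous_onI linear_continuous_on linear_conv_bounded_linear[THEN iffD1])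
  define g where "g = inv f"
  have g: "orthogonal_transformation g" unfolding g_def by (rule orthogonal_transformation_inv[OF f])
  have gf: "g (f x) = x" "f (g x) = x" for x
    using orthogonal_transformation_bij[OF f] by (simp_all add: g_def bij_is_inj bij_is_surj surj_f_inv_f)
  fix l u :: "real^2" assume lu: "\<And>b. b \<in> Basis \<Longrightarrow> l \<bullet> b \<le> u \<bullet> b"
  have pre: "f -` box l u = g ` box l u"
  proof
    show "f -` box l u \<subseteq> g ` box l u" using gf(1) by (metis imageI subsetI vimageD)
    show "g ` box l u \<subseteq> f -` box l u" using gf(2) by auto
  qed
  have gb: "g ` box l u \<in> sets borel"
    unfolding pre[symmetric] using measurable_sets[OF fm, of "box l u"] by simp
  have "emeasure (distr lborel borel f) (box l u) = emeasure lborel (g ` box l u)"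
    using fm pre by (subst emeasure_distr) auto
  also have "\<dots> = emeasure lebesgue (g ` box l u)"
    using gb by simp
  also have "\<dots> = ennreal (measure lebesgue (g ` box l u))"
    by (rule emeasure_eq_measure2[THEN trans]) (use measurable_orthogonal_image[OF g lmeasurable_box, of l u] in \<open>auto simp: fmeasurable_def\<close>)
  also have "\<dots> = ennreal (measure lebesgue (box l u))"
    by (subst measure_orthogonal_image[OF g]) auto
  also have "\<dots> = ennreal (\<Prod>b\<in>Basis. (u - l) \<bullet> b)"
    using lu by (simp add: measure_completion measure_lborel_box)
  finally show "emeasure (distr lborel borel f) (box l u) = ennreal (\<Prod>b\<in>Basis. (u - l) \<bullet> b)" .
qed simp

lemma nn_integral_orthogonal:
  fixes f :: "real^2 \<Rightarrow> real^2" and h :: "real^2 \<Rightarrow> ennreal"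
  assumes f: "orthogonal_transformation f" and h: "h \<in> borel_measurable borel"
  shows "(\<integral>\<^sup>+x. h (f x) \<partial>lborel) = (\<integral>\<^sup>+x. h x \<partial>lborel)"
proof -
  have fm: "f \<in> borel_measurable borel"
    using orthogonal_transformation_linear[OF f]
    by (intro borel_measurable_continuous_onI linear_continuous_on linear_conv_bounded_linear[THEN iffD1])
  have "(\<integral>\<^sup>+x. h x \<partial>distr lborel borel f) = (\<integral>\<^sup>+x. h (f x) \<partial>lborel)"
    by (rule nn_integral_distr) (use fm h in auto)
  then show ?thesis by (simp add: distr_lborel_orthogonal[OF f])
qed

lemma nn_integral_translation:
  fixes h :: "real^2 \<Rightarrow> ennreal"
  assumes h: "h \<in> borel_measurable borel"
  shows "(\<integral>\<^sup>+x. h (x + v) \<partial>lborel) = (\<integral>\<^sup>+x. h x \<partial>lborel)"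
proof -
  have "(\<integral>\<^sup>+x. h x \<partial>distr lborel borel ((+) v)) = (\<integral>\<^sup>+x. h (v + x) \<partial>lborel)"
    by (rule nn_integral_distr) (use h in auto)
  then show ?thesis by (simp add: lborel_distr_plus add.commute)
qed

text \<open>The Cauchy-Schwarz inequality against the constant function, from the variance of \<open>m\<close>.\<close>

lemma square_integral_le:
  fixes m :: "real \<Rightarrow> real"
  assumes c: "continuous_on {0..L} m" and L: "0 < L"
  shows "(integral {0..L} m)\<^sup>2 \<le> L * integral {0..L} (\<lambda>t. (m t)\<^sup>2)"
proof -
  have i: "m integrable_on {0..L}" "(\<lambda>t. (m t)\<^sup>2) integrable_on {0..L}"
    by (intro integrable_continuous_interval continuous_intros c)+
  define b where "b = integral {0..L} m / L"
  have "0 \<le> integral {0..L} (\<lambda>t. (m t - b)\<^sup>2)"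
    by (rule integral_nonneg) (auto intro!: integrable_continuous_interval continuous_intros c)
  also have "integral {0..L} (\<lambda>t. (m t - b)\<^sup>2) = integral {0..L} (\<lambda>t. ((m t)\<^sup>2 - 2 * b * m t) + b\<^sup>2)"
    by (simp add: power2_diff algebra_simps)
  also have "\<dots> = (integral {0..L} (\<lambda>t. (m t)\<^sup>2) - 2 * b * integral {0..L} m) + L * b\<^sup>2"
  proof -
    have i3: "(\<lambda>t. 2 * b * m t) integrable_on {0..L}" using i(1) by (rule integrable_on_mult_right)
    show ?thesis
      using Henstock_Kurzweil_Integration.integral_add[OF integrable_diff[OF i(2) i3] integrable_const_ivl[of "b\<^sup>2"]]
        Henstock_Kurzweil_Integration.integral_diff[OF i(2) i3] L by simp
  qed
  also have "L * \<dots> = L * integral {0..L} (\<lambda>t. (m t)\<^sup>2) - (integral {0..L} m)\<^sup>2"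
    using L by (simp add: b_def field_simps power2_eq_square)
  finally show ?thesis using L by (simp add: zero_le_mult_iff)
qed

text \<open>The two averaging arguments below (over rotations and over translations) share this shape: a
  pointwise bound by an integral along an orbit of a measure preserving flow is squared and then
  integrated over the plane.\<close>

lemma orbit_average_bound:
  fixes m :: "real^2 \<Rightarrow> real" and T :: "real \<Rightarrow> real^2 \<Rightarrow> real^2" and f :: "real^2 \<Rightarrow> real"
  assumes m: "continuous_on UNIV m" "\<And>x. 0 \<le> m x"
    and T: "continuous_on UNIV (\<lambda>(t, x). T t x)"
    and inv: "\<And>t h. h \<in> borel_measurable borel \<Longrightarrow> (\<integral>\<^sup>+x. h (T t x) \<partial>lborel) = (\<integral>\<^sup>+x. h x \<partial>(lborel :: (real^2) measure))"
    and L: "0 < L" and f: "\<And>x. 0 \<le> f x" "\<And>x. f x \<le> integral {0..L} (\<lambda>t. m (T t x))"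
  shows "(\<integral>\<^sup>+x. ennreal ((f x)\<^sup>2) \<partial>lborel) \<le> ennreal (L\<^sup>2) * (\<integral>\<^sup>+x. ennreal ((m x)\<^sup>2) \<partial>lborel)"
proof -
  have mT: "continuous_on UNIV (\<lambda>p. m (T (fst p) (snd p)))"
    by (rule continuous_on_compose2[OF m(1) T[unfolded case_prod_beta]]) auto
  have mt: "continuous_on {0..L} (\<lambda>t. m (T t x))" for x
    by (rule continuous_on_compose2[OF mT, of _ "\<lambda>t. (t, x)", simplified]) (auto intro!: continuous_intros)
  have meas: "(\<lambda>p. ennreal ((m (T (snd p) (fst p)))\<^sup>2) * indicator {0..L} (snd p)) \<in> borel_measurable (lborel \<Otimes>\<^sub>M lborel)"
  proof -
    have c: "continuous_on UNIV (\<lambda>p. m (T (snd p) (fst p)))"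
      by (rule continuous_on_compose2[OF mT, of _ "\<lambda>p. (snd p, fst p)", simplified]) (auto intro!: continuous_intros)
    have "(\<lambda>p. m (T (snd p) (fst p))) \<in> borel_measurable (borel \<Otimes>\<^sub>M borel)"
      unfolding borel_prod by (rule borel_measurable_continuous_onI[OF c])
    then have 1: "(\<lambda>p. m (T (snd p) (fst p))) \<in> borel_measurable (lborel \<Otimes>\<^sub>M lborel)"
      by (simp cong: measurable_cong_sets sets_pair_measure_cong)
    have 2: "(\<lambda>p. indicator {0..L} (snd p) :: ennreal) \<in> borel_measurable ((lborel :: (real^2) measure) \<Otimes>\<^sub>M (lborel :: real measure))"
      by measurable
    show ?thesis using 1 2 by measurable
  qed
  have pt: "ennreal ((f x)\<^sup>2) \<le> ennreal L * (\<integral>\<^sup>+t. ennreal ((m (T t x))\<^sup>2) * indicator {0..L} t \<partial>lborel)" for x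
  proof -
    have "(f x)\<^sup>2 \<le> (integral {0..L} (\<lambda>t. m (T t x)))\<^sup>2" by (intro power_mono f)
    also have "\<dots> \<le> L * integral {0..L} (\<lambda>t. (m (T t x))\<^sup>2)" by (rule square_integral_le[OF mt L])
    finally have 1: "(f x)\<^sup>2 \<le> L * integral {0..L} (\<lambda>t. (m (T t x))\<^sup>2)" .
    have "((\<lambda>t. (m (T t x))\<^sup>2) has_integral integral {0..L} (\<lambda>t. (m (T t x))\<^sup>2)) {0..L}"
      by (intro integrable_integral integrable_continuous_interval continuous_intros mt)
    then have "(\<integral>\<^sup>+t. ennreal ((m (T t x))\<^sup>2) * indicator {0..L} t \<partial>lborel) = ennreal (integral {0..L} (\<lambda>t. (m (T t x))\<^sup>2))"
      by (intro nn_integral_has_integral_lebesgue') auto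
    then show ?thesis using 1 L by (simp add: ennreal_leI flip: ennreal_mult')
  qed
  have "(\<integral>\<^sup>+x. ennreal ((f x)\<^sup>2) \<partial>lborel)
      \<le> (\<integral>\<^sup>+x. ennreal L * (\<integral>\<^sup>+t. ennreal ((m (T t x))\<^sup>2) * indicator {0..L} t \<partial>lborel) \<partial>lborel)"
    by (intro nn_integral_mono pt)
  also have "\<dots> = ennreal L * (\<integral>\<^sup>+x. (\<integral>\<^sup>+t. ennreal ((m (T t x))\<^sup>2) * indicator {0..L} t \<partial>lborel) \<partial>lborel)"
    using lborel.borel_measurable_nn_integral[of "\<lambda>x t. ennreal ((m (T t x))\<^sup>2) * indicator {0..L} t" lborel] meas
    by (intro nn_integral_cmult) (simp add: case_prod_beta)
  also have "(\<integral>\<^sup>+x. (\<integral>\<^sup>+t. ennreal ((m (T t x))\<^sup>2) * indicator {0..L} t \<partial>lborel) \<partial>lborel)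
      = (\<integral>\<^sup>+t. (\<integral>\<^sup>+x. ennreal ((m (T t x))\<^sup>2) * indicator {0..L} t \<partial>lborel) \<partial>lborel)"
    by (rule lborel_pair.Fubini'[symmetric]) (use meas in \<open>simp add: case_prod_beta\<close>)
  also have "\<dots> = (\<integral>\<^sup>+t. (\<integral>\<^sup>+x. ennreal ((m x)\<^sup>2) \<partial>lborel) * indicator {0..L} t \<partial>lborel)"
  proof (rule nn_integral_cong)
    fix t
    have mm: "(\<lambda>x. ennreal ((m x)\<^sup>2)) \<in> borel_measurable borel"
      using borel_measurable_continuous_onI[OF m(1)] by measurable
    show "(\<integral>\<^sup>+x. ennreal ((m (T t x))\<^sup>2) * indicator {0..L} t \<partial>lborel) = (\<integral>\<^sup>+x. ennreal ((m x)\<^sup>2) \<partial>lborel) * indicator {0..L} t"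
      using inv[OF mm] by (cases "t \<in> {0..L}") auto
  qed
  also have "\<dots> = (\<integral>\<^sup>+x. ennreal ((m x)\<^sup>2) \<partial>lborel) * ennreal L"
    using L by (simp add: nn_integral_cmult)
  finally show ?thesis
    using L by (simp add: power2_eq_square ennreal_mult' mult.assoc mult.commute)
qed

section \<open>The Hardy inequality for test functions\<close>

definition perp :: "real^2 \<Rightarrow> real^2" where
  "perp v = vector [- (v$2), v$1]"

lemma perp_nth [simp]: "perp v $ 1 = - (v$2)" "perp v $ 2 = v$1"
  by (simp_all add: perp_def)

lemma inner_real2: "(x::real^2) \<bullet> y = x$1 * y$1 + x$2 * y$2"
  by (simp add: inner_vec_def sum_2)

lemma perp_props: "v \<bullet> perp v = 0" "perp v \<bullet> perp v = v \<bullet> v" "perp (perp v) = - v"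
  "norm (perp v) = norm v" "perp (a *\<^sub>R v) = a *\<^sub>R perp v" "perp (v + w) = perp v + perp w" "perp (v - w) = perp v - perp w"
  by (simp_all add: inner_real2 vec_eq_iff forall_2 norm_eq_sqrt_inner)

lemma bounded_linear_perp: "bounded_linear perp"
  by (rule linear_conv_bounded_linear[THEN iffD1]) (auto intro!: linearI simp: perp_props)

definition rot :: "real \<Rightarrow> real^2 \<Rightarrow> real^2" where
  "rot t v = cos t *\<^sub>R v + sin t *\<^sub>R perp v"

lemma rot_orthogonal: "orthogonal_transformation (rot t)"
  unfolding orthogonal_transformation
proof
  show "linear (rot t)"
    by (rule linearI) (simp_all add: rot_def perp_props algebra_simps)
  show "\<forall>v. norm (rot t v) = norm v"
  proof
    fix v
    have "rot t v \<bullet> rot t v = cos t * cos t * (v \<bullet> v) + sin t * sin t * (v \<bullet> v)"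
      unfolding rot_def by (simp add: inner_add_left inner_add_right perp_props inner_commute[of "perp v" v] algebra_simps)
    also have "\<dots> = v \<bullet> v" by (simp flip: distrib_right)
    finally show "norm (rot t v) = norm v" by (simp add: norm_eq_sqrt_inner)
  qed
qed

lemma norm_rot [simp]: "norm (rot t v) = norm v"
  using rot_orthogonal orthogonal_transformation_norm by blast

lemma rot_deriv: "((\<lambda>t. rot t v) has_vector_derivative perp (rot t v)) (at t within S)"
  unfolding rot_def by (auto intro!: derivative_eq_intros simp: perp_props algebra_simps)

lemma AB_potential_perp: "AB_potential \<alpha> a x = (\<alpha> / (norm (x - a))\<^sup>2) *\<^sub>R perp (x - a)"
  by (simp add: vec_eq_iff forall_2 AB_potential_def)

lemma AB_potential_rot:
  "x \<noteq> a \<Longrightarrow> AB_potential \<alpha> a x \<bullet> perp (x - a) = \<alpha>"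
  unfolding AB_potential_perp by (simp add: perp_props(2) power2_norm_eq_inner)

lemma frechet_derivative_pd:
  assumes "\<phi> \<in> test_functions U"
  shows "frechet_derivative \<phi> (at x) h = (\<Sum>i\<in>UNIV. complex_of_real (h $ i) * pd i \<phi> x)"
proof -
  have lin: "linear (frechet_derivative \<phi> (at x))"
    using test_has_derivative[OF assms] by (rule has_derivative_linear)
  have "h = (\<Sum>i\<in>UNIV. (h $ i) *\<^sub>R axis i 1)"
    by (simp add: vec_eq_iff axis_def if_distrib cong: if_cong)
  then have "frechet_derivative \<phi> (at x) h = frechet_derivative \<phi> (at x) (\<Sum>i\<in>UNIV. (h $ i) *\<^sub>R axis i 1)"
    by (rule arg_cong)
  also have "\<dots> = (\<Sum>i\<in>UNIV. (h $ i) *\<^sub>R frechet_derivative \<phi> (at x) (axis i 1))"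
    unfolding linear_sum[OF lin] linear_cmul[OF lin] ..
  finally have "frechet_derivative \<phi> (at x) h = (\<Sum>i\<in>UNIV. (h $ i) *\<^sub>R frechet_derivative \<phi> (at x) (axis i 1))" .
  then show ?thesis by (simp add: pd_def scaleR_conv_of_real)
qed

lemma norm_complex_dot_le:
  fixes w :: "real^2" and F :: "complex^2"
  shows "norm (\<Sum>i\<in>UNIV. complex_of_real (w $ i) * F $ i) \<le> norm w * norm F"
proof -
  have "norm (\<Sum>i\<in>UNIV. complex_of_real (w $ i) * F $ i) \<le> (\<Sum>i\<in>UNIV. norm (w $ i) * norm (F $ i))"
    by (rule order_trans[OF norm_sum]) (simp add: norm_mult)
  also have "\<dots> \<le> norm w * norm F"
    unfolding norm_vec_def using L2_set_mult_ineq[of "\<lambda>i. norm (w $ i)" "\<lambda>i. norm (F $ i)" UNIV] by simp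
  finally show ?thesis .
qed

text \<open>Along the circle of radius \<open>|x - a|\<close> the function \<open>e\<^sup>-\<^sup>i\<^sup>\<alpha>\<^sup>t \<phi>\<close> has derivative of size
  \<open>|x - a| |(i\<nabla> + A\<^sub>a)\<phi>|\<close>, but after one turn it has been multiplied by \<open>e\<^sup>-\<^sup>2\<^sup>\<pi>\<^sup>i\<^sup>\<alpha> \<noteq> 1\<close>. So \<open>|\<phi>(x)|\<close>
  is bounded by an integral over the circle, and rotation invariance gives a Hardy inequality with a
  constant that depends on \<open>\<alpha>\<close> only.\<close>

lemma circle_bound:
  assumes \<phi>: "\<phi> \<in> test_functions (- {a})" and x: "x \<noteq> a"
  shows "norm (exp (- 2 * pi * \<alpha> * \<i>) - 1) * norm (\<phi> x) \<le>
     norm (x - a) * integral {0..2*pi} (\<lambda>t. norm (mgrad (AB_potential \<alpha> a) \<phi> (a + rot t (x - a))))"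
proof -
  define m where "m t = norm (mgrad (AB_potential \<alpha> a) \<phi> (a + rot t (x - a)))" for t
  define y where "y t = a + rot t (x - a)" for t
  define e where "e t = exp (- \<i> * complex_of_real \<alpha> * complex_of_real t) * \<phi> (y t)" for t
  define e' where "e' t = exp (- \<i> * complex_of_real \<alpha> * complex_of_real t) *
     (frechet_derivative \<phi> (at (y t)) (perp (y t - a)) - \<i> * complex_of_real \<alpha> * \<phi> (y t))" for t
  have ya: "y t \<noteq> a" for t
  proof
    assume "y t = a"
    then have "norm (rot t (x - a)) = 0" by (simp add: y_def)
    then show False using x by simp
  qed
  have ny: "norm (y t - a) = norm (x - a)" for t by (simp add: y_def)
  have dy: "(y has_vector_derivative perp (y t - a)) (at t within {0..2*pi})" for t
    unfolding y_def using rot_deriv[of "x - a" t] by (auto intro!: derivative_eq_intros)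
  have d\<phi>: "((\<lambda>t. \<phi> (y t)) has_vector_derivative frechet_derivative \<phi> (at (y t)) (perp (y t - a))) (at t within {0..2*pi})" for t
    using vector_derivative_diff_chain_within[OF dy has_derivative_at_withinI[OF test_has_derivative[OF \<phi>]], of t]
    by (simp add: o_def)
  have dexp: "((\<lambda>t. exp (- \<i> * complex_of_real \<alpha> * complex_of_real t)) has_vector_derivative
      (- \<i> * complex_of_real \<alpha>) * exp (- \<i> * complex_of_real \<alpha> * complex_of_real t)) (at t within {0..2*pi})" for t
  proof -
    have "((\<lambda>z. exp (- \<i> * complex_of_real \<alpha> * z)) has_field_derivative
      (- \<i> * complex_of_real \<alpha>) * exp (- \<i> * complex_of_real \<alpha> * complex_of_real t)) (at (complex_of_real t))"
      by (auto intro!: derivative_eq_intros)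
    then show ?thesis
      by (rule has_vector_derivative_real_field[THEN has_vector_derivative_at_within, unfolded o_def])
  qed
  have de: "(e has_vector_derivative e' t) (at t within {0..2*pi})" for t
    unfolding e_def e'_def
    by (rule has_vector_derivative_eq_rhs[OF has_vector_derivative_mult[OF dexp d\<phi>]]) (simp add: algebra_simps)
  have e'_eq: "e' t = exp (- \<i> * complex_of_real \<alpha> * complex_of_real t) * (- \<i>) *
      (\<Sum>i\<in>UNIV. complex_of_real (perp (y t - a) $ i) * mgrad (AB_potential \<alpha> a) \<phi> (y t) $ i)" for t
  proof -
    let ?w = "perp (y t - a)" and ?A = "AB_potential \<alpha> a (y t)"
    have "(\<Sum>i\<in>UNIV. complex_of_real (?w $ i) * mgrad (AB_potential \<alpha> a) \<phi> (y t) $ i)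
      = \<i> * (\<Sum>i\<in>UNIV. complex_of_real (?w $ i) * pd i \<phi> (y t)) + complex_of_real (?A \<bullet> ?w) * \<phi> (y t)"
      unfolding mgrad_nth mpart_def inner_vec_def sum_2 by (simp add: algebra_simps)
    also have "\<dots> = \<i> * frechet_derivative \<phi> (at (y t)) ?w + complex_of_real \<alpha> * \<phi> (y t)"
      unfolding frechet_derivative_pd[OF \<phi>] AB_potential_rot[OF ya] ..
    finally show ?thesis by (simp add: e'_def algebra_simps)
  qed
  have e'_le: "norm (e' t) \<le> norm (x - a) * m t" for t
  proof -
    have "norm (e' t) = norm (\<Sum>i\<in>UNIV. complex_of_real (perp (y t - a) $ i) * mgrad (AB_potential \<alpha> a) \<phi> (y t) $ i)"
      unfolding e'_eq norm_mult by simp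
    also have "\<dots> \<le> norm (perp (y t - a)) * norm (mgrad (AB_potential \<alpha> a) \<phi> (y t))"
      by (rule norm_complex_dot_le)
    finally show ?thesis unfolding perp_props(4) ny unfolding m_def y_def .
  qed
  have mc: "continuous_on {0..2*pi} m"
    unfolding m_def
    by (intro continuous_on_norm continuous_on_compose2[OF mgrad_continuous[OF _ smooth_pot_AB \<phi>]])
       (auto simp: rot_def intro!: continuous_intros)
  have I: "(e' has_integral (e (2*pi) - e 0)) {0..2*pi}"
    by (rule fundamental_theorem_of_calculus) (use de in auto)
  have "norm (e (2*pi) - e 0) \<le> integral {0..2*pi} (\<lambda>t. norm (x - a) * m t)"
    unfolding integral_unique[OF I, symmetric]
    by (intro integral_norm_bound_integral has_integral_integrable[OF I] e'_le
        integrable_continuous_interval continuous_intros mc)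
  moreover have "e (2*pi) - e 0 = (exp (- 2 * pi * \<alpha> * \<i>) - 1) * \<phi> x"
    by (simp add: e_def y_def rot_def algebra_simps)
  ultimately show ?thesis by (simp add: norm_mult m_def)
qed

text \<open>This is where the circulation must not be an integer.\<close>

lemma exp_circulation_ne:
  assumes "0 < \<alpha>" "\<alpha> < 1"
  shows "exp (- 2 * pi * \<alpha> * \<i>) \<noteq> 1"
proof
  assume "exp (- 2 * pi * \<alpha> * \<i>) = 1"
  then obtain n :: int where "Im (- 2 * pi * \<alpha> * \<i>) = of_int (2 * n) * pi"
    unfolding exp_eq_1 by blast
  then have "pi * (- \<alpha>) = pi * of_int n" by simp
  then have "- \<alpha> = of_int n" unfolding mult_cancel_left by simp
  then have "-1 < real_of_int n" "real_of_int n < 0" using assms by linarith+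
  then have "-1 < n" "n < 0" by simp_all
  then show False by linarith
qed

definition hardy_const :: "real \<Rightarrow> real" where
  "hardy_const \<alpha> = 2 * pi / norm (exp (- 2 * pi * \<alpha> * \<i>) - 1)"

lemma hardy_const_pos: "0 < \<alpha> \<Longrightarrow> \<alpha> < 1 \<Longrightarrow> 0 < hardy_const \<alpha>"
  using exp_circulation_ne[of \<alpha>] unfolding hardy_const_def by (intro divide_pos_pos) auto

lemma AB_hardy_test:
  assumes \<alpha>: "0 < \<alpha>" "\<alpha> < 1" and \<phi>: "\<phi> \<in> test_functions (- {a})"
  shows "(\<integral>\<^sup>+x. ennreal ((norm (\<phi> x) / norm (x - a))\<^sup>2) \<partial>lborel) \<le>
     ennreal ((hardy_const \<alpha>)\<^sup>2) * (\<integral>\<^sup>+x. ennreal ((norm (mgrad (AB_potential \<alpha> a) \<phi> x))\<^sup>2) \<partial>lborel)"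
proof -
  define k where "k = norm (exp (- 2 * pi * \<alpha> * \<i>) - 1)"
  have k: "0 < k" using exp_circulation_ne[OF \<alpha>] by (simp add: k_def)
  let ?m = "\<lambda>x. norm (mgrad (AB_potential \<alpha> a) \<phi> x) / k"
  have mc: "continuous_on UNIV (\<lambda>x. norm (mgrad (AB_potential \<alpha> a) \<phi> x))"
    by (intro continuous_on_norm mgrad_continuous[OF _ smooth_pot_AB \<phi>]) auto
  have "(\<integral>\<^sup>+x. ennreal ((norm (\<phi> x) / norm (x - a))\<^sup>2) \<partial>lborel) \<le>
     ennreal ((2 * pi)\<^sup>2) * (\<integral>\<^sup>+x. ennreal ((?m x)\<^sup>2) \<partial>lborel)"
  proof (rule orbit_average_bound[where T="\<lambda>t x. a + rot t (x - a)"])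
    show "continuous_on UNIV ?m" using k by (intro continuous_intros mc) auto
    show "continuous_on UNIV (\<lambda>(t, x). a + rot t (x - a))"
      unfolding rot_def case_prod_beta
      by (intro continuous_intros bounded_linear.continuous_on[OF bounded_linear_perp])
    fix t :: real and h :: "real^2 \<Rightarrow> ennreal" assume h: "h \<in> borel_measurable borel"
    have ha: "(\<lambda>y. h (y + a)) \<in> borel_measurable borel" using h by measurable
    have rm: "rot t \<in> borel_measurable borel"
      unfolding rot_def by (intro borel_measurable_continuous_onI continuous_intros bounded_linear.continuous_on[OF bounded_linear_perp])
    have hr: "(\<lambda>y. h (rot t y + a)) \<in> borel_measurable borel"
      using measurable_compose[OF rm ha] .
    have "(\<integral>\<^sup>+x. h (a + rot t (x - a)) \<partial>lborel) = (\<integral>\<^sup>+x. h (rot t x + a) \<partial>lborel)"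
      using nn_integral_translation[OF hr, of "- a"] by (simp add: add.commute)
    also have "\<dots> = (\<integral>\<^sup>+x. h (x + a) \<partial>lborel)" by (rule nn_integral_orthogonal[OF rot_orthogonal ha])
    also have "\<dots> = (\<integral>\<^sup>+x. h x \<partial>lborel)" by (rule nn_integral_translation[OF h])
    finally show "(\<integral>\<^sup>+x. h (a + rot t (x - a)) \<partial>lborel) = (\<integral>\<^sup>+x. h x \<partial>lborel)" .
  next
    fix x
    show "norm (\<phi> x) / norm (x - a) \<le> integral {0..2*pi} (\<lambda>t. ?m (a + rot t (x - a)))"
    proof (cases "x = a")
      case True
      then show ?thesis using k by (auto intro!: integral_nonneg integrable_continuous_interval continuous_intros simp: rot_def perp_props(5)[of 0, simplified])
    next
      case False
      define I where "I = integral {0..2*pi} (\<lambda>t. norm (mgrad (AB_potential \<alpha> a) \<phi> (a + rot t (x - a))))"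
      have "k * norm (\<phi> x) \<le> norm (x - a) * I"
        using circle_bound[OF \<phi> False, of \<alpha>] by (simp add: k_def I_def)
      then have "norm (\<phi> x) / norm (x - a) \<le> I / k"
        using k False by (simp add: field_simps)
      then show ?thesis by (simp add: I_def)
    qed
  qed (use k in auto)
  also have "\<dots> = ennreal ((2 * pi)\<^sup>2) * (ennreal (1 / k\<^sup>2) * (\<integral>\<^sup>+x. ennreal ((norm (mgrad (AB_potential \<alpha> a) \<phi> x))\<^sup>2) \<partial>lborel))"
  proof -
    have "ennreal ((?m x)\<^sup>2) = ennreal (1 / k\<^sup>2) * ennreal ((norm (mgrad (AB_potential \<alpha> a) \<phi> x))\<^sup>2)" for x
      by (simp add: power_divide flip: ennreal_mult')
    then show ?thesis
      using borel_measurable_continuous_onI[OF mc] by (simp add: nn_integral_cmult)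
  qed
  also have "\<dots> = ennreal ((hardy_const \<alpha>)\<^sup>2) * (\<integral>\<^sup>+x. ennreal ((norm (mgrad (AB_potential \<alpha> a) \<phi> x))\<^sup>2) \<partial>lborel)"
  proof -
    have "hardy_const \<alpha> = 2 * pi / k" unfolding hardy_const_def k_def ..
    then show ?thesis
      unfolding mult.assoc[symmetric]
      by (subst ennreal_mult'[symmetric]) (simp_all add: power_divide)
  qed
  finally show ?thesis .
qed

section \<open>Removing a point from the domain\<close>

context
  fixes \<Omega> :: "(real^2) set" and a :: "real^2"
  assumes \<Omega>: "open \<Omega>"
begin

lemma sets_lebesgue_remove: "\<Omega> \<inter> space lebesgue \<in> sets lebesgue" "(\<Omega> - {a}) \<inter> space lebesgue \<in> sets lebesgue"
  using \<Omega> by auto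

lemma AE_lebesgue_ne: "AE x in lebesgue. x \<noteq> a"
  by (rule AE_completion) (rule AE_lborel_singleton)

lemma measurable_remove_point:
  fixes f :: "real^2 \<Rightarrow> 'b::euclidean_space"
  shows "f \<in> borel_measurable (lebesgue_on (\<Omega> - {a})) \<longleftrightarrow> f \<in> borel_measurable (lebesgue_on \<Omega>)"
  unfolding borel_measurable_restrict_space_iff[OF sets_lebesgue_remove(1)]
    borel_measurable_restrict_space_iff[OF sets_lebesgue_remove(2)]
proof -
  have e1: "(\<lambda>x. indicator \<Omega> x *\<^sub>R f x) = (\<lambda>x. indicator (\<Omega> - {a}) x *\<^sub>R f x + indicator (\<Omega> \<inter> {a}) x *\<^sub>R f a)"
    and e2: "(\<lambda>x. indicator (\<Omega> - {a}) x *\<^sub>R f x) = (\<lambda>x. indicator \<Omega> x *\<^sub>R f x - indicator (\<Omega> \<inter> {a}) x *\<^sub>R f a)"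
    by (auto simp: indicator_def fun_eq_iff)
  have s: "\<Omega> \<inter> {a} \<in> sets lebesgue" using \<Omega> by auto
  have m: "(\<lambda>x. indicator (\<Omega> \<inter> {a}) x *\<^sub>R f a) \<in> borel_measurable lebesgue"
    using s by (intro borel_measurable_scaleR borel_measurable_indicator borel_measurable_const)
  show "(\<lambda>x. indicator (\<Omega> - {a}) x *\<^sub>R f x) \<in> borel_measurable lebesgue \<longleftrightarrow>
      (\<lambda>x. indicator \<Omega> x *\<^sub>R f x) \<in> borel_measurable lebesgue"
  proof
    assume "(\<lambda>x. indicator (\<Omega> - {a}) x *\<^sub>R f x) \<in> borel_measurable lebesgue"
    from borel_measurable_add[OF this m] show "(\<lambda>x. indicator \<Omega> x *\<^sub>R f x) \<in> borel_measurable lebesgue"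
      unfolding e1 .
  next
    assume "(\<lambda>x. indicator \<Omega> x *\<^sub>R f x) \<in> borel_measurable lebesgue"
    from borel_measurable_diff[OF this m] show "(\<lambda>x. indicator (\<Omega> - {a}) x *\<^sub>R f x) \<in> borel_measurable lebesgue"
      unfolding e2 .
  qed
qed

lemma AE_indicator_remove:
  fixes f :: "real^2 \<Rightarrow> 'b::euclidean_space"
  shows "AE x in lebesgue. indicator (\<Omega> - {a}) x *\<^sub>R f x = indicator \<Omega> x *\<^sub>R f x"
  using AE_lebesgue_ne by eventually_elim (auto simp: indicator_def)

lemma integrable_remove_point:
  fixes f :: "real^2 \<Rightarrow> 'b::euclidean_space"
  shows "integrable (lebesgue_on (\<Omega> - {a})) f \<longleftrightarrow> integrable (lebesgue_on \<Omega>) f"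
proof (cases "f \<in> borel_measurable (lebesgue_on \<Omega>)")
  case True
  then have m: "(\<lambda>x. indicator \<Omega> x *\<^sub>R f x) \<in> borel_measurable lebesgue"
     "(\<lambda>x. indicator (\<Omega> - {a}) x *\<^sub>R f x) \<in> borel_measurable lebesgue"
    using measurable_remove_point[of f] borel_measurable_restrict_space_iff[OF sets_lebesgue_remove(1)]
    borel_measurable_restrict_space_iff[OF sets_lebesgue_remove(2)] by blast+
  show ?thesis
    unfolding integrable_restrict_space[OF sets_lebesgue_remove(1)] integrable_restrict_space[OF sets_lebesgue_remove(2)]
    by (rule integrable_cong_AE[OF m(2,1) AE_indicator_remove])
next
  case False
  then show ?thesis using measurable_remove_point[of f] borel_measurable_integrable by blast
qed

lemma integral_remove_point:
  fixes f :: "real^2 \<Rightarrow> 'b::euclidean_space"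
  shows "(LINT x|lebesgue_on (\<Omega> - {a}). f x) = (LINT x|lebesgue_on \<Omega>. f x)"
proof (cases "f \<in> borel_measurable (lebesgue_on \<Omega>)")
  case True
  then have m: "(\<lambda>x. indicator \<Omega> x *\<^sub>R f x) \<in> borel_measurable lebesgue"
     "(\<lambda>x. indicator (\<Omega> - {a}) x *\<^sub>R f x) \<in> borel_measurable lebesgue"
    using measurable_remove_point[of f] borel_measurable_restrict_space_iff[OF sets_lebesgue_remove(1)]
    borel_measurable_restrict_space_iff[OF sets_lebesgue_remove(2)] by blast+
  show ?thesis
    unfolding integral_restrict_space[OF sets_lebesgue_remove(1)] integral_restrict_space[OF sets_lebesgue_remove(2)]
    by (rule integral_cong_AE[OF m(2,1) AE_indicator_remove])
next
  case False
  then have "\<not> integrable (lebesgue_on \<Omega>) f" "\<not> integrable (lebesgue_on (\<Omega> - {a})) f"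
    using measurable_remove_point[of f] borel_measurable_integrable by blast+
  then show ?thesis by (simp add: not_integrable_integral_eq)
qed

lemma sqint_remove_point:
  fixes f :: "real^2 \<Rightarrow> 'b::euclidean_space"
  shows "sqint (lebesgue_on (\<Omega> - {a})) f \<longleftrightarrow> sqint (lebesgue_on \<Omega>) f"
  unfolding sqint_def measurable_remove_point integrable_remove_point ..

lemma l2norm_remove_point:
  fixes f :: "real^2 \<Rightarrow> 'b::euclidean_space"
  shows "l2norm (lebesgue_on (\<Omega> - {a})) f = l2norm (lebesgue_on \<Omega>) f"
  unfolding l2norm_def integral_remove_point ..

end

section \<open>The Hardy inequality on the form domain\<close>

lemma AB_hardy_l2_test:
  assumes \<alpha>: "0 < \<alpha>" "\<alpha> < 1" and U: "open U" "a \<notin> U" and \<phi>: "\<phi> \<in> test_functions U"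
  shows "sqint (lebesgue_on U) (\<lambda>x. norm (\<phi> x) / norm (x - a))" (is "sqint ?M ?h")
    "l2norm (lebesgue_on U) (\<lambda>x. norm (\<phi> x) / norm (x - a)) \<le> hardy_const \<alpha> * l2norm (lebesgue_on U) (mgrad (AB_potential \<alpha> a) \<phi>)"
proof -
  have Ua: "U \<subseteq> - {a}" using U by auto
  note A = smooth_pot_subset[OF smooth_pot_AB Ua]
  obtain S where S: "compact S" "S \<subseteq> U" "\<And>x. x \<notin> S \<Longrightarrow> mgrad (AB_potential \<alpha> a) \<phi> x = 0" "\<And>x. x \<notin> S \<Longrightarrow> \<phi> x = 0"
    using mgrad_supportE[OF U(1) A \<phi>] by metis
  have oS: "open (- S)" using compact_imp_closed[OF S(1)] by auto
  have h0: "?h x = 0" if "x \<notin> S" for x using S(4)[OF that] by simp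
  have "continuous_on U ?h"
    using U by (intro continuous_intros continuous_on_subset[OF test_continuous[OF \<phi>]]) auto
  moreover have "continuous_on (- S) ?h"
    using continuous_on_cong[of "- S" "- S" ?h "\<lambda>x. 0"] h0 by simp
  ultimately have "continuous_on (U \<union> - S) ?h" by (rule continuous_on_open_Un[OF U(1) oS])
  moreover have "U \<union> - S = UNIV" using S by auto
  ultimately have hc: "continuous_on UNIV ?h" by simp
  show sq: "sqint ?M ?h" by (rule compact_support_sqint[OF hc S(1,2) h0 U(1)])
  have mc: "continuous_on UNIV (mgrad (AB_potential \<alpha> a) \<phi>)" by (rule mgrad_continuous[OF U(1) A \<phi>])
  have e: "(l2norm ?M f)\<^sup>2 = (LINT x|lborel. (norm (f x))\<^sup>2) \<and>
      (\<integral>\<^sup>+x. ennreal ((norm (f x))\<^sup>2) \<partial>lborel) = ennreal (LINT x|lborel. (norm (f x))\<^sup>2)"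
    if "continuous_on UNIV f" "\<And>x. x \<notin> S \<Longrightarrow> f x = 0" for f :: "real^2 \<Rightarrow> 'd::euclidean_space"
  proof
    have c: "continuous_on UNIV (\<lambda>x. (norm (f x))\<^sup>2)" by (intro continuous_intros that)
    show "(l2norm ?M f)\<^sup>2 = (LINT x|lborel. (norm (f x))\<^sup>2)"
      unfolding l2norm_sq by (rule compact_support_lebesgue_on(2)[OF c S(1,2) _ U(1)]) (use that in simp)
    show "(\<integral>\<^sup>+x. ennreal ((norm (f x))\<^sup>2) \<partial>lborel) = ennreal (LINT x|lborel. (norm (f x))\<^sup>2)"
      by (rule nn_integral_eq_integral[OF compact_support_integrable[OF c S(1)]]) (use that in auto)
  qed
  have "ennreal ((l2norm ?M ?h)\<^sup>2) \<le> ennreal ((hardy_const \<alpha>)\<^sup>2) * ennreal ((l2norm ?M (mgrad (AB_potential \<alpha> a) \<phi>))\<^sup>2)"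
    using AB_hardy_test[OF \<alpha> test_mono[OF Ua \<phi>]] e[OF hc h0] e[OF mc S(3)] by simp
  also have "\<dots> = ennreal ((hardy_const \<alpha> * l2norm ?M (mgrad (AB_potential \<alpha> a) \<phi>))\<^sup>2)"
    by (simp add: power_mult_distrib flip: ennreal_mult')
  finally have "(l2norm ?M ?h)\<^sup>2 \<le> (hardy_const \<alpha> * l2norm ?M (mgrad (AB_potential \<alpha> a) \<phi>))\<^sup>2"
    by (simp add: ennreal_le_iff)
  then show "l2norm ?M ?h \<le> hardy_const \<alpha> * l2norm ?M (mgrad (AB_potential \<alpha> a) \<phi>)"
    by (rule power2_le_imp_le) (use hardy_const_pos[OF \<alpha>] in simp)
qed

text \<open>The weight \<open>1 / |x - a|\<close> is unbounded, so the inequality is passed to the limit for bounded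
  multipliers \<open>\<psi>\<close> below \<open>\<epsilon> / |x - a|\<close>.\<close>

lemma AB_hardy:
  fixes \<psi> :: "real^2 \<Rightarrow> real"
  assumes \<alpha>: "0 < \<alpha>" "\<alpha> < 1" and U: "open U" "a \<notin> U" and u: "form_limit (AB_potential \<alpha> a) U u F"
    and \<psi>: "\<psi> \<in> borel_measurable (lebesgue_on U)" "\<And>x. \<bar>\<psi> x\<bar> \<le> B" "\<And>x. \<bar>\<psi> x\<bar> * norm (x - a) \<le> \<epsilon>"
  shows "l2norm (lebesgue_on U) (\<lambda>x. \<psi> x *\<^sub>R u x) \<le> \<epsilon> * hardy_const \<alpha> * l2norm (lebesgue_on U) F"
proof -
  let ?M = "lebesgue_on U" and ?A = "AB_potential \<alpha> a"
  have Ua: "U \<subseteq> - {a}" using U by auto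
  note A = smooth_pot_subset[OF smooth_pot_AB Ua]
  obtain \<phi> where \<phi>: "\<And>n. \<phi> n \<in> test_functions U" "(\<lambda>n. l2norm ?M (\<lambda>x. \<phi> n x - u x)) \<longlonglongrightarrow> 0"
      "(\<lambda>n. l2norm ?M (\<lambda>x. mgrad ?A (\<phi> n) x - F x)) \<longlonglongrightarrow> 0"
    and uF: "sqint ?M u" "sqint ?M F" using u unfolding form_limit_iff by blast
  have s\<phi>: "sqint ?M (\<phi> n)" "sqint ?M (mgrad ?A (\<phi> n))" for n
    using test_sqint[OF U(1) \<phi>(1)] mgrad_sqint[OF U(1) A \<phi>(1)] by auto
  have B: "0 \<le> B" using \<psi>(2)[of 0] by linarith
  have e: "0 \<le> \<epsilon>" using \<psi>(3)[of a] by simp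
  have sm: "sqint ?M (\<lambda>x. \<psi> x *\<^sub>R v x)" if "sqint ?M v" for v :: "real^2 \<Rightarrow> complex"
    by (rule sqint_dominated[OF that, where B=B]) (use \<psi> that in \<open>auto simp: sqint_def intro!: mult_right_mono\<close>)
  have lm: "l2norm ?M (\<lambda>x. \<psi> x *\<^sub>R v x) \<le> B * l2norm ?M v" if "sqint ?M v" for v :: "real^2 \<Rightarrow> complex"
    by (rule l2norm_dominated[OF that _ _ B]) (use \<psi> that in \<open>auto simp: sqint_def intro!: mult_right_mono\<close>)
  have n: "l2norm ?M (\<lambda>x. \<psi> x *\<^sub>R \<phi> n x) \<le> \<epsilon> * hardy_const \<alpha> * l2norm ?M (mgrad ?A (\<phi> n))" for n
  proof -
    have "l2norm ?M (\<lambda>x. \<psi> x *\<^sub>R \<phi> n x) \<le> \<epsilon> * l2norm ?M (\<lambda>x. norm (\<phi> n x) / norm (x - a))"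
    proof (rule l2norm_dominated[OF AB_hardy_l2_test(1)[OF \<alpha> U \<phi>(1)] _ _ e])
      show "(\<lambda>x. \<psi> x *\<^sub>R \<phi> n x) \<in> borel_measurable ?M" using sm[OF s\<phi>(1)] by (simp add: sqint_def)
      have "norm (\<psi> x *\<^sub>R \<phi> n x) \<le> \<epsilon> * norm (norm (\<phi> n x) / norm (x - a))" if "x \<in> U" for x
      proof -
        have p: "0 < norm (x - a)" using that U by auto
        have "(\<bar>\<psi> x\<bar> * norm (x - a)) * norm (\<phi> n x) \<le> \<epsilon> * norm (\<phi> n x)"
          by (intro mult_right_mono \<psi>) auto
        then show ?thesis using p by (simp add: field_simps)
      qed
      then show "AE x in ?M. norm (\<psi> x *\<^sub>R \<phi> n x) \<le> \<epsilon> * norm (norm (\<phi> n x) / norm (x - a))"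
        by (intro AE_I2) auto
    qed
    also have "\<dots> \<le> \<epsilon> * (hardy_const \<alpha> * l2norm ?M (mgrad ?A (\<phi> n)))"
      by (intro mult_left_mono AB_hardy_l2_test(2) \<alpha> U \<phi> e)
    finally show ?thesis by (simp add: mult.assoc)
  qed
  have "(\<lambda>n. l2norm ?M (\<lambda>x. \<psi> x *\<^sub>R \<phi> n x - \<psi> x *\<^sub>R u x)) \<longlonglongrightarrow> 0"
  proof (rule Lim_null_comparison[OF _ tendsto_mult_right_zero[OF \<phi>(2), of B]], rule always_eventually, rule allI)
    show "norm (l2norm ?M (\<lambda>x. \<psi> x *\<^sub>R \<phi> n x - \<psi> x *\<^sub>R u x)) \<le> B * l2norm ?M (\<lambda>x. \<phi> n x - u x)" for n
      using lm[OF sqint_diff[OF s\<phi>(1) uF(1)], of n] by (simp add: scaleR_diff_right)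
  qed
  then have "(\<lambda>n. l2norm ?M (\<lambda>x. \<psi> x *\<^sub>R \<phi> n x)) \<longlonglongrightarrow> l2norm ?M (\<lambda>x. \<psi> x *\<^sub>R u x)"
    by (rule l2norm_tendsto[OF sm[OF s\<phi>(1)] sm[OF uF(1)]])
  moreover have "(\<lambda>n. \<epsilon> * hardy_const \<alpha> * l2norm ?M (mgrad ?A (\<phi> n))) \<longlonglongrightarrow> \<epsilon> * hardy_const \<alpha> * l2norm ?M F"
    by (intro tendsto_mult tendsto_const l2norm_tendsto[OF s\<phi>(2) uF(2) \<phi>(3)])
  ultimately show ?thesis by (rule LIMSEQ_le) (use n in blast)
qed

section \<open>Multiplication operators between form domains\<close>

text \<open>If multiplication by \<open>m\<close> maps test functions to test functions and changes the magnetic gradient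
  by a term of order zero with bounded coefficient \<open>b\<close>, then it maps one form domain to the other.
  This covers the cutoffs that move the pole and the gauge factors that remove it.\<close>

lemma form_limit_multiplier:
  assumes \<Omega>: "open \<Omega>" and A: "smooth_pot (\<Omega> - {a}) A" and A': "smooth_pot (\<Omega> - {a'}) A'"
    and u: "form_limit A (\<Omega> - {a}) u F"
    and m: "m \<in> borel_measurable (lebesgue_on \<Omega>)" "\<And>x. x \<in> \<Omega> \<Longrightarrow> norm (m x) \<le> 1"
    and b: "b \<in> borel_measurable (lebesgue_on \<Omega>)" "\<And>x. x \<in> \<Omega> \<Longrightarrow> norm (b x) \<le> B"
    and test: "\<And>\<phi>. \<phi> \<in> test_functions (\<Omega> - {a}) \<Longrightarrow> (\<lambda>x. m x * \<phi> x) \<in> test_functions (\<Omega> - {a'})"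
    and grad: "\<And>\<phi> x. \<phi> \<in> test_functions (\<Omega> - {a}) \<Longrightarrow> x \<in> \<Omega> \<Longrightarrow>
        mgrad A' (\<lambda>x. m x * \<phi> x) x = m x *s mgrad A \<phi> x + \<phi> x *s b x"
  shows "form_limit A' (\<Omega> - {a'}) (\<lambda>x. m x * u x) (\<lambda>x. m x *s F x + u x *s b x)"
proof -
  let ?M = "lebesgue_on \<Omega>"
  have U: "open (\<Omega> - {a})" using \<Omega> by auto
  obtain \<phi> where \<phi>: "\<And>n. \<phi> n \<in> test_functions (\<Omega> - {a})" "(\<lambda>n. l2norm ?M (\<lambda>x. \<phi> n x - u x)) \<longlonglongrightarrow> 0"
      "(\<lambda>n. l2norm ?M (\<lambda>x. mgrad A (\<phi> n) x - F x)) \<longlonglongrightarrow> 0"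
    and uF: "sqint ?M u" "sqint ?M F"
    using u unfolding form_limit_iff sqint_remove_point[OF \<Omega>] l2norm_remove_point[OF \<Omega>] by blast
  have s\<phi>: "sqint ?M (\<phi> n)" "sqint ?M (mgrad A (\<phi> n))" for n
    using test_sqint[OF U \<phi>(1)] mgrad_sqint[OF U A \<phi>(1)] unfolding sqint_remove_point[OF \<Omega>] by auto
  note [measurable] = m(1) b(1)
  have B: "norm (b x) \<le> \<bar>B\<bar>" if "x \<in> \<Omega>" for x using b(2)[OF that] by linarith
  have s1: "sqint ?M (\<lambda>x. m x * v x)" "l2norm ?M (\<lambda>x. m x * v x) \<le> 1 * l2norm ?M v"
    if "sqint ?M v" for v
  proof -
    have 1: "AE x in ?M. norm (m x * v x) \<le> 1 * norm (v x)"
      using m(2) by (intro AE_I2) (auto simp: norm_mult intro!: mult_left_le_one_le)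
    have [measurable]: "v \<in> borel_measurable ?M" using that by (simp add: sqint_def)
    show "sqint ?M (\<lambda>x. m x * v x)"
      by (rule sqint_dominated[OF that _ 1]) simp
    show "l2norm ?M (\<lambda>x. m x * v x) \<le> 1 * l2norm ?M v"
      by (rule l2norm_dominated[OF that _ 1]) simp_all
  qed
  have s2: "sqint ?M (\<lambda>x. m x *s G x)" "l2norm ?M (\<lambda>x. m x *s G x) \<le> 1 * l2norm ?M G"
    if "sqint ?M G" for G :: "real^2 \<Rightarrow> complex^2"
  proof -
    have 1: "AE x in ?M. norm (m x *s G x) \<le> 1 * norm (G x)"
      using m(2) by (intro AE_I2) (auto simp: norm_vector_smult intro!: mult_left_le_one_le)
    have [measurable]: "G \<in> borel_measurable ?M" using that by (simp add: sqint_def)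
    show "sqint ?M (\<lambda>x. m x *s G x)"
      by (rule sqint_dominated[OF that _ 1]) simp
    show "l2norm ?M (\<lambda>x. m x *s G x) \<le> 1 * l2norm ?M G"
      by (rule l2norm_dominated[OF that _ 1]) simp_all
  qed
  have s3: "sqint ?M (\<lambda>x. v x *s b x)" "l2norm ?M (\<lambda>x. v x *s b x) \<le> \<bar>B\<bar> * l2norm ?M v"
    if "sqint ?M v" for v
  proof -
    have "norm (v x *s b x) \<le> \<bar>B\<bar> * norm (v x)" if "x \<in> \<Omega>" for x
      using mult_right_mono[OF B[OF that], of "norm (v x)"]
      by (simp add: norm_vector_smult mult.commute[of "norm (v x)"])
    then have 1: "AE x in ?M. norm (v x *s b x) \<le> \<bar>B\<bar> * norm (v x)" by (intro AE_I2) auto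
    have [measurable]: "v \<in> borel_measurable ?M" using that by (simp add: sqint_def)
    show "sqint ?M (\<lambda>x. v x *s b x)"
      by (rule sqint_dominated[OF that _ 1]) simp
    show "l2norm ?M (\<lambda>x. v x *s b x) \<le> \<bar>B\<bar> * l2norm ?M v"
      by (rule l2norm_dominated[OF that _ 1]) simp_all
  qed
  have le1: "l2norm ?M (\<lambda>x. m x * \<phi> n x - m x * u x) \<le> l2norm ?M (\<lambda>x. \<phi> n x - u x)" for n
    using s1(2)[OF sqint_diff[OF s\<phi>(1) uF(1)], of n] by (simp add: algebra_simps)
  have le2: "l2norm ?M (\<lambda>x. mgrad A' (\<lambda>x. m x * \<phi> n x) x - (m x *s F x + u x *s b x))
      \<le> l2norm ?M (\<lambda>x. mgrad A (\<phi> n) x - F x) + \<bar>B\<bar> * l2norm ?M (\<lambda>x. \<phi> n x - u x)" for n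
  proof -
    have "l2norm ?M (\<lambda>x. mgrad A' (\<lambda>x. m x * \<phi> n x) x - (m x *s F x + u x *s b x))
        = l2norm ?M (\<lambda>x. m x *s (mgrad A (\<phi> n) x - F x) + (\<phi> n x - u x) *s b x)"
      unfolding l2norm_def
      by (intro arg_cong[where f=sqrt] Bochner_Integration.integral_cong refl)
         (simp add: grad[OF \<phi>(1)] vector_ssub_ldistrib vector_sub_rdistrib algebra_simps)
    also have "\<dots> \<le> l2norm ?M (\<lambda>x. m x *s (mgrad A (\<phi> n) x - F x)) + l2norm ?M (\<lambda>x. (\<phi> n x - u x) *s b x)"
      by (intro l2norm_triangle s2 s3 sqint_diff s\<phi> uF)
    finally show ?thesis
      using s2(2)[OF sqint_diff[OF s\<phi>(2) uF(2)], of n] s3(2)[OF sqint_diff[OF s\<phi>(1) uF(1)], of n] by simp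
  qed
  show ?thesis
    unfolding form_limit_iff sqint_remove_point[OF \<Omega>] l2norm_remove_point[OF \<Omega>]
  proof (intro conjI exI[of _ "\<lambda>n x. m x * \<phi> n x"] allI test \<phi>)
    show "(\<lambda>n. l2norm ?M (\<lambda>x. m x * \<phi> n x - m x * u x)) \<longlonglongrightarrow> 0"
      by (rule Lim_null_comparison[OF _ \<phi>(2)]) (use le1 in simp)
    show "(\<lambda>n. l2norm ?M (\<lambda>x. mgrad A' (\<lambda>x. m x * \<phi> n x) x - (m x *s F x + u x *s b x))) \<longlonglongrightarrow> 0"
      by (rule Lim_null_comparison[OF _ tendsto_add_zero[OF \<phi>(3) tendsto_mult_right_zero[OF \<phi>(2), of "\<bar>B\<bar>"]]])
         (use le2 in simp)
  qed (intro sqint_add s1 s2 s3 uF)+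
qed

section \<open>Moving the pole\<close>

text \<open>Up to a rotation by a right angle the potential is the inversion \<open>v / |v|\<^sup>2\<close>, and the inversion
  satisfies \<open>|v / |v|\<^sup>2 - w / |w|\<^sup>2| = |v - w| / (|v| |w|)\<close>.\<close>

lemma AB_potential_diff:
  assumes "x \<noteq> a" "x \<noteq> a'" "0 \<le> \<alpha>"
  shows "norm (AB_potential \<alpha> a' x - AB_potential \<alpha> a x) = \<alpha> * norm (a' - a) / (norm (x - a') * norm (x - a))"
proof -
  define v w where "v = x - a" and "w = x - a'"
  have n: "0 < norm v" "0 < norm w" using assms by (auto simp: v_def w_def)
  define c d where "c = 1 / (norm w)\<^sup>2" and "d = 1 / (norm v)\<^sup>2"
  have c: "c * (norm w)\<^sup>2 = 1" and d: "d * (norm v)\<^sup>2 = 1" using n by (auto simp: c_def d_def)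
  have "(norm (c *\<^sub>R w - d *\<^sub>R v))\<^sup>2 = c * (c * (norm w)\<^sup>2) - 2 * c * d * (w \<bullet> v) + d * (d * (norm v)\<^sup>2)"
    unfolding power2_norm_eq_inner
    by (simp add: inner_diff_left inner_diff_right inner_commute[of v w] algebra_simps)
  also have "\<dots> = c - 2 * c * d * (w \<bullet> v) + d" by (simp add: c d)
  also have "\<dots> = (norm (w - v))\<^sup>2 * (c * d)"
  proof -
    have nd: "(norm (w - v))\<^sup>2 = (norm w)\<^sup>2 - 2 * (w \<bullet> v) + (norm v)\<^sup>2"
      unfolding power2_norm_eq_inner by (simp add: inner_diff_left inner_diff_right inner_commute[of v w])
    have "(norm (w - v))\<^sup>2 * (c * d) = (c * (norm w)\<^sup>2) * d - 2 * c * d * (w \<bullet> v) + (d * (norm v)\<^sup>2) * c"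
      unfolding nd by (simp add: algebra_simps)
    then show ?thesis by (simp add: c d)
  qed
  also have "\<dots> = (norm (w - v) / (norm w * norm v))\<^sup>2"
    by (simp add: c_def d_def power_divide power_mult_distrib)
  finally have "(norm ((1 / (norm w)\<^sup>2) *\<^sub>R w - (1 / (norm v)\<^sup>2) *\<^sub>R v))\<^sup>2 = (norm (w - v) / (norm w * norm v))\<^sup>2"
    unfolding c_def d_def .
  then have e: "norm ((1 / (norm w)\<^sup>2) *\<^sub>R w - (1 / (norm v)\<^sup>2) *\<^sub>R v) = norm (w - v) / (norm w * norm v)"
    by (rule power2_eq_imp_eq) auto
  have "AB_potential \<alpha> a' x - AB_potential \<alpha> a x = \<alpha> *\<^sub>R perp ((1 / (norm w)\<^sup>2) *\<^sub>R w - (1 / (norm v)\<^sup>2) *\<^sub>R v)"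
    unfolding AB_potential_perp v_def w_def perp_props(7)[of "_ *\<^sub>R _"] perp_props(5) by (simp add: scaleR_diff_right)
  then have "norm (AB_potential \<alpha> a' x - AB_potential \<alpha> a x) = \<alpha> * (norm (w - v) / (norm w * norm v))"
    using assms(3) by (simp add: perp_props(4) e)
  moreover have "norm (w - v) = norm (a' - a)" by (simp add: v_def w_def norm_minus_commute)
  ultimately show ?thesis by (simp add: v_def w_def)
qed

lemma measurable_AB [measurable]: "AB_potential \<alpha> a \<in> borel_measurable borel"
proof -
  have [measurable]: "(\<lambda>x. perp (x - a)) \<in> borel_measurable borel"
    by (intro borel_measurable_continuous_onI bounded_linear.continuous_on[OF bounded_linear_perp] continuous_intros)
  show ?thesis unfolding AB_potential_perp[abs_def] by measurable
qed

definition cvec :: "real^2 \<Rightarrow> complex^2" where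
  "cvec v = (\<chi> i. complex_of_real (v $ i))"

lemma measurable_cvec [measurable]: "cvec \<in> borel_measurable borel"
  unfolding cvec_def by (intro borel_measurable_continuous_onI continuous_on_vec_lambda continuous_intros)

lemma norm_cvec: "norm (cvec v) = norm v"
  by (simp add: norm_vec_def cvec_def)

lemma borel_imp_lebesgue_on: "f \<in> borel_measurable borel \<Longrightarrow> f \<in> borel_measurable (lebesgue_on S)"
  by (intro measurable_restrict_space1 measurable_completion) simp

text \<open>Multiplication by the cutoff around \<open>a\<close> turns functions for the pole \<open>a\<close> into functions for a nearby
  pole \<open>a'\<close>. The new terms in the gradient come from the derivative of the cutoff and from the change
  of the potential; both are at most a multiple of \<open>\<epsilon> / |x - a|\<close> where the cutoff does not vanish, and
  the removed mass sits in a disc of radius \<open>R\<close>, so the Hardy inequality bounds everything by the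
  energy. The admissible distance \<open>\<eta>\<close> depends on \<open>\<epsilon>\<close> and \<open>R\<close> only, not on the position of the poles.\<close>

lemma pole_move:
  assumes \<alpha>: "0 < \<alpha>" "\<alpha> < 1" and eps: "0 < \<epsilon>" and R: "0 < R"
  obtains \<eta> where "0 < \<eta>" "\<And>a a' \<Omega>. open \<Omega> \<Longrightarrow> norm (a' - a) < \<eta> \<Longrightarrow>
     \<exists>\<zeta>. \<forall>u F. form_limit (AB_potential \<alpha> a) (\<Omega> - {a}) u F \<longrightarrow>
        (\<exists>F'. form_limit (AB_potential \<alpha> a') (\<Omega> - {a'}) (\<lambda>x. \<zeta> x * u x) F' \<and>
           l2norm (lebesgue_on \<Omega>) F' \<le> (1 + 3 * \<epsilon> * hardy_const \<alpha>) * l2norm (lebesgue_on \<Omega>) F \<and>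
           l2norm (lebesgue_on \<Omega>) u - R * hardy_const \<alpha> * l2norm (lebesgue_on \<Omega>) F
             \<le> l2norm (lebesgue_on \<Omega>) (\<lambda>x. \<zeta> x * u x))"
proof -
  obtain \<delta> where \<delta>: "0 < \<delta>" and cut: "\<And>a. \<exists>\<zeta>. rsmooth_on UNIV \<zeta> \<and> (\<forall>x. 0 \<le> \<zeta> x \<and> \<zeta> x \<le> 1) \<and>
        (\<forall>x. norm (x - a) \<le> \<delta> \<longrightarrow> \<zeta> x = 0) \<and> (\<forall>x. R \<le> norm (x - a) \<longrightarrow> \<zeta> x = 1) \<and>
        (\<forall>x i. norm (x - a) * norm (pd i (\<lambda>x. complex_of_real (\<zeta> x)) x) \<le> \<epsilon>)"
    using logarithmic_cutoff[OF eps R] by metis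
  \<comment> \<open>\<open>a'\<close> must lie well inside the hole of the cutoff, and \<open>|a' - a| / |x - a'| \<le> \<epsilon>\<close> outside the hole\<close>
  define \<eta> where "\<eta> = min (\<delta> / 2) (\<epsilon> * \<delta> / 2)"
  have \<eta>: "0 < \<eta>" "\<eta> \<le> \<delta> / 2" "\<eta> \<le> \<epsilon> * \<delta> / 2" using \<delta> eps by (auto simp: \<eta>_def)
  show thesis
  proof (rule that[OF \<eta>(1)])
    fix a a' :: "real^2" and \<Omega> :: "(real^2) set"
    assume \<Omega>: "open \<Omega>" and aa: "norm (a' - a) < \<eta>"
    let ?A = "AB_potential \<alpha> a" and ?A' = "AB_potential \<alpha> a'" and ?M = "lebesgue_on \<Omega>"
    obtain \<zeta> where sm: "rsmooth_on UNIV \<zeta>" and rng: "\<And>x. 0 \<le> \<zeta> x" "\<And>x. \<zeta> x \<le> 1"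
      and z0: "\<And>x. norm (x - a) \<le> \<delta> \<Longrightarrow> \<zeta> x = 0" and z1: "\<And>x. R \<le> norm (x - a) \<Longrightarrow> \<zeta> x = 1"
      and zg: "\<And>x i. norm (x - a) * norm (pd i (\<lambda>x. complex_of_real (\<zeta> x)) x) \<le> \<epsilon>"
      using cut[of a] by blast
    define Z where "Z x = complex_of_real (\<zeta> x)" for x
    have sZ: "smooth_on UNIV Z" using sm unfolding rsmooth_on_def Z_def .
    define gZ where "gZ x = (\<chi> i. pd i Z x)" for x
    define b where "b x = \<i> *s gZ x + Z x *s cvec (?A' x - ?A x)" for x
    have Zc: "continuous_on UNIV Z" by (rule smooth_on_continuous[OF sZ])
    have gZc: "continuous_on UNIV gZ"
      unfolding gZ_def by (intro continuous_on_vec_lambda smooth_on_continuous[OF smooth_on_pd[OF sZ]])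
    note [measurable] = borel_measurable_continuous_onI[OF Zc] borel_measurable_continuous_onI[OF gZc]
    have bm: "b \<in> borel_measurable borel" unfolding b_def by measurable
    have g_le: "norm (gZ x) * norm (x - a) \<le> 2 * \<epsilon>" for x
    proof -
      have "norm (gZ x) \<le> (\<Sum>i\<in>UNIV. norm (pd i Z x))"
        unfolding norm_vec_def gZ_def by (rule order_trans[OF L2_set_le_sum]) auto
      from mult_right_mono[OF this norm_ge_zero[of "x - a"]]
      have "norm (gZ x) * norm (x - a) \<le> (\<Sum>i\<in>UNIV. norm (pd i Z x) * norm (x - a))"
        by (simp only: sum_distrib_right)
      also have "\<dots> \<le> (\<Sum>i\<in>(UNIV::2 set). \<epsilon>)"
        using zg[of x] by (intro sum_mono) (simp add: Z_def[abs_def] mult.commute)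
      finally show ?thesis by simp
    qed
    have A_le: "\<zeta> x * norm (?A' x - ?A x) * norm (x - a) \<le> \<epsilon>" for x
    proof (cases "norm (x - a) \<le> \<delta>")
      case True
      then show ?thesis using z0 eps by simp
    next
      case False
      have xa': "\<delta> / 2 < norm (x - a')"
        using norm_triangle_ineq[of "x - a'" "a' - a"] False aa \<eta>(2) by simp
      then have ne: "x \<noteq> a" "x \<noteq> a'" using False \<delta> by auto
      have "norm (?A' x - ?A x) * norm (x - a) = \<alpha> * norm (a' - a) / norm (x - a')"
        using AB_potential_diff[OF ne, of \<alpha>] \<alpha> ne by simp
      also have "\<dots> \<le> \<alpha> * norm (a' - a) / (\<delta> / 2)"
        using xa' \<delta> \<alpha> by (intro divide_left_mono mult_pos_pos) auto
      also have "\<dots> \<le> 1 * (\<epsilon> * \<delta> / 2) / (\<delta> / 2)"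
        using aa \<eta> \<delta> \<alpha> by (intro divide_right_mono mult_mono) auto
      also have "\<dots> = \<epsilon>" using \<delta> by simp
      finally have "norm (?A' x - ?A x) * norm (x - a) \<le> \<epsilon>" .
      then have "\<zeta> x * (norm (?A' x - ?A x) * norm (x - a)) \<le> 1 * \<epsilon>"
        by (intro mult_mono rng) (use eps in auto)
      then show ?thesis by (simp add: mult.assoc)
    qed
    have b_le: "norm (b x) * norm (x - a) \<le> 3 * \<epsilon>" for x
    proof -
      have "norm (b x) \<le> norm (gZ x) + \<zeta> x * norm (?A' x - ?A x)"
        unfolding b_def by (rule order_trans[OF norm_triangle_ineq])
          (simp add: norm_vector_smult norm_cvec Z_def rng)
      then have "norm (b x) * norm (x - a) \<le> (norm (gZ x) + \<zeta> x * norm (?A' x - ?A x)) * norm (x - a)"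
        by (rule mult_right_mono) simp
      then show ?thesis using g_le[of x] A_le[of x] by (simp add: distrib_right)
    qed
    have b_bd: "norm (b x) \<le> 3 * \<epsilon> / \<delta>" for x
    proof (cases "norm (x - a) < \<delta>")
      case True
      then have xb: "x \<in> ball a \<delta>" by (simp add: dist_norm norm_minus_commute)
      have "pd i Z x = 0" for i
      proof -
        have "pd i Z x = pd i (\<lambda>x. 0) x"
          by (rule pd_cong_open[OF open_ball xb]) (auto simp: Z_def z0 dist_norm norm_minus_commute)
        also have "\<dots> = 0" by (rule pd_eq) (rule has_derivative_const)
        finally show ?thesis .
      qed
      then have "b x = 0" using z0[of x] True by (simp add: b_def gZ_def Z_def vec_eq_iff)
      then show ?thesis using eps \<delta> by simp
    next
      case False
      have "norm (b x) * \<delta> \<le> norm (b x) * norm (x - a)" using False by (intro mult_left_mono) auto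
      also note b_le[of x]
      finally show ?thesis using \<delta> by (simp add: pos_le_divide_eq)
    qed
    have test: "(\<lambda>x. Z x * \<phi> x) \<in> test_functions (\<Omega> - {a'})" if \<phi>: "\<phi> \<in> test_functions (\<Omega> - {a})" for \<phi>
    proof -
      obtain S where S: "compact S" "S \<subseteq> \<Omega> - {a}" "\<And>x. x \<notin> S \<Longrightarrow> \<phi> x = 0" using test_supportE[OF \<phi>] by blast
      let ?S = "S \<inter> {x. \<delta> \<le> norm (x - a)}"
      have "closed {x. \<delta> \<le> norm (x - a)}" by (intro closed_Collect_le continuous_intros)
      then have c: "compact ?S" using S(1) by (intro compact_Int_closed)
      have "a' \<notin> ?S" using aa \<eta> \<delta> by auto
      then have s: "?S \<subseteq> \<Omega> - {a'}" using S(2) by auto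
      show ?thesis
        by (rule test_functionsI[OF smooth_on_mult[OF open_UNIV sZ test_smooth[OF \<phi>]] c s])
           (use S(3) z0 in \<open>auto simp: Z_def\<close>)
    qed
    have grad: "mgrad ?A' (\<lambda>x. Z x * \<phi> x) x = Z x *s mgrad ?A \<phi> x + \<phi> x *s b x"
      if \<phi>: "\<phi> \<in> test_functions (\<Omega> - {a})" for \<phi> x
    proof -
      have "((\<lambda>x. Z x * \<phi> x) has_derivative
          (\<lambda>h. Z x * frechet_derivative \<phi> (at x) h + frechet_derivative Z (at x) h * \<phi> x)) (at x)"
        by (intro has_derivative_mult test_has_derivative[OF \<phi>] smooth_on_has_derivative[OF sZ]) auto
      then have "pd i (\<lambda>x. Z x * \<phi> x) x = Z x * pd i \<phi> x + pd i Z x * \<phi> x" for i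
        by (simp add: pd_eq) (simp add: pd_def)
      then show ?thesis
        by (simp add: vec_eq_iff mgrad_nth mpart_def b_def gZ_def cvec_def algebra_simps)
    qed
    have Ua: "open (\<Omega> - {a})" "a \<notin> \<Omega> - {a}" using \<Omega> by auto
    have sA: "smooth_pot (\<Omega> - {a}) ?A" "smooth_pot (\<Omega> - {a'}) ?A'"
      by (rule smooth_pot_subset[OF smooth_pot_AB], auto)+
    have "\<exists>F'. form_limit ?A' (\<Omega> - {a'}) (\<lambda>x. Z x * u x) F' \<and>
           l2norm ?M F' \<le> (1 + 3 * \<epsilon> * hardy_const \<alpha>) * l2norm ?M F \<and>
           l2norm ?M u - R * hardy_const \<alpha> * l2norm ?M F \<le> l2norm ?M (\<lambda>x. Z x * u x)"
      if uF: "form_limit ?A (\<Omega> - {a}) u F" for u F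
    proof (intro exI conjI)
      have sq: "sqint ?M u" "sqint ?M F"
        using form_limit_sqint[OF uF] unfolding sqint_remove_point[OF \<Omega>] .
      have [measurable]: "u \<in> borel_measurable ?M" "F \<in> borel_measurable ?M" using sq by (auto simp: sqint_def)
      have [measurable]: "Z \<in> borel_measurable ?M" "b \<in> borel_measurable ?M"
        by (auto intro!: borel_imp_lebesgue_on bm)
      have nZ: "norm (Z x) \<le> 1" for x using rng[of x] by (simp add: Z_def)
      show fl: "form_limit ?A' (\<Omega> - {a'}) (\<lambda>x. Z x * u x) (\<lambda>x. Z x *s F x + u x *s b x)"
        by (rule form_limit_multiplier[OF \<Omega> sA uF _ nZ _ b_bd test grad]) auto
      have sZF: "sqint ?M (\<lambda>x. Z x *s F x)"
        by (rule sqint_dominated[OF sq(2), where B=1]) (auto simp: norm_vector_smult intro!: mult_left_le_one_le nZ)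
      have lZF: "l2norm ?M (\<lambda>x. Z x *s F x) \<le> 1 * l2norm ?M F"
        by (rule l2norm_dominated[OF sq(2)]) (auto simp: norm_vector_smult intro!: mult_left_le_one_le nZ)
      have "norm (u x *s b x) \<le> 3 * \<epsilon> / \<delta> * norm (u x)" for x
        using mult_right_mono[OF b_bd[of x], of "norm (u x)"]
        by (simp add: norm_vector_smult mult.commute[of "norm (u x)"])
      then have sub: "sqint ?M (\<lambda>x. u x *s b x)"
        by (intro sqint_dominated[OF sq(1), where B="3 * \<epsilon> / \<delta>"] AE_I2) simp_all
      have "l2norm ?M (\<lambda>x. u x *s b x) = l2norm ?M (\<lambda>x. norm (b x) *\<^sub>R u x)"
        by (rule l2norm_cong_AE) (auto simp: norm_vector_smult mult.commute)
      also have "\<dots> \<le> 3 * \<epsilon> * hardy_const \<alpha> * l2norm ?M F"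
        using AB_hardy[OF \<alpha> Ua uF, of "\<lambda>x. norm (b x)" "3 * \<epsilon> / \<delta>" "3 * \<epsilon>"] b_bd b_le
        unfolding l2norm_remove_point[OF \<Omega>] measurable_remove_point[OF \<Omega>] by simp
      finally have lub: "l2norm ?M (\<lambda>x. u x *s b x) \<le> 3 * \<epsilon> * hardy_const \<alpha> * l2norm ?M F" .
      show "l2norm ?M (\<lambda>x. Z x *s F x + u x *s b x) \<le> (1 + 3 * \<epsilon> * hardy_const \<alpha>) * l2norm ?M F"
        using l2norm_triangle[OF sZF sub] lZF lub by (simp add: distrib_right)
      have "l2norm ?M (\<lambda>x. (1 - \<zeta> x) *\<^sub>R u x) \<le> R * hardy_const \<alpha> * l2norm ?M F"
      proof -
        have "(\<lambda>x. Re (Z x)) \<in> borel_measurable ?M" by measurable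
        then have [measurable]: "\<zeta> \<in> borel_measurable ?M" by (simp add: Z_def)
        have "\<bar>1 - \<zeta> x\<bar> * norm (x - a) \<le> R" for x
        proof (cases "R \<le> norm (x - a)")
          case False
          then have "\<bar>1 - \<zeta> x\<bar> * norm (x - a) \<le> 1 * R" by (intro mult_mono) (use rng[of x] in auto)
          then show ?thesis by simp
        qed (use z1 R in simp)
        moreover have "\<bar>1 - \<zeta> x\<bar> \<le> 1" for x using rng[of x] by simp
        ultimately show ?thesis
          using AB_hardy[OF \<alpha> Ua uF, of "\<lambda>x. 1 - \<zeta> x" 1 R]
          unfolding l2norm_remove_point[OF \<Omega>] measurable_remove_point[OF \<Omega>] by simp
      qed
      moreover have "l2norm ?M u \<le> l2norm ?M (\<lambda>x. Z x * u x) + l2norm ?M (\<lambda>x. (1 - \<zeta> x) *\<^sub>R u x)"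
      proof -
        have 1: "sqint ?M (\<lambda>x. Z x * u x)"
          using form_limit_sqint(1)[OF fl] unfolding sqint_remove_point[OF \<Omega>] .
        have e: "u x - Z x * u x = (1 - \<zeta> x) *\<^sub>R u x" for x
          by (simp add: Z_def scaleR_conv_of_real algebra_simps)
        have 2: "sqint ?M (\<lambda>x. (1 - \<zeta> x) *\<^sub>R u x)" using sqint_diff[OF sq(1) 1] by (simp add: e)
        have "Z x * u x + (1 - \<zeta> x) *\<^sub>R u x = u x" for x by (simp flip: e)
        then show ?thesis using l2norm_triangle[OF 1 2] by simp
      qed
      ultimately show "l2norm ?M u - R * hardy_const \<alpha> * l2norm ?M F \<le> l2norm ?M (\<lambda>x. Z x * u x)" by linarith
    qed
    then show "\<exists>\<zeta>. \<forall>u F. form_limit ?A (\<Omega> - {a}) u F \<longrightarrow>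
        (\<exists>F'. form_limit ?A' (\<Omega> - {a'}) (\<lambda>x. \<zeta> x * u x) F' \<and>
           l2norm ?M F' \<le> (1 + 3 * \<epsilon> * hardy_const \<alpha>) * l2norm ?M F \<and>
           l2norm ?M u - R * hardy_const \<alpha> * l2norm ?M F \<le> l2norm ?M (\<lambda>x. \<zeta> x * u x))"
      by blast
  qed
qed

section \<open>Hermitian forms and the min-max formula\<close>

text \<open>Gaussian elimination of one unknown \<open>p\<close> that occurs in the last equation.\<close>

lemma underdetermined_system:
  fixes A :: "nat \<Rightarrow> 'k \<Rightarrow> complex"
  assumes "finite S" "m < card S"
  shows "\<exists>c. (\<exists>k\<in>S. c k \<noteq> 0) \<and> (\<forall>i<m. (\<Sum>k\<in>S. A i k * c k) = 0)"
  using assms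
proof (induction m arbitrary: S A)
  case 0
  then have "S \<noteq> {}" by auto
  then show ?case by (intro exI[of _ "\<lambda>k. 1"]) auto
next
  case (Suc m)
  show ?case
  proof (cases "\<forall>k\<in>S. A m k = 0")
    case True
    obtain c where "\<exists>k\<in>S. c k \<noteq> 0" "\<forall>i<m. (\<Sum>k\<in>S. A i k * c k) = 0"
      using Suc.IH[of S A] Suc.prems by auto
    moreover have "(\<Sum>k\<in>S. A m k * c k) = 0" using True by (intro sum.neutral) auto
    ultimately show ?thesis by (intro exI[of _ c]) (auto simp: less_Suc_eq)
  next
    case False
    then obtain p where p: "p \<in> S" "A m p \<noteq> 0" by blast
    let ?S = "S - {p}"
    let ?B = "\<lambda>i k. A i k - A i p * (A m k / A m p)"
    obtain c where c: "\<exists>k\<in>?S. c k \<noteq> 0" "\<forall>i<m. (\<Sum>k\<in>?S. ?B i k * c k) = 0"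
    proof -
      have "m < card ?S" using Suc.prems p by simp
      from Suc.IH[OF _ this, of ?B] Suc.prems(1) that show ?thesis by blast
    qed
    define z where "z = - (\<Sum>k\<in>?S. A m k * c k) / A m p"
    define d where "d = c(p := z)"
    have e: "(\<Sum>k\<in>S. A i k * d k) = A i p * z + (\<Sum>k\<in>?S. A i k * c k)" for i
      unfolding d_def sum.remove[OF Suc.prems(1) p(1)] by (auto intro: sum.cong)
    have "(\<Sum>k\<in>S. A i k * d k) = 0" if i: "i < Suc m" for i
    proof (cases "i = m")
      case True
      then show ?thesis unfolding e using p by (simp add: z_def)
    next
      case False
      have "(\<Sum>k\<in>?S. ?B i k * c k) = (\<Sum>k\<in>?S. A i k * c k) - (\<Sum>k\<in>?S. A i p / A m p * (A m k * c k))"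
        unfolding sum_subtractf[symmetric] by (intro sum.cong) (simp_all add: algebra_simps)
      also have "\<dots> = (\<Sum>k\<in>?S. A i k * c k) + A i p * z"
        unfolding sum_distrib_left[symmetric] z_def by simp
      finally show ?thesis using c(2) i False unfolding e by (simp add: add.commute)
    qed
    moreover have "\<exists>k\<in>S. d k \<noteq> 0" using c(1) by (auto simp: d_def)
    ultimately show ?thesis by blast
  qed
qed

definition lincomb :: "nat \<Rightarrow> (nat \<Rightarrow> complex) \<Rightarrow> (nat \<Rightarrow> 'x \<Rightarrow> complex) \<Rightarrow> 'x \<Rightarrow> complex" where
  "lincomb n c w = (\<lambda>x. \<Sum>k<n. c k * w k x)"

definition fminus :: "('x \<Rightarrow> complex) \<Rightarrow> ('x \<Rightarrow> complex) \<Rightarrow> 'x \<Rightarrow> complex" where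
  "fminus u v = (\<lambda>x. u x + (-1) * v x)"

text \<open>The spaces below are sets of functions, and functions that agree almost everywhere are not
  identified, so the forms are only semidefinite.\<close>

locale herm_form =
  fixes D :: "('x \<Rightarrow> complex) set" and h :: "('x \<Rightarrow> complex) \<Rightarrow> ('x \<Rightarrow> complex) \<Rightarrow> complex"
  assumes zero: "(\<lambda>x. 0) \<in> D"
    and lin: "u \<in> D \<Longrightarrow> v \<in> D \<Longrightarrow> (\<lambda>x. u x + c * v x) \<in> D"
    and left: "u \<in> D \<Longrightarrow> v \<in> D \<Longrightarrow> w \<in> D \<Longrightarrow> h (\<lambda>x. u x + c * v x) w = h u w + c * h v w"
    and sym: "u \<in> D \<Longrightarrow> v \<in> D \<Longrightarrow> h v u = cnj (h u v)"
    and pos: "u \<in> D \<Longrightarrow> 0 \<le> Re (h u u)"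
begin

definition q :: "('x \<Rightarrow> complex) \<Rightarrow> real" where "q u = Re (h u u)"

lemma q_nonneg: "u \<in> D \<Longrightarrow> 0 \<le> q u"
  by (simp add: q_def pos)

lemma h_self: "u \<in> D \<Longrightarrow> h u u = complex_of_real (q u)"
  using sym[of u u] unfolding q_def by (metis Reals_cnj_iff of_real_Re)

lemma right: "u \<in> D \<Longrightarrow> v \<in> D \<Longrightarrow> w \<in> D \<Longrightarrow> h w (\<lambda>x. u x + c * v x) = h w u + cnj c * h w v"
  using sym[OF lin[of u v c], of w] sym[of u w] sym[of v w] left[of u v w c] lin[of u v c] by simp

lemma zero_left: "u \<in> D \<Longrightarrow> h (\<lambda>x. 0) u = 0"
  using left[of "\<lambda>x. 0" "\<lambda>x. 0" u "-1"] zero by simp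

lemma q_zero: "q (\<lambda>x. 0) = 0"
  by (simp add: q_def zero_left zero)

lemma q_add:
  assumes "u \<in> D" "v \<in> D"
  shows "q (\<lambda>x. u x + c * v x) = q u + 2 * Re (cnj c * h u v) + (norm c)\<^sup>2 * q v"
proof -
  have "h (\<lambda>x. u x + c * v x) (\<lambda>x. u x + c * v x) = (h u u + cnj c * h u v) + c * (h v u + cnj c * h v v)"
    using assms by (simp add: left right lin)
  also have "\<dots> = h u u + (cnj c * h u v + cnj (cnj c * h u v)) + complex_of_real ((norm c)\<^sup>2) * h v v"
    unfolding complex_norm_square using assms by (simp add: sym[of u v] algebra_simps)
  finally show ?thesis
    by (simp add: q_def complex_add_cnj)
qed

lemma q_scale: "v \<in> D \<Longrightarrow> q (\<lambda>x. c * v x) = (norm c)\<^sup>2 * q v"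
  using q_add[OF zero, of v c] by (simp add: zero_left q_zero)

lemma scale: "v \<in> D \<Longrightarrow> (\<lambda>x. c * v x) \<in> D"
  using lin[OF zero, of v c] by simp

lemma scale_left: "v \<in> D \<Longrightarrow> w \<in> D \<Longrightarrow> h (\<lambda>x. c * v x) w = c * h v w"
  using left[OF zero, of v w c] by (simp add: zero_left)

lemma fminus_in: "u \<in> D \<Longrightarrow> v \<in> D \<Longrightarrow> fminus u v \<in> D"
  unfolding fminus_def by (rule lin)

lemma Cauchy_Schwarz:
  assumes "u \<in> D" "v \<in> D"
  shows "(norm (h u v))\<^sup>2 \<le> q u * q v"
proof (cases "h u v = 0")
  case True
  then show ?thesis using q_nonneg assms by simp
next
  case False
  define s where "s = h u v / complex_of_real (norm (h u v))"
  have "cnj s * h u v = (h u v * cnj (h u v)) / complex_of_real (norm (h u v))"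
    by (simp add: s_def)
  also have "\<dots> = complex_of_real (norm (h u v))"
    unfolding complex_norm_square[symmetric] using False by (simp add: power2_eq_square)
  finally have s: "norm s = 1" "cnj s * h u v = complex_of_real (norm (h u v))"
    using False by (auto simp: s_def norm_divide)
  have "0 \<le> q u + 2 * t * norm (h u v) + t\<^sup>2 * q v" for t
  proof -
    have "cnj (of_real t * s) * h u v = complex_of_real (t * norm (h u v))"
      using s(2) by (simp add: mult.assoc)
    then have "q (\<lambda>x. u x + of_real t * s * v x) = q u + 2 * (t * norm (h u v)) + (norm (of_real t * s))\<^sup>2 * q v"
      by (simp only: q_add[OF assms] Re_complex_of_real)
    then show ?thesis
      using q_nonneg[OF lin[OF assms, of "of_real t * s"]] by (simp add: norm_mult s(1))
  qed
  from quadratic_nonneg_imp[OF this] show ?thesis using q_nonneg assms by simp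
qed

lemma fminus_q:
  assumes "u \<in> D" "v \<in> D"
  shows "q (fminus u v) = q u - 2 * Re (h u v) + q v"
  using q_add[OF assms, of "-1"] by (simp add: fminus_def)

lemma parallelogram:
  assumes "u \<in> D" "v \<in> D"
  shows "q (fminus u v) + q (\<lambda>x. u x + 1 * v x) = 2 * q u + 2 * q v"
  using fminus_q[OF assms] q_add[OF assms, of 1] by simp

lemma q_diff_le:
  assumes "u \<in> D" "v \<in> D"
  shows "\<bar>sqrt (q u) - sqrt (q v)\<bar> \<le> sqrt (q (fminus u v))"
proof -
  have "Re (h u v) \<le> sqrt (q u) * sqrt (q v)"
  proof -
    have "norm (h u v) \<le> sqrt (q u * q v)"
      using Cauchy_Schwarz[OF assms] by (intro real_le_rsqrt)
    then show ?thesis using complex_Re_le_cmod[of "h u v"] by (simp add: real_sqrt_mult)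
  qed
  then have "(\<bar>sqrt (q u) - sqrt (q v)\<bar>)\<^sup>2 \<le> q (fminus u v)"
    using fminus_q[OF assms] q_nonneg assms by (simp add: power2_diff)
  then show ?thesis by (rule real_le_rsqrt)
qed

lemma q_tendsto:
  assumes "\<And>n. v n \<in> D" "u \<in> D" "(\<lambda>n. q (fminus (v n) u)) \<longlonglongrightarrow> 0"
  shows "(\<lambda>n. q (v n)) \<longlonglongrightarrow> q u"
proof -
  have "(\<lambda>n. sqrt (q (v n)) - sqrt (q u)) \<longlonglongrightarrow> 0"
  proof (rule Lim_null_comparison)
    show "(\<lambda>n. sqrt (q (fminus (v n) u))) \<longlonglongrightarrow> 0" using tendsto_real_sqrt[OF assms(3)] by simp
    show "\<forall>\<^sub>F n in sequentially. norm (sqrt (q (v n)) - sqrt (q u)) \<le> sqrt (q (fminus (v n) u))"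
      unfolding real_norm_def by (intro always_eventually allI q_diff_le assms(1,2))
  qed
  then have "(\<lambda>n. sqrt (q (v n))) \<longlonglongrightarrow> sqrt (q u)" by (simp add: LIM_zero_iff)
  from tendsto_power[OF this, of 2] show ?thesis
    by (simp only: real_sqrt_pow2[OF q_nonneg[OF assms(1)]] real_sqrt_pow2[OF q_nonneg[OF assms(2)]])
qed

lemma lincomb_in: "(\<And>k. k < n \<Longrightarrow> w k \<in> D) \<Longrightarrow> lincomb n c w \<in> D"
proof (induction n)
  case 0
  then show ?case using zero by (simp add: lincomb_def)
next
  case (Suc n)
  have "(\<lambda>x. lincomb n c w x + c n * w n x) \<in> D" by (rule lin) (use Suc in auto)
  then show ?case by (simp add: lincomb_def)
qed

lemma lincomb_left:
  "(\<And>k. k < n \<Longrightarrow> w k \<in> D) \<Longrightarrow> v \<in> D \<Longrightarrow> h (lincomb n c w) v = (\<Sum>k<n. c k * h (w k) v)"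
proof (induction n)
  case 0
  then show ?case by (simp add: lincomb_def zero_left)
next
  case (Suc n)
  have "h (\<lambda>x. lincomb n c w x + c n * w n x) v = h (lincomb n c w) v + c n * h (w n) v"
    by (rule left) (use Suc lincomb_in in auto)
  then show ?case using Suc by (simp add: lincomb_def)
qed

lemma lincomb_right:
  assumes "\<And>k. k < n \<Longrightarrow> w k \<in> D" "v \<in> D"
  shows "h v (lincomb n c w) = (\<Sum>k<n. cnj (c k) * h v (w k))"
proof -
  have "h v (lincomb n c w) = cnj (h (lincomb n c w) v)" by (rule sym) (use assms lincomb_in in auto)
  also have "\<dots> = (\<Sum>k<n. cnj (c k) * cnj (h (w k) v))" using lincomb_left[OF assms] by simp
  also have "\<dots> = (\<Sum>k<n. cnj (c k) * h v (w k))"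
  proof (intro sum.cong refl)
    fix k assume "k \<in> {..<n}"
    then have "h v (w k) = cnj (h (w k) v)" using assms by (intro sym) auto
    then show "cnj (c k) * cnj (h (w k) v) = cnj (c k) * h v (w k)" by (simp only:)
  qed
  finally show ?thesis .
qed

lemma lincomb_q:
  assumes "\<And>k. k < n \<Longrightarrow> w k \<in> D"
  shows "q (lincomb n c w) = Re (\<Sum>k<n. \<Sum>l<n. c k * cnj (c l) * h (w k) (w l))"
proof -
  have "h (lincomb n c w) (lincomb n c w) = (\<Sum>k<n. c k * h (w k) (lincomb n c w))"
    by (rule lincomb_left) (use assms lincomb_in in auto)
  also have "\<dots> = (\<Sum>k<n. c k * (\<Sum>l<n. cnj (c l) * h (w k) (w l)))"
    by (intro sum.cong refl arg_cong2[where f="(*)"] lincomb_right) (use assms in auto)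
  finally show ?thesis by (simp add: q_def sum_distrib_left mult.assoc)
qed

end

locale two_forms = I: herm_form D ip + E: herm_form D en
  for D :: "('x \<Rightarrow> complex) set" and ip en
begin

definition indep :: "nat \<Rightarrow> (nat \<Rightarrow> 'x \<Rightarrow> complex) \<Rightarrow> bool" where
  "indep j w \<longleftrightarrow> (\<forall>c. I.q (lincomb j c w) = 0 \<longrightarrow> (\<forall>k<j. c k = 0))"

definition subspaces :: "nat \<Rightarrow> ('x \<Rightarrow> complex) set set" where
  "subspaces j = {W. \<exists>w. (\<forall>k<j. w k \<in> D) \<and> indep j w \<and> W = range (\<lambda>c. lincomb j c w)}"

definition minmax :: "nat \<Rightarrow> real" where
  "minmax j = (INF W\<in>subspaces j. SUP \<Phi>\<in>{\<Phi>\<in>W. I.q \<Phi> \<noteq> 0}. E.q \<Phi> / I.q \<Phi>)"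

text \<open>The Rayleigh quotient is bounded on a finite-dimensional space, because the unit sphere of
  the coefficients is compact; this makes the supremum in the min-max formula a genuine one.\<close>

lemma rayleigh_bounded:
  assumes w: "\<And>k. k < j \<Longrightarrow> w k \<in> D" and ind: "indep j w"
  obtains C where "\<And>c. E.q (lincomb j c w) \<le> C * I.q (lincomb j c w)"
proof -
  define N where "N c = (\<Sum>k<j. (norm (c k))\<^sup>2)" for c :: "nat \<Rightarrow> complex"
  have cont: "(\<lambda>n. Xq (lincomb j (c n) w)) \<longlonglongrightarrow> Xq (lincomb j c' w)"
    if X: "herm_form D X" and "Xq = herm_form.q X" and lim: "\<And>k. k < j \<Longrightarrow> (\<lambda>n. c n k) \<longlonglongrightarrow> c' k"
    for X Xq and c :: "nat \<Rightarrow> nat \<Rightarrow> complex" and c'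
  proof -
    have lq: "herm_form.q X (lincomb j d w) = Re (\<Sum>k<j. \<Sum>l<j. d k * cnj (d l) * X (w k) (w l))" for d
      by (rule herm_form.lincomb_q[OF X]) (rule w)
    show ?thesis unfolding that(2) lq
      by (intro tendsto_Re tendsto_sum tendsto_mult tendsto_cnj tendsto_const lim) auto
  qed
  have "\<exists>e>0. \<forall>c. N c = 1 \<longrightarrow> e \<le> I.q (lincomb j c w)"
  proof (rule ccontr)
    assume "\<not> ?thesis"
    then have "\<forall>n. \<exists>c. N c = 1 \<and> I.q (lincomb j c w) < 1 / real (Suc n)"
      by (meson not_le of_nat_0_less_iff zero_less_Suc zero_less_divide_1_iff)
    then obtain c where c: "\<And>n. N (c n) = 1" "\<And>n. I.q (lincomb j (c n) w) < 1 / real (Suc n)" by metis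
    have bd: "norm (c n k) \<le> 1" if "k \<in> {..<j}" for n k
    proof -
      have "(norm (c n k))\<^sup>2 \<le> N (c n)" unfolding N_def
        using that by (intro member_le_sum) auto
      then show ?thesis using c(1) by (simp add: power_le_one_iff abs_square_le_1)
    qed
    obtain s where s: "strict_mono s" "\<And>k. k \<in> {..<j} \<Longrightarrow> \<exists>l. (\<lambda>n. c (s n) k) \<longlonglongrightarrow> l"
      using function_convergent_subsequence[of "{..<j}" c 1] bd by blast
    then obtain c' where c': "\<And>k. k < j \<Longrightarrow> (\<lambda>n. c (s n) k) \<longlonglongrightarrow> c' k"
      by (metis lessThan_iff)
    have "(\<lambda>n. N (c (s n))) \<longlonglongrightarrow> N c'"
      unfolding N_def by (intro tendsto_sum tendsto_power tendsto_norm c') auto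
    then have N1: "N c' = 1" by (simp add: c(1) LIMSEQ_const_iff)
    have 1: "(\<lambda>n. I.q (lincomb j (c (s n)) w)) \<longlonglongrightarrow> I.q (lincomb j c' w)"
      by (rule cont[OF I.herm_form_axioms refl c'])
    have "(\<lambda>n. I.q (lincomb j (c (s n)) w)) \<longlonglongrightarrow> 0"
    proof (rule Lim_null_comparison[OF always_eventually], rule allI)
      show "norm (I.q (lincomb j (c (s n)) w)) \<le> 1 / real (Suc n)" for n
      proof -
        have "1 / real (Suc (s n)) \<le> 1 / real (Suc n)"
          using strict_mono_imp_increasing[OF s(1), of n] by (simp add: frac_le)
        then show ?thesis using c(2)[of "s n"] I.q_nonneg[OF I.lincomb_in[OF w]] by simp
      qed
      show "(\<lambda>n. 1 / real (Suc n)) \<longlonglongrightarrow> 0" by (rule LIMSEQ_Suc[OF lim_1_over_n])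
    qed
    then have "I.q (lincomb j c' w) = 0" using 1 LIMSEQ_unique by blast
    then have "\<forall>k<j. c' k = 0" using ind by (simp add: indep_def)
    then have "N c' = 0" by (simp add: N_def)
    then show False using N1 by simp
  qed
  then obtain e where e: "0 < e" "\<And>c. N c = 1 \<Longrightarrow> e \<le> I.q (lincomb j c w)" by blast
  define K where "K = (\<Sum>k<j. \<Sum>l<j. norm (en (w k) (w l)))"
  have "E.q (lincomb j c w) \<le> (K / e) * I.q (lincomb j c w)" for c
  proof (cases "N c = 0")
    case True
    then have "\<forall>k<j. c k = 0" by (simp add: N_def sum_nonneg_eq_0_iff)
    then have "lincomb j c w = (\<lambda>x. 0)" by (simp add: lincomb_def)
    then show ?thesis by (simp add: I.q_zero E.q_zero)
  next
    case False
    then have Np: "0 < N c" by (simp add: N_def sum_nonneg less_le)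
    define r where "r = sqrt (N c)"
    have r: "0 < r" "r\<^sup>2 = N c" using Np by (auto simp: r_def)
    define d where "d k = c k / complex_of_real r" for k
    have N1: "N d = 1" using r Np by (simp add: N_def d_def norm_divide power_divide flip: sum_divide_distrib)
    have lc: "lincomb j c w = (\<lambda>x. complex_of_real r * lincomb j d w x)"
      using r by (simp add: lincomb_def d_def sum_distrib_left)
    have dD: "lincomb j d w \<in> D" by (rule I.lincomb_in[OF w])
    have d1: "norm (d k) \<le> 1" if "k < j" for k
    proof -
      have "(norm (d k))\<^sup>2 \<le> N d" unfolding N_def using that by (intro member_le_sum) auto
      then show ?thesis using N1 by (simp add: power_le_one_iff abs_square_le_1)
    qed
    have "E.q (lincomb j d w) = Re (\<Sum>k<j. \<Sum>l<j. d k * cnj (d l) * en (w k) (w l))"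
      by (rule E.lincomb_q) (rule w)
    also have "\<dots> \<le> norm (\<Sum>k<j. \<Sum>l<j. d k * cnj (d l) * en (w k) (w l))"
      by (rule complex_Re_le_cmod)
    also have "\<dots> \<le> K" unfolding K_def
    proof (intro sum_norm_le)
      fix k l assume "k \<in> {..<j}" "l \<in> {..<j}"
      then have "norm (d k) * norm (d l) \<le> 1 * 1" by (intro mult_mono d1) auto
      then show "norm (d k * cnj (d l) * en (w k) (w l)) \<le> norm (en (w k) (w l))"
        by (simp add: norm_mult mult_left_le_one_le)
    qed
    also have "K \<le> K / e * I.q (lincomb j d w)"
    proof -
      have "0 \<le> K" unfolding K_def by (intro sum_nonneg) auto
      then have "K * e \<le> K * I.q (lincomb j d w)" using e(2)[OF N1] by (intro mult_left_mono) auto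
      then show ?thesis using e(1) by (simp add: field_simps)
    qed
    finally have "r\<^sup>2 * E.q (lincomb j d w) \<le> r\<^sup>2 * (K / e * I.q (lincomb j d w))"
      by (rule mult_left_mono) simp
    then show ?thesis unfolding lc I.q_scale[OF dD] E.q_scale[OF dD] using r by (simp add: mult.left_commute)
  qed
  then show ?thesis using that by blast
qed

lemma subspaceE:
  assumes "W \<in> subspaces j"
  obtains w where "\<And>k. k < j \<Longrightarrow> w k \<in> D" "indep j w" "W = range (\<lambda>c. lincomb j c w)"
  using assms unfolding subspaces_def by blast

lemma subspace_in: "W \<in> subspaces j \<Longrightarrow> \<Phi> \<in> W \<Longrightarrow> \<Phi> \<in> D"
  by (elim subspaceE) (auto intro: I.lincomb_in)

lemma subspace_nonzero:
  assumes "W \<in> subspaces j" "1 \<le> j"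
  shows "{\<Phi>\<in>W. I.q \<Phi> \<noteq> 0} \<noteq> {}"
proof -
  obtain w where w: "\<And>k. k < j \<Longrightarrow> w k \<in> D" "indep j w" "W = range (\<lambda>c. lincomb j c w)"
    using subspaceE[OF assms(1)] by metis
  have "I.q (lincomb j (\<lambda>k. 1) w) \<noteq> 0"
  proof
    assume "I.q (lincomb j (\<lambda>k. 1) w) = 0"
    then have "\<forall>k<j. (1::complex) = 0" using w(2) unfolding indep_def by (metis (mono_tags))
    then show False using assms(2) by auto
  qed
  then show ?thesis using w(3) by blast
qed

lemma subspace_bdd:
  assumes "W \<in> subspaces j"
  shows "bdd_above ((\<lambda>\<Phi>. E.q \<Phi> / I.q \<Phi>) ` {\<Phi>\<in>W. I.q \<Phi> \<noteq> 0})"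
proof -
  obtain w where w: "\<And>k. k < j \<Longrightarrow> w k \<in> D" "indep j w" "W = range (\<lambda>c. lincomb j c w)"
    using subspaceE[OF assms] by metis
  obtain C where C: "\<And>c. E.q (lincomb j c w) \<le> C * I.q (lincomb j c w)"
    using rayleigh_bounded[OF w(1,2)] by metis
  show ?thesis
  proof (rule bdd_aboveI2)
    fix \<Phi> assume \<Phi>: "\<Phi> \<in> {\<Phi>\<in>W. I.q \<Phi> \<noteq> 0}"
    then have "0 < I.q \<Phi>" using I.q_nonneg[of \<Phi>] subspace_in[OF assms, of \<Phi>] by auto
    moreover have "E.q \<Phi> \<le> C * I.q \<Phi>" using \<Phi> C w(3) by auto
    ultimately show "E.q \<Phi> / I.q \<Phi> \<le> C" by (simp add: pos_divide_le_eq)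
  qed
qed

lemma sup_nonneg:
  assumes "W \<in> subspaces j" "1 \<le> j"
  shows "0 \<le> (SUP \<Phi>\<in>{\<Phi>\<in>W. I.q \<Phi> \<noteq> 0}. E.q \<Phi> / I.q \<Phi>)"
proof -
  obtain \<Phi> where \<Phi>: "\<Phi> \<in> {\<Phi>\<in>W. I.q \<Phi> \<noteq> 0}" using subspace_nonzero[OF assms] by blast
  then have "0 \<le> E.q \<Phi> / I.q \<Phi>"
    using I.q_nonneg E.q_nonneg subspace_in[OF assms(1)] by auto
  also have "\<dots> \<le> (SUP \<Phi>\<in>{\<Phi>\<in>W. I.q \<Phi> \<noteq> 0}. E.q \<Phi> / I.q \<Phi>)"
    by (rule cSUP_upper[OF \<Phi> subspace_bdd[OF assms(1)]])
  finally show ?thesis .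
qed

lemma minmax_le:
  assumes W: "W \<in> subspaces j" "1 \<le> j" and t: "\<And>\<Phi>. \<Phi> \<in> W \<Longrightarrow> E.q \<Phi> \<le> t * I.q \<Phi>"
  shows "minmax j \<le> t"
proof -
  have "minmax j \<le> (SUP \<Phi>\<in>{\<Phi>\<in>W. I.q \<Phi> \<noteq> 0}. E.q \<Phi> / I.q \<Phi>)"
    unfolding minmax_def
    by (rule cINF_lower[OF bdd_belowI2[of _ 0] W(1)]) (use sup_nonneg W(2) in blast)
  also have "\<dots> \<le> t"
  proof (rule cSUP_least[OF subspace_nonzero[OF W]])
    fix \<Phi> assume \<Phi>: "\<Phi> \<in> {\<Phi>\<in>W. I.q \<Phi> \<noteq> 0}"
    then have "0 < I.q \<Phi>" using I.q_nonneg[of \<Phi>] subspace_in[OF W(1), of \<Phi>] by auto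
    then show "E.q \<Phi> / I.q \<Phi> \<le> t" using \<Phi> t by (simp add: pos_divide_le_eq)
  qed
  finally show ?thesis .
qed

text \<open>The inequality also holds for \<open>I.q \<Phi> = 0\<close>: by independence such a \<open>\<Phi>\<close> has zero coefficients.\<close>

lemma minmax_attained:
  assumes j: "1 \<le> j" and ne: "subspaces j \<noteq> {}" and t: "minmax j < t"
  obtains W where "W \<in> subspaces j" "\<And>\<Phi>. \<Phi> \<in> W \<Longrightarrow> E.q \<Phi> \<le> t * I.q \<Phi>"
proof -
  have "\<exists>W\<in>subspaces j. (SUP \<Phi>\<in>{\<Phi>\<in>W. I.q \<Phi> \<noteq> 0}. E.q \<Phi> / I.q \<Phi>) < t"
    using t unfolding minmax_def
    by (subst (asm) cINF_less_iff[OF ne bdd_belowI2[of _ 0]]) (use sup_nonneg j in blast)+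
  then obtain W where W: "W \<in> subspaces j" "(SUP \<Phi>\<in>{\<Phi>\<in>W. I.q \<Phi> \<noteq> 0}. E.q \<Phi> / I.q \<Phi>) < t" by blast
  show ?thesis
  proof (rule that[OF W(1)])
    fix \<Phi> assume \<Phi>: "\<Phi> \<in> W"
    then have D: "\<Phi> \<in> D" by (rule subspace_in[OF W(1)])
    show "E.q \<Phi> \<le> t * I.q \<Phi>"
    proof (cases "I.q \<Phi> = 0")
      case True
      obtain w where w: "\<And>k. k < j \<Longrightarrow> w k \<in> D" "indep j w" "W = range (\<lambda>c. lincomb j c w)"
        using subspaceE[OF W(1)] by metis
      obtain c where c: "\<Phi> = lincomb j c w" using \<Phi> w(3) by blast
      then have "\<forall>k<j. c k = 0" using True w(2) unfolding indep_def by blast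
      then have "\<Phi> = (\<lambda>x. 0)" by (simp add: c lincomb_def)
      then show ?thesis by (simp add: I.q_zero E.q_zero)
    next
      case False
      then have p: "0 < I.q \<Phi>" using I.q_nonneg[OF D] by simp
      have "E.q \<Phi> / I.q \<Phi> \<le> (SUP \<Phi>\<in>{\<Phi>\<in>W. I.q \<Phi> \<noteq> 0}. E.q \<Phi> / I.q \<Phi>)"
        by (rule cSUP_upper[OF _ subspace_bdd[OF W(1)]]) (use \<Phi> False in simp)
      then have "E.q \<Phi> / I.q \<Phi> \<le> t" using W(2) by simp
      then show ?thesis using p by (simp add: pos_divide_le_eq)
    qed
  qed
qed

lemma minmax_nonneg:
  assumes "1 \<le> j" "subspaces j \<noteq> {}"
  shows "0 \<le> minmax j"
  unfolding minmax_def by (rule cINF_greatest[OF assms(2)]) (rule sup_nonneg[OF _ assms(1)])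

end

text \<open>A multiplication operator between two form domains that controls Rayleigh quotients up to the level \<open>t\<close> and
  that is injective there carries competitors for the min-max formula to competitors.\<close>

lemma minmax_transfer:
  assumes 1: "two_forms D ip en" and 2: "two_forms D' ip' en'"
    and j: "1 \<le> j" and ne: "two_forms.subspaces D ip j \<noteq> {}"
    and t: "two_forms.minmax D ip en j < t"
    and m: "\<And>u. u \<in> D \<Longrightarrow> herm_form.q en u \<le> t * herm_form.q ip u \<Longrightarrow>
        (\<lambda>x. m x * u x) \<in> D' \<and> herm_form.q en' (\<lambda>x. m x * u x) \<le> t' * herm_form.q ip' (\<lambda>x. m x * u x) \<and>
        (herm_form.q ip' (\<lambda>x. m x * u x) = 0 \<longrightarrow> herm_form.q ip u = 0)"
  shows "two_forms.minmax D' ip' en' j \<le> t'"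
proof -
  interpret A: two_forms D ip en by fact
  interpret B: two_forms D' ip' en' by fact
  obtain W where W: "W \<in> A.subspaces j" "\<And>\<Phi>. \<Phi> \<in> W \<Longrightarrow> A.E.q \<Phi> \<le> t * A.I.q \<Phi>"
    using A.minmax_attained[OF j ne t] by metis
  obtain w where w: "\<And>k. k < j \<Longrightarrow> w k \<in> D" "A.indep j w" "W = range (\<lambda>c. lincomb j c w)"
    using A.subspaceE[OF W(1)] by metis
  define w' where "w' k = (\<lambda>x. m x * w k x)" for k
  have lc: "lincomb j c w' = (\<lambda>x. m x * lincomb j c w x)" for c
    by (simp add: lincomb_def w'_def sum_distrib_left mult.left_commute)
  have P: "(\<lambda>x. m x * lincomb j c w x) \<in> D'"
     "B.E.q (lincomb j c w') \<le> t' * B.I.q (lincomb j c w')"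
     "B.I.q (lincomb j c w') = 0 \<Longrightarrow> A.I.q (lincomb j c w) = 0" for c
    using m[of "lincomb j c w"] A.I.lincomb_in[of j w c] w(1) W(2)[of "lincomb j c w"] w(3) unfolding lc by blast+
  have w'D: "w' k \<in> D'" if "k < j" for k
  proof -
    have "lincomb j (\<lambda>i. if i = k then 1 else 0) w = w k"
    proof
      fix x
      have "lincomb j (\<lambda>i. if i = k then 1 else 0) w x = (\<Sum>i<j. if i = k then w i x else 0)"
        unfolding lincomb_def by (intro sum.cong) auto
      then show "lincomb j (\<lambda>i. if i = k then 1 else 0) w x = w k x" using that by simp
    qed
    then show ?thesis using P(1)[of "\<lambda>i. if i = k then 1 else 0"] by (simp add: w'_def)
  qed
  have ind: "B.indep j w'" using w(2) P(3) unfolding A.indep_def B.indep_def by blast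
  have "range (\<lambda>c. lincomb j c w') \<in> B.subspaces j"
    unfolding B.subspaces_def using w'D ind by blast
  then show ?thesis by (rule B.minmax_le[OF _ j]) (use P(2) in auto)
qed

section \<open>Eigenvalues of compact forms\<close>

text \<open>Compactness and completeness are stated through Cauchy sequences: a sequence bounded for both forms has a
  subsequence that is Cauchy for \<open>ip\<close> (Rellich's theorem), and sequences that are Cauchy for both forms
  converge (the form is closed).\<close>

locale compact_forms = two_forms D ip en
  for D :: "('x \<Rightarrow> complex) set" and ip en +
  assumes compact_embedding: "\<And>v C. (\<And>n. v n \<in> D) \<Longrightarrow> (\<And>n. I.q (v n) \<le> C) \<Longrightarrow> (\<And>n. E.q (v n) \<le> C) \<Longrightarrow>
      \<exists>s. strict_mono (s :: nat \<Rightarrow> nat) \<and> (\<forall>e>0. \<exists>N. \<forall>m\<ge>N. \<forall>n\<ge>N. I.q (fminus (v (s m)) (v (s n))) < e)"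
    and complete: "\<And>v. (\<And>n. v n \<in> D) \<Longrightarrow>
      (\<And>e. 0 < e \<Longrightarrow> \<exists>N. \<forall>m\<ge>N. \<forall>n\<ge>N. I.q (fminus (v m) (v n)) < e \<and> E.q (fminus (v m) (v n)) < e) \<Longrightarrow>
      \<exists>u\<in>D. (\<lambda>n. I.q (fminus (v n) u)) \<longlonglongrightarrow> 0 \<and> (\<lambda>n. E.q (fminus (v n) u)) \<longlonglongrightarrow> 0"
    and infinite_dim: "\<And>n. subspaces n \<noteq> {}"
begin

definition eigenpair :: "real \<Rightarrow> ('x \<Rightarrow> complex) \<Rightarrow> bool" where
  "eigenpair \<mu> u \<longleftrightarrow> u \<in> D \<and> I.q u \<noteq> 0 \<and> (\<forall>v\<in>D. en u v = complex_of_real \<mu> * ip u v)"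

lemma eigenpair_q: "eigenpair \<mu> u \<Longrightarrow> E.q u = \<mu> * I.q u"
  unfolding eigenpair_def E.q_def I.q_def by simp

lemma eigenpair_nonneg: "eigenpair \<mu> u \<Longrightarrow> 0 \<le> \<mu>"
  using eigenpair_q[of \<mu> u] I.q_nonneg[of u] E.q_nonneg[of u]
  by (auto simp: eigenpair_def zero_le_mult_iff)

text \<open>Fewer linear conditions than dimensions.\<close>

lemma nontrivial_orthogonal:
  assumes W: "W \<in> subspaces n" and mn: "m < n" and u: "\<And>k. k < m \<Longrightarrow> u k \<in> D"
  shows "\<exists>v\<in>W. I.q v \<noteq> 0 \<and> (\<forall>k<m. ip v (u k) = 0)"
proof -
  obtain w where w: "\<And>k. k < n \<Longrightarrow> w k \<in> D" "indep n w" "W = range (\<lambda>c. lincomb n c w)"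
    using subspaceE[OF W] by metis
  obtain c where c: "\<exists>k\<in>{..<n}. c k \<noteq> 0" "\<forall>i<m. (\<Sum>k<n. ip (w k) (u i) * c k) = 0"
    using underdetermined_system[of "{..<n}" m "\<lambda>i k. ip (w k) (u i)"] mn by auto
  have "ip (lincomb n c w) (u i) = 0" if "i < m" for i
  proof -
    have "ip (lincomb n c w) (u i) = (\<Sum>k<n. c k * ip (w k) (u i))"
      by (rule I.lincomb_left) (use w u that in auto)
    then show ?thesis using c(2) that by (simp add: mult.commute)
  qed
  moreover have "I.q (lincomb n c w) \<noteq> 0" using w(2) c(1) unfolding indep_def by auto
  ultimately show ?thesis using w(3) by blast
qed

text \<open>The direct method. By compactness a minimising sequence has a subsequence that is Cauchy for
  \<open>ip\<close>; the parallelogram law and minimality make it Cauchy for \<open>en\<close> as well. The limit satisfies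
  the eigenvalue equation against all admissible functions by the Cauchy-Schwarz inequality for the
  positive form \<open>en - \<nu> ip\<close>, and against the earlier eigenfunctions by orthogonality.\<close>

lemma constrained_minimiser:
  fixes u :: "nat \<Rightarrow> 'x \<Rightarrow> complex" and \<mu> :: "nat \<Rightarrow> real"
  assumes u: "\<And>k. k < m \<Longrightarrow> eigenpair (\<mu> k) (u k)"
    and orth: "\<And>k l. k < m \<Longrightarrow> l < m \<Longrightarrow> ip (u k) (u l) = (if k = l then 1 else 0)"
  shows "\<exists>v \<nu>. eigenpair \<nu> v \<and> I.q v = 1 \<and> (\<forall>k<m. ip v (u k) = 0) \<and>
    (\<forall>w\<in>D. (\<forall>k<m. ip w (u k) = 0) \<longrightarrow> \<nu> * I.q w \<le> E.q w)"
proof -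
  define V where "V = {v\<in>D. \<forall>k<m. ip v (u k) = 0}"
  have uD: "u k \<in> D" if "k < m" for k using u[OF that] by (simp add: eigenpair_def)
  have VD: "v \<in> D" if "v \<in> V" for v using that by (simp add: V_def)
  have Vlin: "(\<lambda>x. v x + c * w x) \<in> V" if "v \<in> V" "w \<in> V" for v w c
    using that I.lin[of v w c] I.left[of v w _ c] uD unfolding V_def by simp
  have Vscale: "(\<lambda>x. c * v x) \<in> V" if "v \<in> V" for v c
    using that I.scale[of v c] I.scale_left[of v _ c] uD unfolding V_def by simp
  define T where "T = {E.q v | v. v \<in> V \<and> I.q v = 1}"
  define \<nu> where "\<nu> = Inf T"
  obtain W where W: "W \<in> subspaces (Suc m)" using infinite_dim by blast
  obtain v0 where v0: "v0 \<in> W" "I.q v0 \<noteq> 0" "\<forall>k<m. ip v0 (u k) = 0"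
    using nontrivial_orthogonal[OF W lessI, of u] uD by blast
  have v0V: "v0 \<in> V" using v0 subspace_in[OF W] by (simp add: V_def)
  have normalize: "\<exists>c. I.q (\<lambda>x. c * v x) = 1 \<and> E.q (\<lambda>x. c * v x) = E.q v / I.q v"
    if "v \<in> V" "I.q v \<noteq> 0" for v
  proof -
    have p: "0 < I.q v" using I.q_nonneg[OF VD[OF that(1)]] that(2) by simp
    define c where "c = complex_of_real (1 / sqrt (I.q v))"
    have "(norm c)\<^sup>2 = 1 / I.q v"
      using p by (simp add: c_def power_divide norm_divide)
    then show ?thesis
      using p I.q_scale[OF VD[OF that(1)], of c] E.q_scale[OF VD[OF that(1)], of c] by auto
  qed
  have Tne: "T \<noteq> {}" using normalize[OF v0V v0(2)] Vscale[OF v0V] unfolding T_def by blast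
  have Tbdd: "bdd_below T" unfolding T_def by (rule bdd_belowI[of _ 0]) (use E.q_nonneg VD in auto)
  have \<nu>0: "0 \<le> \<nu>" unfolding \<nu>_def by (rule cInf_greatest[OF Tne]) (use E.q_nonneg VD in \<open>auto simp: T_def\<close>)
  have min: "\<nu> * I.q w \<le> E.q w" if w: "w \<in> V" for w
  proof (cases "I.q w = 0")
    case True
    then show ?thesis using E.q_nonneg VD w by simp
  next
    case False
    obtain c where c: "I.q (\<lambda>x. c * w x) = 1" "E.q (\<lambda>x. c * w x) = E.q w / I.q w"
      using normalize[OF w False] by blast
    have "E.q w / I.q w \<in> T" unfolding T_def using c Vscale[OF w, of c] by (auto intro!: exI[of _ "\<lambda>x. c * w x"])
    then have "\<nu> \<le> E.q w / I.q w" unfolding \<nu>_def by (rule cInf_lower[OF _ Tbdd])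
    moreover have "0 < I.q w" using I.q_nonneg[OF VD[OF w]] False by simp
    ultimately show ?thesis by (simp add: pos_le_divide_eq)
  qed
  have "\<exists>v\<in>V. I.q v = 1 \<and> E.q v < \<nu> + 1 / real (Suc n)" for n
  proof -
    have "\<exists>t\<in>T. t < \<nu> + 1 / real (Suc n)"
      using cInf_lessD[OF Tne, of "\<nu> + 1 / real (Suc n)"] unfolding \<nu>_def by simp
    then show ?thesis unfolding T_def by auto
  qed
  then obtain v where v: "\<And>n. v n \<in> V" "\<And>n. I.q (v n) = 1" "\<And>n. E.q (v n) < \<nu> + 1 / real (Suc n)" by metis
  have "E.q (v n) \<le> \<nu> + 1" for n
    using v(3)[of n] by (rule order_trans[OF less_imp_le]) simp
  then have "\<exists>s. strict_mono (s :: nat \<Rightarrow> nat) \<and> (\<forall>e>0. \<exists>N. \<forall>m\<ge>N. \<forall>n\<ge>N. I.q (fminus (v (s m)) (v (s n))) < e)"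
    by (intro compact_embedding[of v "\<nu> + 1"] VD v) (use v(2) \<nu>0 in auto)
  then obtain s :: "nat \<Rightarrow> nat" where s: "strict_mono s" and cauI: "\<And>e. e > 0 \<Longrightarrow> \<exists>N. \<forall>m\<ge>N. \<forall>n\<ge>N. I.q (fminus (v (s m)) (v (s n))) < e"
    by blast
  define y where "y n = v (s n)" for n
  have y: "y n \<in> V" "I.q (y n) = 1" for n using v by (auto simp: y_def)
  have yE: "E.q (y n) < \<nu> + 1 / real (Suc n)" for n
  proof -
    have "1 / real (Suc (s n)) \<le> 1 / real (Suc n)"
      using strict_mono_imp_increasing[OF s, of n] by (simp add: frac_le)
    then show ?thesis using v(3)[of "s n"] by (simp add: y_def)
  qed
  have Ediff: "E.q (fminus (y k) (y n)) \<le> 2 * (1 / real (Suc k)) + 2 * (1 / real (Suc n)) + \<nu> * I.q (fminus (y k) (y n))" for k n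
  proof -
    have "E.q (fminus (y k) (y n)) = 2 * E.q (y k) + 2 * E.q (y n) - E.q (\<lambda>x. y k x + 1 * y n x)"
      using E.parallelogram[OF VD VD, of "y k" "y n"] y by simp
    moreover have "\<nu> * I.q (\<lambda>x. y k x + 1 * y n x) \<le> E.q (\<lambda>x. y k x + 1 * y n x)"
      by (intro min Vlin y)
    moreover have "I.q (\<lambda>x. y k x + 1 * y n x) = 4 - I.q (fminus (y k) (y n))"
      using I.parallelogram[OF VD VD, of "y k" "y n"] y by simp
    ultimately show ?thesis using yE[of k] yE[of n] by (simp add: right_diff_distrib)
  qed
  have "\<exists>z\<in>D. (\<lambda>n. I.q (fminus (y n) z)) \<longlonglongrightarrow> 0 \<and> (\<lambda>n. E.q (fminus (y n) z)) \<longlonglongrightarrow> 0"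
  proof (rule complete)
    show "y n \<in> D" for n using y VD by blast
    fix e :: real assume e: "0 < e"
    define d where "d = min e (e / (3 * (\<nu> + 1)))"
    have d: "0 < d" "d \<le> e" "\<nu> * d \<le> e / 3"
    proof -
      show "0 < d" "d \<le> e" using e \<nu>0 by (auto simp: d_def)
      have "\<nu> * d \<le> (\<nu> + 1) * (e / (3 * (\<nu> + 1)))"
        using \<nu>0 e by (intro mult_mono) (auto simp: d_def)
      also have "\<dots> = e / 3" using \<nu>0 by (simp add: field_simps)
      finally show "\<nu> * d \<le> e / 3" .
    qed
    obtain N1 where N1: "\<forall>m\<ge>N1. \<forall>n\<ge>N1. I.q (fminus (y m) (y n)) < d"
      using cauI[OF d(1)] unfolding y_def by blast
    obtain N2 :: nat where N2: "6 / e < real N2" using reals_Archimedean2 by blast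
    have small: "2 * (1 / real (Suc k)) < e / 3" if "k \<ge> N2" for k
    proof -
      have "6 / e < real (Suc k)" using N2 that by linarith
      then have "6 < e * real (Suc k)" using e by (simp add: pos_divide_less_eq mult.commute)
      then show ?thesis by (simp add: field_simps)
    qed
    show "\<exists>N. \<forall>m\<ge>N. \<forall>n\<ge>N. I.q (fminus (y m) (y n)) < e \<and> E.q (fminus (y m) (y n)) < e"
    proof (intro exI[of _ "max N1 N2"] allI impI conjI)
      fix k n assume kn: "max N1 N2 \<le> k" "max N1 N2 \<le> n"
      then have I: "I.q (fminus (y k) (y n)) < d" using N1 by simp
      then show "I.q (fminus (y k) (y n)) < e" using d(2) by linarith
      have "\<nu> * I.q (fminus (y k) (y n)) \<le> e / 3"
        using mult_left_mono[OF less_imp_le[OF I] \<nu>0] d(3) by linarith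
      then show "E.q (fminus (y k) (y n)) < e"
        using Ediff[of k n] small[of k] small[of n] kn by linarith
    qed
  qed
  then obtain z where z: "z \<in> D" "(\<lambda>n. I.q (fminus (y n) z)) \<longlonglongrightarrow> 0" "(\<lambda>n. E.q (fminus (y n) z)) \<longlonglongrightarrow> 0" by blast
  have yD: "y n \<in> D" for n using y VD by blast
  have zI: "I.q z = 1"
    using I.q_tendsto[OF yD z(1,2)] y(2) by (simp add: LIMSEQ_const_iff)
  have zV: "ip z (u k) = 0" if k: "k < m" for k
  proof -
    have "(norm (ip z (u k)))\<^sup>2 \<le> I.q (fminus (y n) z) * I.q (u k)" for n
    proof -
      have "ip (fminus (y n) z) (u k) = ip (y n) (u k) + (-1) * ip z (u k)"
        unfolding fminus_def by (rule I.left) (use yD z(1) uD k in auto)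
      also have "\<dots> = - ip z (u k)" using y(1)[of n] k by (simp add: V_def)
      finally show ?thesis
        using I.Cauchy_Schwarz[OF I.fminus_in[OF yD z(1)] uD[OF k], of n] by simp
    qed
    moreover have "(\<lambda>n. I.q (fminus (y n) z) * I.q (u k)) \<longlonglongrightarrow> 0"
      by (rule tendsto_mult_left_zero[OF z(2)])
    ultimately have "(norm (ip z (u k)))\<^sup>2 \<le> 0"
      by (intro LIMSEQ_le_const[of "\<lambda>n. I.q (fminus (y n) z) * I.q (u k)"]) auto
    then show ?thesis by simp
  qed
  then have zV': "z \<in> V" using z(1) by (simp add: V_def)
  have "E.q z \<le> \<nu>"
  proof (rule LIMSEQ_le[OF E.q_tendsto[OF yD z(1,3)]])
    have "(\<lambda>n. \<nu> + 1 / real (Suc n)) \<longlonglongrightarrow> \<nu> + 0"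
      by (intro tendsto_add tendsto_const LIMSEQ_Suc[OF lim_1_over_n])
    then show "(\<lambda>n. \<nu> + 1 / real (Suc n)) \<longlonglongrightarrow> \<nu>" by simp
    show "\<exists>N. \<forall>n\<ge>N. E.q (y n) \<le> \<nu> + 1 / real (Suc n)" using yE less_imp_le by blast
  qed
  then have zE: "E.q z = \<nu>" using min[OF zV'] zI by simp
  interpret G: herm_form V "\<lambda>v w. en v w - complex_of_real \<nu> * ip v w"
  proof
    show "(\<lambda>x. 0) \<in> V" using I.zero I.zero_left uD by (simp add: V_def)
    show "(\<lambda>x. v x + c * w x) \<in> V" if "v \<in> V" "w \<in> V" for v w c by (rule Vlin[OF that])
    show "en (\<lambda>x. v x + c * v' x) w - complex_of_real \<nu> * ip (\<lambda>x. v x + c * v' x) w =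
        (en v w - complex_of_real \<nu> * ip v w) + c * (en v' w - complex_of_real \<nu> * ip v' w)"
      if "v \<in> V" "v' \<in> V" "w \<in> V" for v v' w c
      using I.left[of v v' w c] E.left[of v v' w c] VD that by (simp add: algebra_simps)
    show "en w v - complex_of_real \<nu> * ip w v = cnj (en v w - complex_of_real \<nu> * ip v w)"
      if "v \<in> V" "w \<in> V" for v w
    proof -
      have "en w v = cnj (en v w)" "ip w v = cnj (ip v w)" using E.sym I.sym VD that by blast+
      then show ?thesis by simp
    qed
    show "0 \<le> Re (en v v - complex_of_real \<nu> * ip v v)" if "v \<in> V" for v
      using min[OF that] by (simp add: E.q_def I.q_def)
  qed
  have Gz: "G.q z = 0" using zE zI by (simp add: G.q_def E.q_def I.q_def)
  have onV: "en z w = complex_of_real \<nu> * ip z w" if w: "w \<in> V" for w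
    using G.Cauchy_Schwarz[OF zV' w] Gz by simp
  have all: "en z w = complex_of_real \<nu> * ip z w" if w: "w \<in> D" for w
  proof -
    define c where "c k = ip w (u k)" for k
    define p where "p = lincomb m c u"
    have pD: "p \<in> D" unfolding p_def by (rule I.lincomb_in[OF uD])
    have "ip p (u k) = c k" if "k < m" for k
    proof -
      have "ip p (u k) = (\<Sum>l<m. c l * ip (u l) (u k))" unfolding p_def
        by (rule I.lincomb_left) (use uD that in auto)
      also have "\<dots> = (\<Sum>l<m. if l = k then c l else 0)" by (intro sum.cong) (use orth that in auto)
      finally show ?thesis using that by simp
    qed
    then have "ip (fminus w p) (u k) = 0" if "k < m" for k
      using I.left[OF w pD uD[OF that], of "-1"] that by (simp add: fminus_def c_def)
    then have fV: "fminus w p \<in> V" using I.fminus_in[OF w pD] by (simp add: V_def)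
    have up: "en z (u k) = 0 \<and> ip z (u k) = 0" if k: "k < m" for k
    proof -
      have "en (u k) z = complex_of_real (\<mu> k) * ip (u k) z"
        using u[OF k] z(1) by (simp add: eigenpair_def)
      moreover have "ip (u k) z = 0" using I.sym[OF z(1) uD[OF k]] zV[OF k] by simp
      moreover have "en z (u k) = cnj (en (u k) z)" by (rule E.sym[OF uD[OF k] z(1)])
      ultimately show ?thesis using zV[OF k] by simp
    qed
    have "en z p = 0" "ip z p = 0"
      using E.lincomb_right[of m u z c] I.lincomb_right[of m u z c] uD z(1) up by (auto simp: p_def)
    moreover have "en z (fminus w p) = en z w - en z p" "ip z (fminus w p) = ip z w - ip z p"
      using E.right[OF w pD z(1), of "-1"] I.right[OF w pD z(1), of "-1"] by (simp_all add: fminus_def)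
    ultimately show ?thesis using onV[OF fV] by simp
  qed
  have ep: "eigenpair \<nu> z" unfolding eigenpair_def using z(1) zI all by simp
  have min': "\<nu> * I.q w \<le> E.q w" if "w \<in> D" "\<forall>k<m. ip w (u k) = 0" for w
    by (rule min) (use that in \<open>simp add: V_def\<close>)
  show ?thesis using ep zI zV min' by blast
qed

lemma spectral_sequence:
  fixes m :: nat
  shows "\<exists>u \<mu>. (\<forall>k<m. eigenpair (\<mu> k) (u k)) \<and> (\<forall>k<m. \<forall>l<m. ip (u k) (u l) = (if k = l then 1 else 0)) \<and>
     (\<forall>k<m. \<forall>w\<in>D. (\<forall>l<k. ip w (u l) = 0) \<longrightarrow> \<mu> k * I.q w \<le> E.q w)"
proof (induction m)
  case 0
  show ?case by simp
next
  case (Suc m)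
  then obtain u \<mu> where u: "\<And>k. k < m \<Longrightarrow> eigenpair (\<mu> k) (u k)"
      and orth: "\<And>k l. k < m \<Longrightarrow> l < m \<Longrightarrow> ip (u k) (u l) = (if k = l then 1 else 0)"
      and min: "\<And>k w. k < m \<Longrightarrow> w \<in> D \<Longrightarrow> (\<forall>l<k. ip w (u l) = 0) \<Longrightarrow> \<mu> k * I.q w \<le> E.q w"
    by blast
  obtain v \<nu> where v: "eigenpair \<nu> v" "I.q v = 1" "\<And>k. k < m \<Longrightarrow> ip v (u k) = 0"
    "\<And>w. w \<in> D \<Longrightarrow> \<forall>k<m. ip w (u k) = 0 \<Longrightarrow> \<nu> * I.q w \<le> E.q w"
    using constrained_minimiser[of m \<mu> u] u orth by blast
  have vD: "v \<in> D" using v(1) by (simp add: eigenpair_def)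
  have uD: "u k \<in> D" if "k < m" for k using u[OF that] by (simp add: eigenpair_def)
  have vv: "ip v v = 1" using I.h_self[OF vD] v(2) by simp
  have uv: "ip (u k) v = 0" if "k < m" for k using I.sym[OF vD uD[OF that]] v(3)[OF that] by simp
  let ?u = "u(m := v)" and ?\<mu> = "\<mu>(m := \<nu>)"
  have "\<forall>k<Suc m. eigenpair (?\<mu> k) (?u k)" using u v(1) by (auto simp: less_Suc_eq)
  moreover have "\<forall>k<Suc m. \<forall>l<Suc m. ip (?u k) (?u l) = (if k = l then 1 else 0)"
    using orth v(3) vv uv by (auto simp: less_Suc_eq)
  moreover have "\<forall>k<Suc m. \<forall>w\<in>D. (\<forall>l<k. ip w (?u l) = 0) \<longrightarrow> ?\<mu> k * I.q w \<le> E.q w"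
    using min v(4) by (auto simp: less_Suc_eq)
  ultimately show ?case by blast
qed

definition eigenvalue :: "nat \<Rightarrow> real" where
  "eigenvalue j = Inf {t. \<exists>u. (\<forall>k<j. \<exists>\<mu>\<le>t. eigenpair \<mu> (u k)) \<and> indep j u}"

text \<open>Among \<open>j\<close> dimensions there is a function orthogonal to the first \<open>j - 1\<close> minimisers, which bounds
  the min-max value from below by the last one. Conversely the span of \<open>j\<close> eigenfunctions with
  eigenvalues at most \<open>t\<close> has Rayleigh quotients at most \<open>t\<close>.\<close>

theorem eigenvalue_eq_minmax:
  assumes j: "1 \<le> j"
  shows "eigenvalue j = minmax j"
proof -
  define T where "T = {t. \<exists>u. (\<forall>k<j. \<exists>\<mu>\<le>t. eigenpair \<mu> (u k)) \<and> indep j u}"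
  have Tbdd: "bdd_below T"
  proof (rule bdd_belowI)
    fix t assume "t \<in> T"
    then obtain u where "\<forall>k<j. \<exists>\<mu>\<le>t. eigenpair \<mu> (u k)" unfolding T_def by blast
    moreover have "0 < j" using j by simp
    ultimately obtain \<mu> where "\<mu> \<le> t" "eigenpair \<mu> (u 0)" by blast
    then show "0 \<le> t" using eigenpair_nonneg by fastforce
  qed
  obtain u \<mu> where u: "\<And>k. k < j \<Longrightarrow> eigenpair (\<mu> k) (u k)"
      and orth: "\<And>k l. k < j \<Longrightarrow> l < j \<Longrightarrow> ip (u k) (u l) = (if k = l then 1 else 0)"
      and min: "\<And>k w. k < j \<Longrightarrow> w \<in> D \<Longrightarrow> (\<forall>l<k. ip w (u l) = 0) \<Longrightarrow> \<mu> k * I.q w \<le> E.q w"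
    using spectral_sequence[of j] by blast
  have uD: "u k \<in> D" if "k < j" for k using u[OF that] by (simp add: eigenpair_def)
  have uq: "I.q (u k) = 1" if "k < j" for k using orth[OF that that] by (simp add: I.q_def)
  define i where "i = j - 1" \<comment> \<open>the eigenfunctions are numbered from \<open>0\<close>\<close>
  have i: "i < j" "j = Suc i" using j by (auto simp: i_def)
  have inT: "\<mu> i \<in> T" unfolding T_def
  proof (intro CollectI exI[of _ u] conjI)
    show "\<forall>k<j. \<exists>\<mu>'\<le>\<mu> i. eigenpair \<mu>' (u k)"
    proof (intro allI impI)
      fix k assume k: "k < j"
      have "\<mu> k * I.q (u i) \<le> E.q (u i)"
        by (rule min[OF k uD[OF i(1)]]) (use orth i k in auto)
      then have "\<mu> k \<le> \<mu> i" using eigenpair_q[OF u[OF i(1)]] uq[OF i(1)] by simp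
      then show "\<exists>\<mu>'\<le>\<mu> i. eigenpair \<mu>' (u k)" using u[OF k] by blast
    qed
  next
    show "indep j u" unfolding indep_def
    proof (intro allI impI)
      fix c k assume 0: "I.q (lincomb j c u) = 0" and k: "k < j"
      have "(norm (ip (lincomb j c u) (u k)))\<^sup>2 \<le> 0"
        using I.Cauchy_Schwarz[OF I.lincomb_in uD[OF k], of j u c] uD 0 by simp
      then have "ip (lincomb j c u) (u k) = 0" by simp
      moreover have "ip (lincomb j c u) (u k) = (\<Sum>l<j. c l * ip (u l) (u k))"
        by (rule I.lincomb_left) (use uD k in auto)
      moreover have "\<dots> = (\<Sum>l<j. if l = k then c l else 0)" by (intro sum.cong) (use orth k in auto)
      ultimately show "c k = 0" using k by simp
    qed
  qed
  have le: "\<mu> i \<le> t" if t: "minmax j < t" for t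
  proof -
    obtain W where W: "W \<in> subspaces j" "\<And>\<Phi>. \<Phi> \<in> W \<Longrightarrow> E.q \<Phi> \<le> t * I.q \<Phi>"
      using minmax_attained[OF j infinite_dim t] by metis
    have "u k \<in> D" if "k < i" for k using uD[of k] that i by simp
    then obtain v where v: "v \<in> W" "I.q v \<noteq> 0" "\<forall>k<i. ip v (u k) = 0"
      using nontrivial_orthogonal[OF W(1) i(1), of u] by blast
    have vD: "v \<in> D" by (rule subspace_in[OF W(1) v(1)])
    have "\<mu> i * I.q v \<le> t * I.q v"
      using min[OF i(1) vD] v(3) W(2)[OF v(1)] by fastforce
    then show ?thesis using v(2) I.q_nonneg[OF vD] by (simp add: mult_le_cancel_right)
  qed
  have 1: "eigenvalue j \<le> minmax j"
  proof -
    have "eigenvalue j \<le> \<mu> i" unfolding eigenvalue_def T_def[symmetric] by (rule cInf_lower[OF inT Tbdd])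
    also have "\<mu> i \<le> minmax j" by (rule dense_ge) (rule le)
    finally show ?thesis .
  qed
  have "minmax j \<le> t" if t: "t \<in> T" for t
  proof -
    obtain w where w: "\<forall>k<j. \<exists>\<mu>\<le>t. eigenpair \<mu> (w k)" and ind: "indep j w" using t unfolding T_def by blast
    then obtain \<kappa> where \<kappa>: "\<And>k. k < j \<Longrightarrow> \<kappa> k \<le> t" "\<And>k. k < j \<Longrightarrow> eigenpair (\<kappa> k) (w k)" by metis
    have wD: "w k \<in> D" if "k < j" for k using \<kappa>(2)[OF that] by (simp add: eigenpair_def)
    have orth': "ip (w k) (w l) = 0" if "k < j" "l < j" "\<kappa> k \<noteq> \<kappa> l" for k l
    proof -
      have "en (w k) (w l) = complex_of_real (\<kappa> k) * ip (w k) (w l)"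
        using \<kappa>(2)[OF that(1)] wD[OF that(2)] by (simp add: eigenpair_def)
      moreover have "en (w l) (w k) = complex_of_real (\<kappa> l) * ip (w l) (w k)"
        using \<kappa>(2)[OF that(2)] wD[OF that(1)] by (simp add: eigenpair_def)
      moreover have "en (w k) (w l) = cnj (en (w l) (w k))" "ip (w k) (w l) = cnj (ip (w l) (w k))"
        using E.sym I.sym wD that by blast+
      ultimately have "complex_of_real (\<kappa> k) * ip (w k) (w l) = complex_of_real (\<kappa> l) * ip (w k) (w l)" by auto
      then show ?thesis using that(3) by simp
    qed
    have "E.q (lincomb j c w) \<le> t * I.q (lincomb j c w)" for c
    proof -
      \<comment> \<open>eigenfunctions of different eigenvalues are orthogonal, so \<open>t ip - en\<close> on the span of \<open>w\<close> is
        the square of \<open>ip\<close> after the coefficients are scaled by \<open>sqrt (t - \<kappa> k)\<close>\<close>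
      define d where "d k = complex_of_real (sqrt (t - \<kappa> k)) * c k" for k
      have weighted: "d k * cnj (d l) * ip (w k) (w l) =
          complex_of_real t * (c k * cnj (c l) * ip (w k) (w l)) - c k * cnj (c l) * en (w k) (w l)"
        if "k < j" "l < j" for k l
      proof -
        have e: "en (w k) (w l) = complex_of_real (\<kappa> k) * ip (w k) (w l)"
          using \<kappa>(2)[OF that(1)] wD[OF that(2)] by (simp add: eigenpair_def)
        show ?thesis
        proof (cases "\<kappa> k = \<kappa> l")
          case True
          have sq: "complex_of_real (sqrt (t - \<kappa> k)) * complex_of_real (sqrt (t - \<kappa> l)) = complex_of_real (t - \<kappa> k)"
            unfolding True of_real_mult[symmetric] using \<kappa>(1)[OF that(2)] by simp
          have "d k * cnj (d l) * ip (w k) (w l) = (complex_of_real (sqrt (t - \<kappa> k)) * complex_of_real (sqrt (t - \<kappa> l))) *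
              (c k * cnj (c l) * ip (w k) (w l))"
            by (simp add: d_def mult_ac)
          also have "\<dots> = complex_of_real (t - \<kappa> k) * (c k * cnj (c l) * ip (w k) (w l))" by (simp only: sq)
          finally show ?thesis unfolding e by (simp add: algebra_simps)
        next
          case False
          then show ?thesis unfolding e using orth'[OF that] by simp
        qed
      qed
      have "0 \<le> I.q (lincomb j d w)" by (intro I.q_nonneg I.lincomb_in wD)
      also have "I.q (lincomb j d w) = Re (\<Sum>k<j. \<Sum>l<j. d k * cnj (d l) * ip (w k) (w l))"
        by (rule I.lincomb_q) (rule wD)
      also have "(\<Sum>k<j. \<Sum>l<j. d k * cnj (d l) * ip (w k) (w l)) =
         (\<Sum>k<j. \<Sum>l<j. complex_of_real t * (c k * cnj (c l) * ip (w k) (w l)) - c k * cnj (c l) * en (w k) (w l))"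
        by (intro sum.cong refl weighted) auto
      also have "\<dots> = complex_of_real t * (\<Sum>k<j. \<Sum>l<j. c k * cnj (c l) * ip (w k) (w l)) - (\<Sum>k<j. \<Sum>l<j. c k * cnj (c l) * en (w k) (w l))"
        by (simp add: sum_subtractf sum_distrib_left)
      also have "Re \<dots> = t * I.q (lincomb j c w) - E.q (lincomb j c w)"
        using I.lincomb_q[of j w c] E.lincomb_q[of j w c] wD by simp
      finally show ?thesis by simp
    qed
    moreover have "range (\<lambda>c. lincomb j c w) \<in> subspaces j"
      unfolding subspaces_def using wD ind by blast
    ultimately show ?thesis by (intro minmax_le[OF _ j]) auto
  qed
  then have 2: "minmax j \<le> eigenvalue j"
    unfolding eigenvalue_def T_def[symmetric] using inT by (intro cInf_greatest) auto
  show ?thesis using 1 2 by (rule antisym)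
qed

end

section \<open>The magnetic form and the min-max formula\<close>

definition energy :: "(real^2 \<Rightarrow> real^2) \<Rightarrow> (real^2) set \<Rightarrow> (real^2 \<Rightarrow> complex) \<Rightarrow> (real^2 \<Rightarrow> complex) \<Rightarrow> complex" where
  "energy A U u v = vip (lebesgue_on U) (mgrad_ext A U u) (mgrad_ext A U v)"

context
  fixes A :: "real^2 \<Rightarrow> real^2" and U :: "(real^2) set"
  assumes U: "open U" and A: "smooth_pot U A"
begin

lemma form_domain_sqint: "u \<in> form_domain A U \<Longrightarrow> sqint (lebesgue_on U) u"
  using form_limit_sqint(1) mgrad_ext_limit by blast

lemma mgrad_ext_sqint: "u \<in> form_domain A U \<Longrightarrow> sqint (lebesgue_on U) (mgrad_ext A U u)"
  using form_limit_sqint(2) mgrad_ext_limit by blast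

lemma form_domain_lin:
  assumes "u \<in> form_domain A U" "v \<in> form_domain A U"
  shows "form_limit A U (\<lambda>x. u x + c * v x) (\<lambda>x. mgrad_ext A U u x + c *s mgrad_ext A U v x)"
  by (rule form_limit_lin[OF U A mgrad_ext_limit[OF assms(1)] mgrad_ext_limit[OF assms(2)]])

lemma herm_form_ip: "herm_form (form_domain A U) (cip (lebesgue_on U))"
proof
  show "(\<lambda>x. 0) \<in> form_domain A U"
    by (rule form_limit_domain[OF form_limit_test[OF U A test_zero]])
  show "(\<lambda>x. u x + c * v x) \<in> form_domain A U" if "u \<in> form_domain A U" "v \<in> form_domain A U" for u v c
    by (rule form_limit_domain[OF form_domain_lin[OF that]])
  show "cip (lebesgue_on U) (\<lambda>x. u x + c * v x) w = cip (lebesgue_on U) u w + c * cip (lebesgue_on U) v w"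
    if "u \<in> form_domain A U" "v \<in> form_domain A U" "w \<in> form_domain A U" for u v w c
    by (intro cip_lin_left form_domain_sqint that)
  show "cip (lebesgue_on U) v u = cnj (cip (lebesgue_on U) u v)" for u v by (rule cip_cnj)
  show "0 \<le> Re (cip (lebesgue_on U) u u)" for u by (simp add: cip_self)
qed

lemma herm_form_energy: "herm_form (form_domain A U) (energy A U)"
proof -
  interpret I: herm_form "form_domain A U" "cip (lebesgue_on U)" by (rule herm_form_ip)
  show ?thesis
  proof
    show "energy A U (\<lambda>x. u x + c * v x) w = energy A U u w + c * energy A U v w"
      if uvw: "u \<in> form_domain A U" "v \<in> form_domain A U" "w \<in> form_domain A U" for u v w c
    proof -
      have "energy A U (\<lambda>x. u x + c * v x) w =
          vip (lebesgue_on U) (\<lambda>x. mgrad_ext A U u x + c *s mgrad_ext A U v x) (mgrad_ext A U w)"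
        unfolding energy_def
        by (intro vip_cong_AE mgrad_ext_eq[OF U A form_domain_lin] mgrad_ext_sqint uvw I.lin sqint_add sqint_smult) auto
      also have "\<dots> = energy A U u w + c * energy A U v w"
        unfolding energy_def by (intro vip_lin_left mgrad_ext_sqint uvw)
      finally show ?thesis .
    qed
    show "energy A U v u = cnj (energy A U u v)" for u v unfolding energy_def by (rule vip_cnj)
    show "0 \<le> Re (energy A U u u)" for u unfolding energy_def by (simp add: vip_self)
  qed (intro I.zero I.lin; assumption)+
qed

lemma two_forms_magnetic: "two_forms (form_domain A U) (cip (lebesgue_on U)) (energy A U)"
  unfolding two_forms_def using herm_form_ip herm_form_energy by blast

interpretation F: two_forms "form_domain A U" "cip (lebesgue_on U)" "energy A U"
  by (rule two_forms_magnetic)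

lemma ip_q: "F.I.q u = (l2norm (lebesgue_on U) u)\<^sup>2"
  by (simp add: F.I.q_def cip_self)

lemma energy_q: "F.E.q u = form_norm_sq A U u"
  by (simp add: F.E.q_def energy_def vip_self form_norm_sq_def L2_sq_eq)

lemma ae_zero_iff: "u \<in> form_domain A U \<Longrightarrow> ae_zero U u \<longleftrightarrow> F.I.q u = 0"
  unfolding ae_zero_def ip_q using l2norm_eq_0_iff_AE[OF form_domain_sqint] by simp

lemma ae_independent_iff:
  assumes "\<And>k. k < j \<Longrightarrow> w k \<in> form_domain A U"
  shows "ae_independent U j w \<longleftrightarrow> F.indep j w"
  unfolding ae_independent_def F.indep_def lincomb_def[symmetric]
  using ae_zero_iff[OF F.I.lincomb_in[of j w]] assms by simp

lemma form_subspaces_eq: "form_subspaces A U j = F.subspaces j"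
proof -
  have "(\<forall>k<j. w k \<in> form_domain A U) \<and> ae_independent U j w \<and> W = range (\<lambda>c. lincomb j c w) \<longleftrightarrow>
      (\<forall>k<j. w k \<in> form_domain A U) \<and> F.indep j w \<and> W = range (\<lambda>c. lincomb j c w)" for w W
    using ae_independent_iff[of j w] by blast
  moreover have "range (\<lambda>(c :: nat \<Rightarrow> complex) x. \<Sum>k<j. c k * w k x) = range (\<lambda>c. lincomb j c w)" for w :: "nat \<Rightarrow> real^2 \<Rightarrow> complex"
    by (simp add: lincomb_def)
  ultimately show ?thesis unfolding form_subspaces_def F.subspaces_def by simp
qed

text \<open>Almost everywhere vanishing and independence are expressed by the \<open>L\<^sup>2\<close> form.\<close>

lemma rayleigh_minmax_eq:
  "(INF W\<in>form_subspaces A U j. SUP \<Phi>\<in>{\<Phi>\<in>W. \<not> ae_zero U \<Phi>}. form_norm_sq A U \<Phi> / L2_sq U \<Phi>) = F.minmax j"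
  unfolding F.minmax_def form_subspaces_eq
proof (rule arg_cong[where f=Inf], rule image_cong[OF refl])
  fix W assume W: "W \<in> F.subspaces j"
  then have "{\<Phi>\<in>W. \<not> ae_zero U \<Phi>} = {\<Phi>\<in>W. F.I.q \<Phi> \<noteq> 0}"
    using ae_zero_iff F.subspace_in by blast
  then show "(SUP \<Phi>\<in>{\<Phi>\<in>W. \<not> ae_zero U \<Phi>}. form_norm_sq A U \<Phi> / L2_sq U \<Phi>) =
      (SUP \<Phi>\<in>{\<Phi>\<in>W. F.I.q \<Phi> \<noteq> 0}. F.E.q \<Phi> / F.I.q \<Phi>)"
    by (simp add: energy_q ip_q L2_sq_eq)
qed

lemma continuous_ae_zero:
  fixes f :: "real^2 \<Rightarrow> complex"
  assumes f: "continuous_on UNIV f" and z: "AE x in lebesgue_on U. f x = 0" and x: "x \<in> U"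
  shows "f x = 0"
proof (rule ccontr)
  assume "f x \<noteq> 0"
  let ?N = "{y\<in>U. f y \<noteq> 0}"
  have "open {y. f y \<noteq> 0}" using f by (intro open_Collect_neq) auto
  then have o: "open ?N" using U by (simp add: Collect_conj_eq open_Int)
  have "AE y in lebesgue. y \<in> U \<longrightarrow> f y = 0"
    using z by (subst (asm) AE_restrict_space_iff) (use U in auto)
  then have "AE y in lebesgue. y \<notin> ?N" by eventually_elim auto
  moreover have "?N \<in> sets lebesgue" using o by auto
  ultimately have "?N \<in> null_sets lebesgue" using AE_iff_null_sets by blast
  then have "negligible ?N" by (simp add: negligible_iff_null_sets)
  moreover have "?N \<noteq> {}" using x \<open>f x \<noteq> 0\<close> by auto
  ultimately show False using open_not_negligible[OF o] by blast
qed

text \<open>Bumps on \<open>n\<close> disjoint annuli around one point span an \<open>n\<close>-dimensional space, so the infimum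
  in the min-max formula is never over the empty family.\<close>

lemma subspaces_nonempty:
  assumes "U \<noteq> {}"
  shows "F.subspaces n \<noteq> {}"
proof -
  obtain p where p: "p \<in> U" using assms by blast
  obtain \<rho> where \<rho>: "0 < \<rho>" "ball p \<rho> \<subseteq> U" using U p open_contains_ball by blast
  define s where "s k = \<rho>\<^sup>2 * real (k + 1) / real (n + 2)" for k
  have s_mono: "s k \<le> s l" if "k \<le> l" for k l
    unfolding s_def using that by (intro divide_right_mono mult_left_mono) auto
  have s_less: "s k < s (Suc k)" for k using \<rho> by (simp add: s_def divide_strict_right_mono)
  have s_pos: "0 < s k" for k using \<rho> by (simp add: s_def)
  have s_n: "s n < \<rho>\<^sup>2" using \<rho> by (simp add: s_def pos_divide_less_eq)
  define \<phi> where "\<phi> k x = complex_of_real (flat ((norm (x - p))\<^sup>2 - s k) * flat (s (Suc k) - (norm (x - p))\<^sup>2))" for k x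
  have sup: "\<phi> k x = 0" if "(norm (x - p))\<^sup>2 \<le> s k \<or> s (Suc k) \<le> (norm (x - p))\<^sup>2" for k x
    using that by (auto simp: \<phi>_def flat_zero)
  have test: "\<phi> k \<in> test_functions U" if "k < n" for k
  proof (rule test_functionsI[where S="cball p (sqrt (s n))"])
    have "rsmooth_on UNIV (\<lambda>x. flat ((norm (x - p))\<^sup>2 - s k) * flat (s (Suc k) - (norm (x - p))\<^sup>2))"
      by (intro rsmooth_on_mult rsmooth_on_flat rsmooth_on_diff rsmooth_on_const rsmooth_on_dist_sq open_UNIV)
    then show "smooth_on UNIV (\<phi> k)" unfolding rsmooth_on_def \<phi>_def[abs_def] .
    have "sqrt (s n) < \<rho>" using s_n \<rho> by (simp add: real_less_lsqrt)
    then show "cball p (sqrt (s n)) \<subseteq> U" using \<rho>(2) by (auto simp: subset_iff)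
    fix x assume "x \<notin> cball p (sqrt (s n))"
    then have "sqrt (s n) < norm (x - p)" by (simp add: dist_norm norm_minus_commute)
    then have "(sqrt (s n))\<^sup>2 < (norm (x - p))\<^sup>2" using s_pos[of n] by (intro power_strict_mono) auto
    then have "s n < (norm (x - p))\<^sup>2" using s_pos[of n] by simp
    then show "\<phi> k x = 0" using s_mono[of "Suc k" n] that by (intro sup) auto
  qed simp
  have D: "\<phi> k \<in> form_domain A U" if "k < n" for k
    by (rule form_limit_domain[OF form_limit_test[OF U A test[OF that]]])
  define y where "y k = p + sqrt ((s k + s (Suc k)) / 2) *\<^sub>R axis 1 1" for k
  have y: "(norm (y k - p))\<^sup>2 = (s k + s (Suc k)) / 2" for k
    using s_pos[of k] s_pos[of "Suc k"] by (simp add: y_def norm_axis_1)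
  have yU: "y k \<in> U" if "k < n" for k
  proof -
    have "(s k + s (Suc k)) / 2 < \<rho>\<^sup>2" using s_less[of k] s_mono[of "Suc k" n] s_n that by simp
    then have "(norm (y k - p))\<^sup>2 < \<rho>\<^sup>2" by (simp add: y)
    then have "norm (y k - p) < \<rho>" using \<rho> by (simp add: power2_less_imp_less)
    then show ?thesis using \<rho>(2) by (auto simp: subset_iff dist_norm norm_minus_commute)
  qed
  have y1: "\<phi> k (y k) \<noteq> 0" for k
    using flat_pos[of "(s k + s (Suc k)) / 2 - s k"] flat_pos[of "s (Suc k) - (s k + s (Suc k)) / 2"] s_less[of k]
    by (simp add: \<phi>_def y)
  have y0: "\<phi> l (y k) = 0" if "l \<noteq> k" for l k
  proof (rule sup, cases "l < k")
    case True
    then show "(norm (y k - p))\<^sup>2 \<le> s l \<or> s (Suc l) \<le> (norm (y k - p))\<^sup>2"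
      using s_mono[of "Suc l" k] s_less[of k] by (simp add: y)
  next
    case False
    then show "(norm (y k - p))\<^sup>2 \<le> s l \<or> s (Suc l) \<le> (norm (y k - p))\<^sup>2"
      using s_mono[of "Suc k" l] s_less[of k] that by (simp add: y)
  qed
  have "F.indep n \<phi>" unfolding F.indep_def
  proof (intro allI impI)
    fix c k assume 0: "F.I.q (lincomb n c \<phi>) = 0" and k: "k < n"
    have "AE x in lebesgue_on U. lincomb n c \<phi> x = 0"
      using 0 l2norm_eq_0_iff_AE[OF form_domain_sqint[OF F.I.lincomb_in[OF D]]] by (simp add: ip_q)
    moreover have "continuous_on UNIV (lincomb n c \<phi>)"
      unfolding lincomb_def by (intro continuous_intros test_continuous[OF test]) auto
    ultimately have "lincomb n c \<phi> (y k) = 0" by (intro continuous_ae_zero yU k)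
    moreover have "lincomb n c \<phi> (y k) = (\<Sum>l<n. if l = k then c l * \<phi> l (y k) else 0)"
      unfolding lincomb_def by (intro sum.cong) (auto simp: y0)
    ultimately show "c k = 0" using k y1[of k] by simp
  qed
  then show ?thesis unfolding F.subspaces_def using D by blast
qed

end

section \<open>Compact embedding of \<open>H\<^sup>1\<^sub>0\<close> into \<open>L\<^sup>2\<close>\<close>

text \<open>The fundamental theorem of calculus along the segment from \<open>x\<close> to \<open>x + z\<close>, integrated over \<open>x\<close>.\<close>

lemma translation_bound:
  assumes \<phi>: "\<phi> \<in> test_functions UNIV"
  shows "(\<integral>\<^sup>+x. ennreal ((norm (\<phi> (x + z) - \<phi> x))\<^sup>2) \<partial>lborel) \<le>
     ennreal ((norm z)\<^sup>2) * (\<integral>\<^sup>+x. ennreal ((norm (mgrad (\<lambda>_. 0) \<phi> x))\<^sup>2) \<partial>lborel)"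
proof -
  let ?g = "mgrad (\<lambda>_. 0) \<phi>"
  have gc: "continuous_on UNIV ?g" by (rule mgrad_continuous[OF open_UNIV smooth_pot_zero[OF open_UNIV] \<phi>])
  have mc: "continuous_on UNIV (\<lambda>x. norm z * norm (?g x))" by (intro continuous_intros gc)
  have "(\<integral>\<^sup>+x. ennreal ((norm (\<phi> (x + z) - \<phi> x))\<^sup>2) \<partial>lborel) \<le>
     ennreal (1\<^sup>2) * (\<integral>\<^sup>+x. ennreal ((norm z * norm (?g x))\<^sup>2) \<partial>lborel)"
  proof (rule orbit_average_bound[where T="\<lambda>t x. x + t *\<^sub>R z" and m="\<lambda>x. norm z * norm (?g x)", OF mc])
    show "continuous_on UNIV (\<lambda>(t, x). x + t *\<^sub>R z)"
      unfolding case_prod_beta by (intro continuous_intros)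
    show "(\<integral>\<^sup>+x. h (x + t *\<^sub>R z) \<partial>lborel) = (\<integral>\<^sup>+x. h x \<partial>lborel)" if "h \<in> borel_measurable borel" for t h
      by (rule nn_integral_translation[OF that])
    fix x
    have dz: "((\<lambda>t. x + t *\<^sub>R z) has_vector_derivative z) (at t within {0..1})" for t
      by (auto intro!: derivative_eq_intros)
    have d: "((\<lambda>t. \<phi> (x + t *\<^sub>R z)) has_vector_derivative frechet_derivative \<phi> (at (x + t *\<^sub>R z)) z) (at t within {0..1})" for t
      using vector_derivative_diff_chain_within[OF dz has_derivative_at_withinI[OF test_has_derivative[OF \<phi>]], of t]
      by (simp add: o_def)
    have I: "((\<lambda>t. frechet_derivative \<phi> (at (x + t *\<^sub>R z)) z) has_integral (\<phi> (x + 1 *\<^sub>R z) - \<phi> (x + 0 *\<^sub>R z))) {0..1}"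
      by (rule fundamental_theorem_of_calculus) (use d in auto)
    have le: "norm (frechet_derivative \<phi> (at y) z) \<le> norm z * norm (?g y)" for y
    proof -
      have "\<i> * frechet_derivative \<phi> (at y) z = (\<Sum>i\<in>UNIV. complex_of_real (z $ i) * ?g y $ i)"
        unfolding frechet_derivative_pd[OF \<phi>] mgrad_nth mpart_def sum_distrib_left by (simp add: mult.left_commute)
      then have "norm (frechet_derivative \<phi> (at y) z) = norm (\<Sum>i\<in>UNIV. complex_of_real (z $ i) * ?g y $ i)"
        by (metis norm_mult norm_ii mult_1)
      then show ?thesis using norm_complex_dot_le[of z "?g y"] by simp
    qed
    have "norm (\<phi> (x + 1 *\<^sub>R z) - \<phi> (x + 0 *\<^sub>R z)) \<le> integral {0..1} (\<lambda>t. norm z * norm (?g (x + t *\<^sub>R z)))"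
      unfolding integral_unique[OF I, symmetric]
    proof (intro integral_norm_bound_integral has_integral_integrable[OF I] le)
      show "(\<lambda>t. norm z * norm (?g (x + t *\<^sub>R z))) integrable_on {0..1}"
        by (intro integrable_continuous_interval continuous_on_compose2[OF mc]) (auto intro!: continuous_intros)
    qed
    then show "norm (\<phi> (x + z) - \<phi> x) \<le> integral {0..1} (\<lambda>t. norm z * norm (?g (x + t *\<^sub>R z)))" by simp
  qed auto
  also have "\<dots> = ennreal ((norm z)\<^sup>2) * (\<integral>\<^sup>+x. ennreal ((norm (?g x))\<^sup>2) \<partial>lborel)"
  proof -
    have "ennreal ((norm z * norm (?g x))\<^sup>2) = ennreal ((norm z)\<^sup>2) * ennreal ((norm (?g x))\<^sup>2)" for x
      by (simp add: power_mult_distrib ennreal_mult')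
    moreover have "(\<lambda>x. ennreal ((norm (?g x))\<^sup>2)) \<in> borel_measurable lborel"
      using borel_measurable_continuous_onI[OF gc] by measurable
    ultimately show ?thesis by (simp add: nn_integral_cmult)
  qed
  finally show ?thesis .
qed

definition ball_integral :: "real \<Rightarrow> real^2 \<Rightarrow> (real^2 \<Rightarrow> complex) \<Rightarrow> complex" where
  "ball_integral h p f = (LINT y|lborel. indicator (cball p h) y *\<^sub>R f y)"

definition ball_area :: "real \<Rightarrow> real" where
  "ball_area h = measure lborel (cball (0::real^2) h)"

lemma ball_area_eq: "0 \<le> h \<Longrightarrow> measure lborel (cball (p::real^2) h) = ball_area h"
  by (simp add: ball_area_def content_cball)

lemma ball_area_pos: "0 < h \<Longrightarrow> 0 < ball_area h"
  by (simp add: ball_area_def content_cball)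

lemma ball_area_double: "0 \<le> h \<Longrightarrow> ball_area (2 * h) = 4 * ball_area h"
  by (simp add: ball_area_def content_cball power_mult_distrib)

lemma ball_area_mono: "0 \<le> h \<Longrightarrow> h \<le> k \<Longrightarrow> ball_area h \<le> ball_area k"
  by (simp add: ball_area_def content_cball power_mono)

lemma integrable_cball:
  fixes f :: "real^2 \<Rightarrow> 'b::euclidean_space"
  assumes "continuous_on UNIV f"
  shows "integrable lborel (\<lambda>y. indicator (cball p h) y *\<^sub>R f y)"
  by (rule borel_integrable_compact) (use assms continuous_on_subset in auto)

lemma ball_integral_sq_le:
  assumes f: "continuous_on UNIV f" and h: "0 \<le> h"
  shows "(norm (ball_integral h p f))\<^sup>2 \<le> ball_area h * (LINT y|lborel. indicator (cball p h) y *\<^sub>R (norm (f y))\<^sup>2)"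
proof -
  let ?i = "\<lambda>y. indicator (cball p h) y :: real"
  have nc: "continuous_on UNIV (\<lambda>y. norm (f y))" "continuous_on UNIV (\<lambda>y. (norm (f y))\<^sup>2)"
    by (intro continuous_intros f)+
  have e1: "(?i y)\<^sup>2 = ?i y *\<^sub>R 1" and e2: "(?i y *\<^sub>R norm (f y))\<^sup>2 = ?i y *\<^sub>R (norm (f y))\<^sup>2"
    and e3: "?i y \<bullet> (?i y *\<^sub>R norm (f y)) = ?i y *\<^sub>R norm (f y)" for y
    by (auto simp: indicator_def)
  have m: "(\<lambda>y. ?i y *\<^sub>R norm (f y)) \<in> borel_measurable lborel"
    using borel_measurable_integrable[OF integrable_cball[OF nc(1)]] .
  have s1: "sqint lborel ?i"
    unfolding sqint_def real_norm_def power2_abs e1 using integrable_cball[of "\<lambda>_. 1::real"] by auto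
  have s2: "sqint lborel (\<lambda>y. ?i y *\<^sub>R norm (f y))"
    unfolding sqint_def real_norm_def power2_abs e2 using m integrable_cball[OF nc(2)] by auto
  have l1: "(l2norm lborel ?i)\<^sup>2 = ball_area h"
    unfolding l2norm_sq real_norm_def power2_abs e1 using ball_area_eq[OF h, of p] by simp
  have l2: "(l2norm lborel (\<lambda>y. ?i y *\<^sub>R norm (f y)))\<^sup>2 = (LINT y|lborel. ?i y *\<^sub>R (norm (f y))\<^sup>2)"
    unfolding l2norm_sq real_norm_def power2_abs e2 ..
  have "norm (ball_integral h p f) \<le> (LINT y|lborel. norm (?i y *\<^sub>R f y))"
    unfolding ball_integral_def by (rule integral_norm_bound)
  also have "\<dots> = (LINT y|lborel. ?i y \<bullet> (?i y *\<^sub>R norm (f y)))" unfolding e3 by simp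
  also have "\<dots> \<le> l2norm lborel ?i * l2norm lborel (\<lambda>y. ?i y *\<^sub>R norm (f y))"
    using l2norm_Cauchy_Schwarz[OF s1 s2] by linarith
  finally have "(norm (ball_integral h p f))\<^sup>2 \<le> (l2norm lborel ?i * l2norm lborel (\<lambda>y. ?i y *\<^sub>R norm (f y)))\<^sup>2"
    by (rule power_mono) simp
  then show ?thesis unfolding power_mult_distrib l1 l2 .
qed

text \<open>Near a net point \<open>p\<close> the value \<open>\<phi>(x)\<close> is compared with the mean of \<open>\<phi>\<close> over the disc around
  \<open>p\<close>; the error is an average of translates \<open>\<phi>(x + z) - \<phi>(x)\<close> with \<open>|z| \<le> 2h\<close>, controlled by
  the gradient. So finitely many means determine \<open>\<phi>\<close> up to an error of order \<open>h\<close>.\<close>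

lemma finite_means_bound:
  assumes \<Omega>: "open \<Omega>" "bounded \<Omega>" and h: "0 < h" and P: "finite P" "\<And>x. x \<in> \<Omega> \<Longrightarrow> \<exists>p\<in>P. dist x p \<le> h"
    and \<phi>: "\<phi> \<in> test_functions \<Omega>"
  shows "(l2norm (lebesgue_on \<Omega>) \<phi>)\<^sup>2 \<le>
     2 * measure lborel \<Omega> / (ball_area h)\<^sup>2 * (\<Sum>p\<in>P. (norm (ball_integral h p \<phi>))\<^sup>2) +
     32 * h\<^sup>2 * (l2norm (lebesgue_on \<Omega>) (mgrad (\<lambda>_. 0) \<phi>))\<^sup>2"
proof -
  let ?V = "ball_area h" and ?g = "mgrad (\<lambda>_. 0) \<phi>"
  have V: "0 < ?V" by (rule ball_area_pos[OF h])
  have \<phi>U: "\<phi> \<in> test_functions UNIV" by (rule test_mono[OF _ \<phi>]) simp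
  have \<phi>c: "continuous_on UNIV \<phi>" by (rule test_continuous[OF \<phi>])
  have gc: "continuous_on UNIV ?g" by (rule mgrad_continuous[OF \<Omega>(1) smooth_pot_zero[OF \<Omega>(1)] \<phi>])
  obtain S where S: "compact S" "S \<subseteq> \<Omega>" "\<And>x. x \<notin> S \<Longrightarrow> ?g x = 0" "\<And>x. x \<notin> S \<Longrightarrow> \<phi> x = 0"
    using mgrad_supportE[OF \<Omega>(1) smooth_pot_zero[OF \<Omega>(1)] \<phi>] by metis
  have norms: "(\<integral>\<^sup>+x. ennreal ((norm (f x))\<^sup>2) \<partial>lborel) = ennreal ((l2norm (lebesgue_on \<Omega>) f)\<^sup>2)"
    if "continuous_on UNIV f" "\<And>x. x \<notin> S \<Longrightarrow> f x = 0" for f :: "real^2 \<Rightarrow> 'd::euclidean_space"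
  proof -
    have c: "continuous_on UNIV (\<lambda>x. (norm (f x))\<^sup>2)" by (intro continuous_intros that)
    have "(l2norm (lebesgue_on \<Omega>) f)\<^sup>2 = (LINT x|lborel. (norm (f x))\<^sup>2)"
      unfolding l2norm_sq by (rule compact_support_lebesgue_on(2)[OF c S(1,2) _ \<Omega>(1)]) (use that in simp)
    moreover have "(\<integral>\<^sup>+x. ennreal ((norm (f x))\<^sup>2) \<partial>lborel) = ennreal (LINT x|lborel. (norm (f x))\<^sup>2)"
      by (rule nn_integral_eq_integral[OF compact_support_integrable[OF c S(1)]]) (use that in auto)
    ultimately show ?thesis by simp
  qed
  define L where "L = (\<Sum>p\<in>P. (norm (ball_integral h p \<phi>))\<^sup>2)"
  have L0: "0 \<le> L" unfolding L_def by (intro sum_nonneg) simp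
  define J where "J x = (\<integral>\<^sup>+z. indicator (cball 0 (2*h)) z * ennreal ((norm (\<phi> (x + z) - \<phi> x))\<^sup>2) \<partial>lborel)" for x
  have pt: "ennreal (?V\<^sup>2 * (norm (\<phi> x))\<^sup>2) \<le> ennreal (2 * L) * indicator \<Omega> x + ennreal (2 * ?V) * J x" for x
  proof (cases "x \<in> \<Omega>")
    case False
    then have "\<phi> x = 0" using S by blast
    then show ?thesis by simp
  next
    case True
    then obtain p where p: "p \<in> P" "dist x p \<le> h" using P by blast
    let ?d = "\<lambda>y. \<phi> x - \<phi> y"
    have dc: "continuous_on UNIV ?d" by (intro continuous_intros \<phi>c)
    have dc2: "continuous_on UNIV (\<lambda>y. (norm (?d y))\<^sup>2)" by (intro continuous_intros \<phi>c)
    have "ball_integral h p \<phi> + ball_integral h p ?d = (LINT y|lborel. indicator (cball p h) y *\<^sub>R \<phi> y + indicator (cball p h) y *\<^sub>R ?d y)"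
      unfolding ball_integral_def
      by (rule Bochner_Integration.integral_add[symmetric]) (intro integrable_cball \<phi>c dc)+
    also have "\<dots> = (LINT y|lborel. indicator (cball p h) y *\<^sub>R \<phi> x)"
      by (rule Bochner_Integration.integral_cong) (auto simp: indicator_def)
    also have "\<dots> = (LINT y|lborel. indicator (cball p h) y) *\<^sub>R \<phi> x"
      by (rule integral_scaleR_left) (use integrable_cball[of "\<lambda>_. 1::real"] in simp)
    also have "\<dots> = ?V *\<^sub>R \<phi> x" using ball_area_eq[of h p] h by simp
    finally have "?V *\<^sub>R \<phi> x = ball_integral h p \<phi> + ball_integral h p ?d" by simp
    then have "(norm (?V *\<^sub>R \<phi> x))\<^sup>2 \<le> (norm (ball_integral h p \<phi>) + norm (ball_integral h p ?d))\<^sup>2"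
      by (simp add: power_mono norm_triangle_ineq)
    also have "\<dots> \<le> 2 * (norm (ball_integral h p \<phi>))\<^sup>2 + 2 * (norm (ball_integral h p ?d))\<^sup>2"
      using sum_squares_bound[of "norm (ball_integral h p \<phi>)" "norm (ball_integral h p ?d)"] by (simp add: power2_sum)
    also have "\<dots> \<le> 2 * L + 2 * (?V * (LINT y|lborel. indicator (cball p h) y *\<^sub>R (norm (?d y))\<^sup>2))"
    proof (intro add_mono mult_left_mono)
      show "(norm (ball_integral h p \<phi>))\<^sup>2 \<le> L" unfolding L_def using p(1) P(1) by (intro member_le_sum) auto
      show "(norm (ball_integral h p ?d))\<^sup>2 \<le> ?V * (LINT y|lborel. indicator (cball p h) y *\<^sub>R (norm (?d y))\<^sup>2)"
        by (rule ball_integral_sq_le[OF dc]) (use h in simp)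
    qed auto
    finally have le: "?V\<^sup>2 * (norm (\<phi> x))\<^sup>2 \<le> 2 * L + 2 * ?V * (LINT y|lborel. indicator (cball p h) y *\<^sub>R (norm (?d y))\<^sup>2)"
      by (simp add: power_mult_distrib)
    have "ennreal (LINT y|lborel. indicator (cball p h) y *\<^sub>R (norm (?d y))\<^sup>2)
        = (\<integral>\<^sup>+y. ennreal (indicator (cball p h) y *\<^sub>R (norm (?d y))\<^sup>2) \<partial>lborel)"
      by (rule nn_integral_eq_integral[symmetric, OF integrable_cball[OF dc2]]) auto
    also have "\<dots> \<le> (\<integral>\<^sup>+y. indicator (cball 0 (2*h)) (y - x) * ennreal ((norm (\<phi> y - \<phi> x))\<^sup>2) \<partial>lborel)"
    proof (rule nn_integral_mono)
      fix y
      show "ennreal (indicator (cball p h) y *\<^sub>R (norm (?d y))\<^sup>2) \<le> indicator (cball 0 (2*h)) (y - x) * ennreal ((norm (\<phi> y - \<phi> x))\<^sup>2)"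
      proof (cases "y \<in> cball p h")
        case True
        have "dist y x \<le> 2 * h" using True p(2) dist_triangle[of y x p] by (simp add: dist_commute)
        then have "y - x \<in> cball 0 (2*h)" unfolding mem_cball_0 dist_norm .
        then show ?thesis
          using True by (simp only: indicator_simps norm_minus_commute[of "\<phi> x"] scaleR_one mult_1)
      qed simp
    qed
    also have "\<dots> = J x"
    proof -
      have m: "(\<lambda>y. indicator (cball 0 (2*h)) (y - x) * ennreal ((norm (\<phi> y - \<phi> x))\<^sup>2)) \<in> borel_measurable borel"
      proof (rule borel_measurable_times_ennreal)
        show "(\<lambda>y. indicator (cball 0 (2*h)) (y - x) :: ennreal) \<in> borel_measurable borel"
          by (rule measurable_compose[of "\<lambda>y. y - x" borel borel, OF _ borel_measurable_indicator]) simp_all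
        have "(\<lambda>y. (norm (\<phi> y - \<phi> x))\<^sup>2) \<in> borel_measurable borel"
          by (intro borel_measurable_continuous_onI continuous_intros \<phi>c)
        then show "(\<lambda>y. ennreal ((norm (\<phi> y - \<phi> x))\<^sup>2)) \<in> borel_measurable borel" by simp
      qed
      show ?thesis using nn_integral_translation[OF m, of x] by (simp add: J_def add.commute)
    qed
    finally have Jx: "ennreal (LINT y|lborel. indicator (cball p h) y *\<^sub>R (norm (?d y))\<^sup>2) \<le> J x" .
    have i0: "0 \<le> (LINT y|lborel. indicator (cball p h) y *\<^sub>R (norm (?d y))\<^sup>2)" by (intro integral_nonneg_AE) auto
    have "ennreal (?V\<^sup>2 * (norm (\<phi> x))\<^sup>2) \<le> ennreal (2 * L) + ennreal (2 * ?V) * ennreal (LINT y|lborel. indicator (cball p h) y *\<^sub>R (norm (?d y))\<^sup>2)"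
      using ennreal_leI[OF le] L0 V i0 by (simp add: ennreal_plus ennreal_mult')
    also have "\<dots> \<le> ennreal (2 * L) + ennreal (2 * ?V) * J x"
      by (intro add_left_mono mult_left_mono Jx) simp
    finally show ?thesis using True by simp
  qed
  have meas: "(\<lambda>p. indicator (cball 0 (2*h)) (snd p) * ennreal ((norm (\<phi> (fst p + snd p) - \<phi> (fst p)))\<^sup>2))
      \<in> borel_measurable ((lborel :: (real^2) measure) \<Otimes>\<^sub>M (lborel :: (real^2) measure))"
  proof (rule borel_measurable_times_ennreal)
    show "(\<lambda>p. indicator (cball 0 (2*h)) (snd p) :: ennreal) \<in> borel_measurable ((lborel :: (real^2) measure) \<Otimes>\<^sub>M (lborel :: (real^2) measure))"
      by (rule measurable_compose[OF measurable_snd borel_measurable_indicator]) simp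
    have c: "continuous_on UNIV (\<lambda>p. (norm (\<phi> (fst p + snd p) - \<phi> (fst p)))\<^sup>2)"
      by (intro continuous_intros continuous_on_compose2[OF \<phi>c]) auto
    have "(\<lambda>p. (norm (\<phi> (fst p + snd p) - \<phi> (fst p)))\<^sup>2) \<in> borel_measurable (borel \<Otimes>\<^sub>M borel)"
      unfolding borel_prod by (rule borel_measurable_continuous_onI[OF c])
    then have "(\<lambda>p. (norm (\<phi> (fst p + snd p) - \<phi> (fst p)))\<^sup>2) \<in> borel_measurable (lborel \<Otimes>\<^sub>M lborel)"
      by (simp cong: measurable_cong_sets sets_pair_measure_cong)
    then show "(\<lambda>p. ennreal ((norm (\<phi> (fst p + snd p) - \<phi> (fst p)))\<^sup>2)) \<in> borel_measurable (lborel \<Otimes>\<^sub>M lborel)"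
      by simp
  qed
  have Jm: "J \<in> borel_measurable lborel"
    unfolding J_def using lborel.borel_measurable_nn_integral[of "\<lambda>x z. indicator (cball 0 (2*h)) z * ennreal ((norm (\<phi> (x + z) - \<phi> x))\<^sup>2)" lborel] meas
    by (simp add: case_prod_beta)
  define G where "G = (l2norm (lebesgue_on \<Omega>) ?g)\<^sup>2"
  have "(\<integral>\<^sup>+x. J x \<partial>lborel) = (\<integral>\<^sup>+z. (\<integral>\<^sup>+x. indicator (cball 0 (2*h)) z * ennreal ((norm (\<phi> (x + z) - \<phi> x))\<^sup>2) \<partial>lborel) \<partial>lborel)"
    unfolding J_def by (rule lborel_pair.Fubini'[symmetric]) (use meas in \<open>simp add: case_prod_beta\<close>)
  also have "\<dots> \<le> (\<integral>\<^sup>+z. ennreal ((2*h)\<^sup>2 * G) * indicator (cball 0 (2*h)) z \<partial>(lborel :: (real^2) measure))"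
  proof (rule nn_integral_mono)
    fix z :: "real^2"
    have \<phi>m [measurable]: "\<phi> \<in> borel_measurable borel" by (rule borel_measurable_continuous_onI[OF \<phi>c])
    have "(\<integral>\<^sup>+x. ennreal ((norm (\<phi> (x + z) - \<phi> x))\<^sup>2) \<partial>lborel) \<le> ennreal ((norm z)\<^sup>2) * ennreal G"
      using translation_bound[OF \<phi>U, of z] norms[OF gc S(3)] by (simp add: G_def)
    also have "\<dots> \<le> ennreal ((2*h)\<^sup>2 * G)" if "z \<in> cball 0 (2*h)"
    proof -
      have "(norm z)\<^sup>2 \<le> (2*h)\<^sup>2" using that by (intro power_mono) auto
      then show ?thesis by (simp add: G_def ennreal_leI mult_right_mono flip: ennreal_mult')
    qed
    finally show "(\<integral>\<^sup>+x. indicator (cball 0 (2*h)) z * ennreal ((norm (\<phi> (x + z) - \<phi> x))\<^sup>2) \<partial>lborel) \<le> ennreal ((2*h)\<^sup>2 * G) * indicator (cball 0 (2*h)) z"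
      by (cases "z \<in> cball 0 (2*h)") auto
  qed
  also have "\<dots> = ennreal ((2*h)\<^sup>2 * G) * ennreal (4 * ?V)"
  proof -
    have "emeasure lborel (cball (0::real^2) (2*h)) = ennreal (4 * ?V)"
      using ball_area_double[of h] h emeasure_bounded_finite[of "cball (0::real^2) (2*h)"]
      by (simp add: emeasure_eq_ennreal_measure ball_area_def)
    then show ?thesis by (subst nn_integral_cmult_indicator) simp_all
  qed
  also have "\<dots> = ennreal (16 * h\<^sup>2 * ?V * G)"
    using V by (simp add: G_def power_mult_distrib algebra_simps flip: ennreal_mult')
  finally have Jint: "(\<integral>\<^sup>+x. J x \<partial>lborel) \<le> ennreal (16 * h\<^sup>2 * ?V * G)" .
  have \<Omega>m: "emeasure lborel \<Omega> = ennreal (measure lborel \<Omega>)"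
    using emeasure_bounded_finite[OF \<Omega>(2)] by (simp add: emeasure_eq_ennreal_measure)
  have \<phi>m [measurable]: "\<phi> \<in> borel_measurable borel" by (rule borel_measurable_continuous_onI[OF \<phi>c])
  have "ennreal (?V\<^sup>2 * (l2norm (lebesgue_on \<Omega>) \<phi>)\<^sup>2) = (\<integral>\<^sup>+x. ennreal (?V\<^sup>2 * (norm (\<phi> x))\<^sup>2) \<partial>lborel)"
    using norms[OF \<phi>c S(4)] by (simp add: ennreal_mult' nn_integral_cmult)
  also have "\<dots> \<le> (\<integral>\<^sup>+x. ennreal (2 * L) * indicator \<Omega> x + ennreal (2 * ?V) * J x \<partial>lborel)"
    by (intro nn_integral_mono pt)
  also have "\<dots> = ennreal (2 * L) * emeasure lborel \<Omega> + ennreal (2 * ?V) * (\<integral>\<^sup>+x. J x \<partial>lborel)"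
    using Jm \<Omega>(1) by (simp add: nn_integral_add nn_integral_cmult)
  also have "\<dots> \<le> ennreal (2 * L) * ennreal (measure lborel \<Omega>) + ennreal (2 * ?V) * ennreal (16 * h\<^sup>2 * ?V * G)"
    unfolding \<Omega>m by (intro add_left_mono mult_left_mono Jint) simp
  also have "\<dots> = ennreal (2 * L * measure lborel \<Omega> + 2 * ?V * (16 * h\<^sup>2 * ?V * G))"
    using L0 V by (simp add: G_def flip: ennreal_mult' ennreal_plus)
  finally have "?V\<^sup>2 * (l2norm (lebesgue_on \<Omega>) \<phi>)\<^sup>2 \<le> 2 * L * measure lborel \<Omega> + 2 * ?V * (16 * h\<^sup>2 * ?V * G)"
    using L0 V by (subst (asm) ennreal_le_iff) (auto simp: G_def)
  then have "(l2norm (lebesgue_on \<Omega>) \<phi>)\<^sup>2 \<le> 2 * measure lborel \<Omega> / ?V\<^sup>2 * L + 32 * h\<^sup>2 * G"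
    using V by (simp add: field_simps power2_eq_square)
  then show ?thesis unfolding L_def G_def .
qed

lemma ball_integral_bound:
  assumes \<Omega>: "open \<Omega>" and \<phi>: "\<phi> \<in> test_functions \<Omega>" and h: "0 \<le> h"
  shows "(norm (ball_integral h p \<phi>))\<^sup>2 \<le> ball_area h * (l2norm (lebesgue_on \<Omega>) \<phi>)\<^sup>2"
proof -
  obtain S where S: "compact S" "S \<subseteq> \<Omega>" "\<And>x. x \<notin> S \<Longrightarrow> \<phi> x = 0" using test_supportE[OF \<phi>] by blast
  have c: "continuous_on UNIV (\<lambda>x. (norm (\<phi> x))\<^sup>2)" by (intro continuous_intros test_continuous[OF \<phi>])
  have "(LINT y|lborel. indicator (cball p h) y *\<^sub>R (norm (\<phi> y))\<^sup>2) \<le> (LINT y|lborel. (norm (\<phi> y))\<^sup>2)"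
    by (intro integral_mono integrable_cball c compact_support_integrable[OF c S(1)])
       (auto simp: S(3) indicator_def)
  also have "\<dots> = (l2norm (lebesgue_on \<Omega>) \<phi>)\<^sup>2"
    unfolding l2norm_sq by (rule compact_support_lebesgue_on(2)[OF c S(1,2) _ \<Omega>, symmetric]) (simp add: S(3))
  finally have "(LINT y|lborel. indicator (cball p h) y *\<^sub>R (norm (\<phi> y))\<^sup>2) \<le> (l2norm (lebesgue_on \<Omega>) \<phi>)\<^sup>2" .
  moreover have "0 \<le> ball_area h" by (simp add: ball_area_def)
  ultimately show ?thesis
    using ball_integral_sq_le[OF test_continuous[OF \<phi>] h, of p] mult_left_mono by fastforce
qed

lemma ball_integral_diff:
  assumes "continuous_on UNIV f" "continuous_on UNIV g"
  shows "ball_integral h p (\<lambda>x. f x + (-1) * g x) = ball_integral h p f - ball_integral h p g"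
proof -
  have "ball_integral h p (\<lambda>x. f x + (-1) * g x)
      = (LINT y|lborel. indicator (cball p h) y *\<^sub>R f y - indicator (cball p h) y *\<^sub>R g y)"
    unfolding ball_integral_def by (simp add: scaleR_diff_right)
  also have "\<dots> = ball_integral h p f - ball_integral h p g"
    unfolding ball_integral_def
    by (rule Bochner_Integration.integral_diff) (intro integrable_cball assms)+
  finally show ?thesis .
qed

text \<open>For each radius \<open>1/(r + 1)\<close> finitely many means matter, so there are countably many in all and a
  subsequence makes each of them converge. Then the differences of test functions in the subsequence
  are small in mean, and by the preceding bound small in \<open>L\<^sup>2\<close>.\<close>

lemma rellich_test:
  fixes \<phi> :: "nat \<Rightarrow> real^2 \<Rightarrow> complex"
  assumes \<Omega>: "open \<Omega>" "bounded \<Omega>" and \<phi>: "\<And>n. \<phi> n \<in> test_functions \<Omega>"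
    and B: "\<And>n. l2norm (lebesgue_on \<Omega>) (\<phi> n) \<le> B" "\<And>n. l2norm (lebesgue_on \<Omega>) (mgrad (\<lambda>_. 0) (\<phi> n)) \<le> B"
  shows "\<exists>s :: nat \<Rightarrow> nat. strict_mono s \<and>
    (\<forall>e>0. \<exists>N. \<forall>m\<ge>N. \<forall>n\<ge>N. l2norm (lebesgue_on \<Omega>) (\<lambda>x. \<phi> (s m) x - \<phi> (s n) x) < e)"
proof -
  let ?M = "lebesgue_on \<Omega>"
  define h where "h r = 1 / real (Suc r)" for r :: nat
  have h: "0 < h r" "h r \<le> 1" for r by (auto simp: h_def)
  have B0: "0 \<le> B" using B(1)[of 0] l2norm_nonneg by (rule order_trans[rotated])
  have "\<exists>P. finite P \<and> (\<forall>x\<in>\<Omega>. \<exists>p\<in>P. dist x p \<le> h r)" for r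
  proof -
    obtain P where P: "finite P" "closure \<Omega> \<subseteq> (\<Union>p\<in>P. ball p (h r))"
      using compact_eq_totally_bounded[of "closure \<Omega>"] \<Omega>(2) h(1)[of r] compact_closure[of \<Omega>] by blast
    have "\<exists>p\<in>P. dist x p \<le> h r" if "x \<in> \<Omega>" for x
    proof -
      obtain p where p: "p \<in> P" "x \<in> ball p (h r)" using P(2) closure_subset[of \<Omega>] \<open>x \<in> \<Omega>\<close> by blast
      then have "dist x p \<le> h r" by (simp add: dist_commute[of x p])
      with p(1) show ?thesis by blast
    qed
    then show ?thesis using P(1) by blast
  qed
  then obtain P where P: "\<And>r. finite (P r)" "\<And>r x. x \<in> \<Omega> \<Longrightarrow> \<exists>p\<in>P r. dist x p \<le> h r" by metis
  define I where "I = (SIGMA r:UNIV. P r)"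
  have cI: "countable I" unfolding I_def by (intro countable_SIGMA countable_finite P(1) countableI_type)
  define f where "f n i = ball_integral (h (fst i)) (snd i) (\<phi> n)" for n i
  have "norm (f n i) \<le> sqrt (ball_area 1) * B" for n i
  proof -
    have "(norm (f n i))\<^sup>2 \<le> ball_area (h (fst i)) * (l2norm ?M (\<phi> n))\<^sup>2"
      unfolding f_def by (rule ball_integral_bound[OF \<Omega>(1) \<phi> less_imp_le[OF h(1)]])
    also have "\<dots> \<le> ball_area 1 * B\<^sup>2"
      by (intro mult_mono ball_area_mono power_mono B less_imp_le[OF h(1)] h(2)) (auto simp: ball_area_def)
    also have "\<dots> = (sqrt (ball_area 1) * B)\<^sup>2" by (simp add: power_mult_distrib ball_area_def)
    finally show ?thesis by (rule power2_le_imp_le) (use B0 in \<open>simp add: ball_area_def\<close>)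
  qed
  then obtain s where s: "strict_mono s" "\<And>i. i \<in> I \<Longrightarrow> \<exists>l. (\<lambda>n. f (s n) i) \<longlonglongrightarrow> l"
    using function_convergent_subsequence[OF cI, of f] by blast
  show ?thesis
  proof (intro exI[of _ s] conjI s(1) allI impI)
    fix e :: real assume e: "0 < e"
    \<comment> \<open>differences of test functions have gradient norm at most \<open>2B\<close>\<close>
    obtain r where r: "128 * B\<^sup>2 * h r < e\<^sup>2 / 2"
    proof -
      obtain r :: nat where "256 * B\<^sup>2 / e\<^sup>2 < real r" using reals_Archimedean2 by blast
      then have "256 * B\<^sup>2 / e\<^sup>2 < real (Suc r)" by simp
      then have "128 * B\<^sup>2 * h r < e\<^sup>2 / 2" using e by (simp add: h_def field_simps)
      then show ?thesis by (rule that)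
    qed
    define K where "K = 2 * measure lborel \<Omega> / (ball_area (h r))\<^sup>2"
    have K: "0 \<le> K" by (simp add: K_def)
    define a where "a n p = ball_integral (h r) p (\<phi> (s n))" for n p
    have "Cauchy (\<lambda>n. a n p)" if "p \<in> P r" for p
    proof -
      have "(r, p) \<in> I" using that by (simp add: I_def)
      from s(2)[OF this] show ?thesis by (auto simp: f_def a_def dest: LIMSEQ_imp_Cauchy)
    qed
    moreover define d where "d = e / (2 * sqrt (K + 1) * sqrt (real (card (P r)) + 1))"
    moreover have d: "0 < d" using e K by (simp add: d_def)
    ultimately have "\<forall>p\<in>P r. \<exists>N. \<forall>m\<ge>N. \<forall>n\<ge>N. norm (a m p - a n p) < d"
      by (auto simp: Cauchy_iff)
    then obtain N where N: "\<And>p m n. p \<in> P r \<Longrightarrow> N p \<le> m \<Longrightarrow> N p \<le> n \<Longrightarrow> norm (a m p - a n p) < d" by metis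
    define N0 where "N0 = Max (insert 0 (N ` P r))"
    have N0: "N p \<le> N0" if "p \<in> P r" for p unfolding N0_def using P(1) that by (intro Max_ge) auto
    show "\<exists>N. \<forall>m\<ge>N. \<forall>n\<ge>N. l2norm ?M (\<lambda>x. \<phi> (s m) x - \<phi> (s n) x) < e"
    proof (intro exI[of _ N0] allI impI)
      fix m n assume mn: "N0 \<le> m" "N0 \<le> n"
      let ?\<psi> = "\<lambda>x. \<phi> (s m) x + (-1) * \<phi> (s n) x"
      have \<psi>: "?\<psi> \<in> test_functions \<Omega>" by (intro test_add test_cmult \<phi>)
      have sg: "sqint ?M (mgrad (\<lambda>_. 0) (\<phi> n))" for n
        by (rule mgrad_sqint[OF \<Omega>(1) smooth_pot_zero[OF \<Omega>(1)] \<phi>])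
      have "l2norm ?M (mgrad (\<lambda>_. 0) ?\<psi>) = l2norm ?M (\<lambda>x. mgrad (\<lambda>_. 0) (\<phi> (s m)) x + (-1) *s mgrad (\<lambda>_. 0) (\<phi> (s n)) x)"
        by (intro arg_cong[where f="l2norm ?M"] ext mgrad_lin[OF \<phi> \<phi>])
      also have "\<dots> \<le> B + B"
        by (rule order_trans[OF l2norm_triangle[OF sg sqint_smult[OF sg]]], unfold l2norm_smult)
           (use B(2)[of "s m"] B(2)[of "s n"] in simp)
      finally have "(l2norm ?M (mgrad (\<lambda>_. 0) ?\<psi>))\<^sup>2 \<le> (B + B)\<^sup>2" by (rule power_mono) simp
      then have g: "32 * (h r)\<^sup>2 * (l2norm ?M (mgrad (\<lambda>_. 0) ?\<psi>))\<^sup>2 \<le> 128 * B\<^sup>2 * h r"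
      proof -
        have "(h r)\<^sup>2 \<le> h r" using h[of r] by (simp add: power2_eq_square mult_left_le)
        then have "32 * (h r)\<^sup>2 * (l2norm ?M (mgrad (\<lambda>_. 0) ?\<psi>))\<^sup>2 \<le> 32 * h r * (B + B)\<^sup>2"
          using \<open>_ \<le> (B + B)\<^sup>2\<close> h(1)[of r] by (intro mult_mono) auto
        then show ?thesis by (simp add: power2_eq_square algebra_simps)
      qed
      have "(\<Sum>p\<in>P r. (norm (ball_integral (h r) p ?\<psi>))\<^sup>2) \<le> (\<Sum>p\<in>P r. d\<^sup>2)"
      proof (intro sum_mono power_mono)
        fix p assume p: "p \<in> P r"
        have "ball_integral (h r) p ?\<psi> = a m p - a n p"
          unfolding a_def by (intro ball_integral_diff test_continuous[OF \<phi>])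
        then show "norm (ball_integral (h r) p ?\<psi>) \<le> d"
          using N[OF p, of m n] N0[OF p] mn by simp
      qed simp
      then have "K * (\<Sum>p\<in>P r. (norm (ball_integral (h r) p ?\<psi>))\<^sup>2) \<le> K * (real (card (P r)) * d\<^sup>2)"
        by (intro mult_left_mono K) simp
      also have "\<dots> \<le> (K + 1) * ((real (card (P r)) + 1) * d\<^sup>2)"
        using K by (intro mult_mono) auto
      also have "\<dots> = e\<^sup>2 / 4"
      proof -
        define k c where "k = K + 1" and "c = real (card (P r)) + 1"
        have "0 < k" "0 < c" using K by (auto simp: k_def c_def)
        then have "k * (c * (e / (2 * sqrt k * sqrt c))\<^sup>2) = e\<^sup>2 / 4"
          by (simp add: power_divide power_mult_distrib)
        then show ?thesis by (simp only: d_def k_def c_def)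
      qed
      finally have s1: "K * (\<Sum>p\<in>P r. (norm (ball_integral (h r) p ?\<psi>))\<^sup>2) \<le> e\<^sup>2 / 4" .
      have "(l2norm ?M ?\<psi>)\<^sup>2 \<le> K * (\<Sum>p\<in>P r. (norm (ball_integral (h r) p ?\<psi>))\<^sup>2) +
          32 * (h r)\<^sup>2 * (l2norm ?M (mgrad (\<lambda>_. 0) ?\<psi>))\<^sup>2"
        unfolding K_def by (rule finite_means_bound[OF \<Omega> h(1) P \<psi>])
      also have "\<dots> < e\<^sup>2"
      proof -
        have "0 < e\<^sup>2" using e by simp
        then show ?thesis using s1 g r by linarith
      qed
      finally have "l2norm ?M ?\<psi> < e" using e by (simp add: power2_less_imp_less)
      then show "l2norm ?M (\<lambda>x. \<phi> (s m) x - \<phi> (s n) x) < e" by simp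
    qed
  qed
qed

lemma fminus_eq: "fminus u v = (\<lambda>x. u x - v x)"
  by (simp add: fminus_def)

lemma compact_forms_dirichlet:
  assumes \<Omega>: "open \<Omega>" "bounded \<Omega>" "\<Omega> \<noteq> {}"
  shows "compact_forms (form_domain (\<lambda>_. 0) \<Omega>) (cip (lebesgue_on \<Omega>)) (energy (\<lambda>_. 0) \<Omega>)"
proof -
  let ?M = "lebesgue_on \<Omega>" and ?D = "form_domain (\<lambda>_. 0) \<Omega>" and ?g = "mgrad_ext (\<lambda>_. 0) \<Omega>"
  note A = smooth_pot_zero[OF \<Omega>(1)]
  interpret F: two_forms ?D "cip ?M" "energy (\<lambda>_. 0) \<Omega>" by (rule two_forms_magnetic[OF \<Omega>(1) A])
  have Iq: "F.I.q u = (l2norm ?M u)\<^sup>2" for u by (rule ip_q[OF \<Omega>(1) A])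
  have Eq: "F.E.q u = (l2norm ?M G)\<^sup>2" if "form_limit (\<lambda>_. 0) \<Omega> u G" for u G
    unfolding energy_q[OF \<Omega>(1) A] by (rule form_norm_sq_eq[OF \<Omega>(1) A that])
  note lim = mgrad_ext_limit[of _ "\<lambda>_. 0" \<Omega>]
  have sq: "sqint ?M u" "sqint ?M (?g u)" if "u \<in> ?D" for u
    using form_limit_sqint[OF lim[OF that]] by auto
  have Ediff: "F.E.q (fminus u v) = (l2norm ?M (\<lambda>x. ?g u x - G x))\<^sup>2"
    if "u \<in> ?D" "form_limit (\<lambda>_. 0) \<Omega> v G" for u v G
  proof -
    have "form_limit (\<lambda>_. 0) \<Omega> (fminus u v) (\<lambda>x. ?g u x + (-1) *s G x)"
      unfolding fminus_def by (rule form_limit_lin[OF \<Omega>(1) A lim[OF that(1)] that(2)])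
    moreover have "?g u x + (-1) *s G x = ?g u x - G x" for x by (simp add: vec_eq_iff)
    ultimately show ?thesis by (simp add: Eq)
  qed
  show ?thesis
  proof
    fix v :: "nat \<Rightarrow> real^2 \<Rightarrow> complex" and C
    assume v: "\<And>n. v n \<in> ?D" and CI: "\<And>n. F.I.q (v n) \<le> C" and CE: "\<And>n. F.E.q (v n) \<le> C"
    have ex: "\<exists>\<phi>. \<phi> \<in> test_functions \<Omega> \<and> l2norm ?M (\<lambda>x. \<phi> x - v n x) < 1 / real (Suc n) \<and>
      l2norm ?M (\<lambda>x. mgrad (\<lambda>_. 0) \<phi> x - ?g (v n) x) < 1 / real (Suc n)" for n
      by (rule form_limit_approx[OF lim[OF v[of n]], of "1 / real (Suc n)"], simp) blast
    define \<phi> where "\<phi> n = (SOME \<phi>. \<phi> \<in> test_functions \<Omega> \<and> l2norm ?M (\<lambda>x. \<phi> x - v n x) < 1 / real (Suc n) \<and>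
      l2norm ?M (\<lambda>x. mgrad (\<lambda>_. 0) \<phi> x - ?g (v n) x) < 1 / real (Suc n))" for n
    have \<phi>: "\<phi> n \<in> test_functions \<Omega>"
      "l2norm ?M (\<lambda>x. \<phi> n x - v n x) < 1 / real (Suc n)"
      "l2norm ?M (\<lambda>x. mgrad (\<lambda>_. 0) (\<phi> n) x - ?g (v n) x) < 1 / real (Suc n)" for n
      using someI_ex[OF ex[of n]] unfolding \<phi>_def by blast+
    have s\<phi>: "sqint ?M (\<phi> n)" "sqint ?M (mgrad (\<lambda>_. 0) (\<phi> n))" for n
      using test_sqint[OF \<Omega>(1) \<phi>(1)] mgrad_sqint[OF \<Omega>(1) A \<phi>(1)] by auto
    have one: "1 / real (Suc n) \<le> 1" for n by simp
    have "l2norm ?M (v n) \<le> sqrt C" "l2norm ?M (?g (v n)) \<le> sqrt C" for n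
      using CI[of n] CE[of n] Eq[OF lim[OF v[of n]]] by (auto simp: Iq real_le_rsqrt)
    then have "l2norm ?M (\<phi> n) \<le> sqrt C + 1" "l2norm ?M (mgrad (\<lambda>_. 0) (\<phi> n)) \<le> sqrt C + 1" for n
      using l2norm_diff_le[OF s\<phi>(1) sq(1)[OF v[of n]], of n] l2norm_diff_le[OF s\<phi>(2) sq(2)[OF v[of n]], of n]
        \<phi>(2,3)[of n] one[of n] by (smt (verit))+
    then have "\<exists>s :: nat \<Rightarrow> nat. strict_mono s \<and>
      (\<forall>e>0. \<exists>N. \<forall>m\<ge>N. \<forall>n\<ge>N. l2norm ?M (\<lambda>x. \<phi> (s m) x - \<phi> (s n) x) < e)"
      by (rule rellich_test[OF \<Omega>(1,2) \<phi>(1)])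
    then obtain s :: "nat \<Rightarrow> nat" where s: "strict_mono s"
      "\<And>e. 0 < e \<Longrightarrow> \<exists>N. \<forall>m\<ge>N. \<forall>n\<ge>N. l2norm ?M (\<lambda>x. \<phi> (s m) x - \<phi> (s n) x) < e"
      by blast
    show "\<exists>s. strict_mono (s :: nat \<Rightarrow> nat) \<and> (\<forall>e>0. \<exists>N. \<forall>m\<ge>N. \<forall>n\<ge>N. F.I.q (fminus (v (s m)) (v (s n))) < e)"
    proof (intro exI[of _ s] conjI s allI impI)
      fix e :: real assume "0 < e"
      then have e: "0 < sqrt e / 3" by simp
      obtain N1 where N1: "\<forall>m\<ge>N1. \<forall>n\<ge>N1. l2norm ?M (\<lambda>x. \<phi> (s m) x - \<phi> (s n) x) < sqrt e / 3" using s(2)[OF e] by blast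
      obtain N2 where N2: "1 / real (Suc N2) < sqrt e / 3" using nat_approx_posE[OF e] by blast
      show "\<exists>N. \<forall>m\<ge>N. \<forall>n\<ge>N. F.I.q (fminus (v (s m)) (v (s n))) < e"
      proof (intro exI[of _ "max N1 N2"] allI impI)
        fix m n assume mn: "max N1 N2 \<le> m" "max N1 N2 \<le> n"
        have sm: "l2norm ?M (\<lambda>x. \<phi> (s k) x - v (s k) x) < sqrt e / 3" if "N2 \<le> k" for k
        proof -
          have "N2 \<le> s k" using strict_mono_imp_increasing[OF s(1), of k] that by simp
          then have "1 / real (Suc (s k)) \<le> 1 / real (Suc N2)" by (simp add: frac_le)
          then show ?thesis using \<phi>(2)[of "s k"] N2 by linarith
        qed
        have "l2norm ?M (\<lambda>x. v (s m) x - v (s n) x) \<le> l2norm ?M (\<lambda>x. v (s m) x - \<phi> (s m) x) + l2norm ?M (\<lambda>x. \<phi> (s m) x - v (s n) x)"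
          by (rule l2norm_triangle_via[OF sq(1)[OF v] s\<phi>(1) sq(1)[OF v]])
        also have "l2norm ?M (\<lambda>x. \<phi> (s m) x - v (s n) x) \<le> l2norm ?M (\<lambda>x. \<phi> (s m) x - \<phi> (s n) x) + l2norm ?M (\<lambda>x. \<phi> (s n) x - v (s n) x)"
          by (rule l2norm_triangle_via[OF s\<phi>(1) s\<phi>(1) sq(1)[OF v]])
        finally have "l2norm ?M (\<lambda>x. v (s m) x - v (s n) x) < sqrt e"
          using N1 mn sm[of m] sm[of n] l2norm_minus_commute[of ?M "v (s m)" "\<phi> (s m)"] by fastforce
        then have "(l2norm ?M (\<lambda>x. v (s m) x - v (s n) x))\<^sup>2 < (sqrt e)\<^sup>2" by (intro power_strict_mono) auto
        then show "F.I.q (fminus (v (s m)) (v (s n))) < e" using \<open>0 < e\<close> by (simp add: Iq fminus_eq)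
      qed
    qed
  next
    fix v :: "nat \<Rightarrow> real^2 \<Rightarrow> complex"
    assume v: "\<And>n. v n \<in> ?D"
      and C: "\<And>e. 0 < e \<Longrightarrow> \<exists>N. \<forall>m\<ge>N. \<forall>n\<ge>N. F.I.q (fminus (v m) (v n)) < e \<and> F.E.q (fminus (v m) (v n)) < e"
    have C': "\<exists>N. \<forall>m\<ge>N. \<forall>n\<ge>N. l2norm ?M (\<lambda>x. v m x - v n x) < e \<and> l2norm ?M (\<lambda>x. ?g (v m) x - ?g (v n) x) < e"
      if e: "0 < e" for e
    proof -
      obtain N where N: "\<forall>m\<ge>N. \<forall>n\<ge>N. F.I.q (fminus (v m) (v n)) < e\<^sup>2 \<and> F.E.q (fminus (v m) (v n)) < e\<^sup>2"
        using C[of "e\<^sup>2"] e by auto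
      show ?thesis
      proof (intro exI[of _ N] allI impI)
        fix m n assume "N \<le> m" "N \<le> n"
        then have "F.I.q (fminus (v m) (v n)) < e\<^sup>2" "F.E.q (fminus (v m) (v n)) < e\<^sup>2" using N by auto
        then have "(l2norm ?M (\<lambda>x. v m x - v n x))\<^sup>2 < e\<^sup>2" "(l2norm ?M (\<lambda>x. ?g (v m) x - ?g (v n) x))\<^sup>2 < e\<^sup>2"
          using Ediff[OF v[of m] lim[OF v[of n]]] by (simp_all add: Iq fminus_eq)
        then show "l2norm ?M (\<lambda>x. v m x - v n x) < e \<and> l2norm ?M (\<lambda>x. ?g (v m) x - ?g (v n) x) < e"
          using e by (auto intro: power2_less_imp_less)
      qed
    qed
    have C1: "\<exists>N. \<forall>m\<ge>N. \<forall>n\<ge>N. l2norm ?M (\<lambda>x. v m x - v n x) < e" if "0 < e" for e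
      using C'[OF that] by blast
    have C2: "\<exists>N. \<forall>m\<ge>N. \<forall>n\<ge>N. l2norm ?M (\<lambda>x. ?g (v m) x - ?g (v n) x) < e" if "0 < e" for e
      using C'[OF that] by blast
    obtain u where u: "sqint ?M u" "(\<lambda>n. l2norm ?M (\<lambda>x. v n x - u x)) \<longlonglongrightarrow> 0"
      by (rule l2_complete[OF sq(1)[OF v] C1])
    obtain G where G: "sqint ?M G" "(\<lambda>n. l2norm ?M (\<lambda>x. ?g (v n) x - G x)) \<longlonglongrightarrow> 0"
      by (rule l2_complete[OF sq(2)[OF v] C2])
    have uG: "form_limit (\<lambda>_. 0) \<Omega> u G"
      by (rule form_limit_closed[OF \<Omega>(1) A lim[OF v] u(1) G(1) u(2) G(2)])
    show "\<exists>u\<in>?D. (\<lambda>n. F.I.q (fminus (v n) u)) \<longlonglongrightarrow> 0 \<and> (\<lambda>n. F.E.q (fminus (v n) u)) \<longlonglongrightarrow> 0"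
    proof (intro bexI[OF _ form_limit_domain[OF uG]] conjI)
      show "(\<lambda>n. F.I.q (fminus (v n) u)) \<longlonglongrightarrow> 0" using tendsto_power[OF u(2), of 2] by (simp add: Iq fminus_eq)
      show "(\<lambda>n. F.E.q (fminus (v n) u)) \<longlonglongrightarrow> 0" using tendsto_power[OF G(2), of 2] by (simp add: Ediff[OF v uG])
    qed
  next
    show "F.subspaces n \<noteq> {}" for n by (rule subspaces_nonempty[OF \<Omega>(1) A \<Omega>(3)])
  qed
qed

lemma dirichlet_eigenvalue_eq_minmax:
  assumes \<Omega>: "open \<Omega>" "bounded \<Omega>" "\<Omega> \<noteq> {}" and j: "1 \<le> j"
  shows "dirichlet_eigenvalue \<Omega> j =
    two_forms.minmax (form_domain (\<lambda>_. 0) \<Omega>) (cip (lebesgue_on \<Omega>)) (energy (\<lambda>_. 0) \<Omega>) j"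
proof -
  note A = smooth_pot_zero[OF \<Omega>(1)]
  interpret C: compact_forms "form_domain (\<lambda>_. 0) \<Omega>" "cip (lebesgue_on \<Omega>)" "energy (\<lambda>_. 0) \<Omega>"
    by (rule compact_forms_dirichlet[OF \<Omega>])
  have e: "dirichlet_eigenfunction \<Omega> \<mu> u \<longleftrightarrow> C.eigenpair \<mu> u" for \<mu> u
    unfolding dirichlet_eigenfunction_def C.eigenpair_def energy_def vip_def cip_def[symmetric]
    using ae_zero_iff[OF \<Omega>(1) A] by blast
  have "(\<forall>k<j. \<exists>\<mu>\<le>t. dirichlet_eigenfunction \<Omega> \<mu> (u k)) \<and> ae_independent \<Omega> j u \<longleftrightarrow>
      (\<forall>k<j. \<exists>\<mu>\<le>t. C.eigenpair \<mu> (u k)) \<and> C.indep j u" for t u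
    unfolding e using ae_independent_iff[OF \<Omega>(1) A, of j u] by (auto simp: C.eigenpair_def)
  then have "dirichlet_eigenvalue \<Omega> j = C.eigenvalue j"
    unfolding dirichlet_eigenvalue_def C.eigenvalue_def by simp
  then show ?thesis using C.eigenvalue_eq_minmax[OF j] by simp
qed

section \<open>Continuity in the pole\<close>

definition ab_minmax :: "real \<Rightarrow> (real^2) set \<Rightarrow> nat \<Rightarrow> real^2 \<Rightarrow> real" where
  "ab_minmax \<alpha> \<Omega> j a = two_forms.minmax (form_domain (AB_potential \<alpha> a) (\<Omega> - {a}))
     (cip (lebesgue_on (\<Omega> - {a}))) (energy (AB_potential \<alpha> a) (\<Omega> - {a})) j"

context
  fixes \<Omega> :: "(real^2) set" and a :: "real^2" and \<alpha> :: real
  assumes \<Omega>: "open \<Omega>"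
begin

lemma AB_open: "open (\<Omega> - {a})"
  using \<Omega> by auto

lemma AB_smooth: "smooth_pot (\<Omega> - {a}) (AB_potential \<alpha> a)"
  by (rule smooth_pot_subset[OF smooth_pot_AB]) auto

lemma AB_eigenvalue_eq_minmax: "AB_eigenvalue \<alpha> \<Omega> j a = ab_minmax \<alpha> \<Omega> j a"
  unfolding AB_eigenvalue_def ab_minmax_def by (rule rayleigh_minmax_eq[OF AB_open AB_smooth])

lemma AB_two_forms:
  "two_forms (form_domain (AB_potential \<alpha> a) (\<Omega> - {a})) (cip (lebesgue_on (\<Omega> - {a}))) (energy (AB_potential \<alpha> a) (\<Omega> - {a}))"
  by (rule two_forms_magnetic[OF AB_open AB_smooth])

lemma AB_q:
  "herm_form.q (cip (lebesgue_on (\<Omega> - {a}))) u = (l2norm (lebesgue_on \<Omega>) u)\<^sup>2"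
  unfolding ip_q[OF AB_open AB_smooth] l2norm_remove_point[OF \<Omega>] ..

lemma AB_energy_q:
  assumes "form_limit (AB_potential \<alpha> a) (\<Omega> - {a}) u F"
  shows "herm_form.q (energy (AB_potential \<alpha> a) (\<Omega> - {a})) u = (l2norm (lebesgue_on \<Omega>) F)\<^sup>2"
  unfolding energy_q[OF AB_open AB_smooth] form_norm_sq_eq[OF AB_open AB_smooth assms] l2norm_remove_point[OF \<Omega>] ..

lemma AB_subspaces_nonempty:
  assumes "\<Omega> \<noteq> {}"
  shows "two_forms.subspaces (form_domain (AB_potential \<alpha> a) (\<Omega> - {a})) (cip (lebesgue_on (\<Omega> - {a}))) j \<noteq> {}"
proof (rule subspaces_nonempty[OF AB_open AB_smooth])
  show "\<Omega> - {a} \<noteq> {}"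
  proof
    assume "\<Omega> - {a} = {}"
    then have "\<Omega> = {a}" using assms by blast
    then show False using \<Omega> not_open_singleton[of a] by simp
  qed
qed

end

lemma ab_minmax_nonneg:
  "open \<Omega> \<Longrightarrow> \<Omega> \<noteq> {} \<Longrightarrow> 1 \<le> j \<Longrightarrow> 0 \<le> ab_minmax \<alpha> \<Omega> j a"
  unfolding ab_minmax_def by (rule two_forms.minmax_nonneg[OF AB_two_forms _ AB_subspaces_nonempty])

text \<open>The parameter \<open>x\<close> bounds both losses in moving the pole: the relative growth of the gradient and,
  measured by the energy, the loss of mass. As \<open>x\<close> tends to \<open>0\<close> the bound tends to \<open>t\<close>.\<close>

lemma ab_minmax_step:
  assumes \<alpha>: "0 < \<alpha>" "\<alpha> < 1" and x: "0 < x" and \<Omega>: "open \<Omega>" "\<Omega> \<noteq> {}" and j: "1 \<le> j"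
  shows "\<exists>\<eta>>0. \<forall>a a' t. norm (a' - a) < \<eta> \<longrightarrow> ab_minmax \<alpha> \<Omega> j a < t \<longrightarrow> x * sqrt t < 1 \<longrightarrow>
      ab_minmax \<alpha> \<Omega> j a' \<le> (1 + x)\<^sup>2 * t / (1 - x * sqrt t)\<^sup>2"
proof -
  define C where "C = hardy_const \<alpha>"
  have C: "0 < C" using hardy_const_pos[OF \<alpha>] by (simp add: C_def)
  obtain \<eta> where \<eta>: "0 < \<eta>" "\<And>a a' \<Omega>. open \<Omega> \<Longrightarrow> norm (a' - a) < \<eta> \<Longrightarrow>
     \<exists>\<zeta>. \<forall>u F. form_limit (AB_potential \<alpha> a) (\<Omega> - {a}) u F \<longrightarrow>
        (\<exists>F'. form_limit (AB_potential \<alpha> a') (\<Omega> - {a'}) (\<lambda>x. \<zeta> x * u x) F' \<and>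
           l2norm (lebesgue_on \<Omega>) F' \<le> (1 + 3 * (x / (3 * C)) * C) * l2norm (lebesgue_on \<Omega>) F \<and>
           l2norm (lebesgue_on \<Omega>) u - x / C * C * l2norm (lebesgue_on \<Omega>) F
             \<le> l2norm (lebesgue_on \<Omega>) (\<lambda>x. \<zeta> x * u x))"
    unfolding C_def by (rule pole_move[OF \<alpha>, of "x / (3 * hardy_const \<alpha>)" "x / hardy_const \<alpha>"])
      (use x C in \<open>simp_all add: C_def\<close>)
  show ?thesis
  proof (intro exI[of _ \<eta>] conjI \<eta>(1) allI impI)
    fix a a' t
    assume aa: "norm (a' - a) < \<eta>" and t: "ab_minmax \<alpha> \<Omega> j a < t" and xt: "x * sqrt t < 1"
    let ?M = "lebesgue_on \<Omega>"
    have t0: "0 \<le> t" using ab_minmax_nonneg[OF \<Omega> j, of \<alpha> a] t by linarith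
    obtain \<zeta> where \<zeta>: "\<And>u F. form_limit (AB_potential \<alpha> a) (\<Omega> - {a}) u F \<Longrightarrow>
        (\<exists>F'. form_limit (AB_potential \<alpha> a') (\<Omega> - {a'}) (\<lambda>x. \<zeta> x * u x) F' \<and>
           l2norm ?M F' \<le> (1 + x) * l2norm ?M F \<and>
           l2norm ?M u - x * l2norm ?M F \<le> l2norm ?M (\<lambda>x. \<zeta> x * u x))"
      using \<eta>(2)[OF \<Omega>(1) aa] C by auto
    show "ab_minmax \<alpha> \<Omega> j a' \<le> (1 + x)\<^sup>2 * t / (1 - x * sqrt t)\<^sup>2"
      unfolding ab_minmax_def
    proof (rule minmax_transfer[OF AB_two_forms[OF \<Omega>(1)] AB_two_forms[OF \<Omega>(1)] j AB_subspaces_nonempty[OF \<Omega>] t[unfolded ab_minmax_def], where m=\<zeta>])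
      fix u assume u: "u \<in> form_domain (AB_potential \<alpha> a) (\<Omega> - {a})"
        and R: "herm_form.q (energy (AB_potential \<alpha> a) (\<Omega> - {a})) u \<le> t * herm_form.q (cip (lebesgue_on (\<Omega> - {a}))) u"
      obtain F where F: "form_limit (AB_potential \<alpha> a) (\<Omega> - {a}) u F" using u by (auto simp: form_domain_def)
      have "(l2norm ?M F)\<^sup>2 \<le> (sqrt t * l2norm ?M u)\<^sup>2"
        using R t0 unfolding AB_q[OF \<Omega>(1)] AB_energy_q[OF \<Omega>(1) F] by (simp add: power_mult_distrib)
      then have Fu: "l2norm ?M F \<le> sqrt t * l2norm ?M u" by (rule power2_le_imp_le) (simp add: t0)
      obtain F' where F': "form_limit (AB_potential \<alpha> a') (\<Omega> - {a'}) (\<lambda>x. \<zeta> x * u x) F'"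
           "l2norm ?M F' \<le> (1 + x) * l2norm ?M F"
           "l2norm ?M u - x * l2norm ?M F \<le> l2norm ?M (\<lambda>x. \<zeta> x * u x)"
        using \<zeta>[OF F] by blast
      define s where "s = 1 - x * sqrt t"
      have s: "0 < s" using xt by (simp add: s_def)
      have "x * l2norm ?M F \<le> x * (sqrt t * l2norm ?M u)" using x by (intro mult_left_mono Fu) auto
      then have low: "s * l2norm ?M u \<le> l2norm ?M (\<lambda>x. \<zeta> x * u x)"
        using F'(3) by (simp add: s_def algebra_simps)
      have "s * l2norm ?M F' \<le> s * ((1 + x) * (sqrt t * l2norm ?M u))"
        using order_trans[OF F'(2) mult_left_mono[OF Fu, of "1 + x"]] x s by (intro mult_left_mono) auto
      also have "\<dots> = (1 + x) * sqrt t * (s * l2norm ?M u)" by simp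
      also have "\<dots> \<le> (1 + x) * sqrt t * l2norm ?M (\<lambda>x. \<zeta> x * u x)"
        using x t0 by (intro mult_left_mono low) auto
      finally have "(s * l2norm ?M F')\<^sup>2 \<le> ((1 + x) * sqrt t * l2norm ?M (\<lambda>x. \<zeta> x * u x))\<^sup>2"
        by (rule power_mono) (use s in simp)
      then have "s\<^sup>2 * (l2norm ?M F')\<^sup>2 \<le> (1 + x)\<^sup>2 * t * (l2norm ?M (\<lambda>x. \<zeta> x * u x))\<^sup>2"
        by (simp only: power_mult_distrib real_sqrt_pow2[OF t0])
      then have "(l2norm ?M F')\<^sup>2 \<le> (1 + x)\<^sup>2 * t * (l2norm ?M (\<lambda>x. \<zeta> x * u x))\<^sup>2 / s\<^sup>2"
        using s by (simp only: pos_le_divide_eq zero_less_power mult.commute[of "s\<^sup>2"])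
      then have "(l2norm ?M F')\<^sup>2 \<le> (1 + x)\<^sup>2 * t / s\<^sup>2 * (l2norm ?M (\<lambda>x. \<zeta> x * u x))\<^sup>2"
        by simp
      moreover have "l2norm ?M u = 0" if "l2norm ?M (\<lambda>x. \<zeta> x * u x) = 0"
        using low s that l2norm_nonneg[of ?M u] by (simp add: mult_le_0_iff)
      ultimately show "(\<lambda>x. \<zeta> x * u x) \<in> form_domain (AB_potential \<alpha> a') (\<Omega> - {a'}) \<and>
         herm_form.q (energy (AB_potential \<alpha> a') (\<Omega> - {a'})) (\<lambda>x. \<zeta> x * u x)
           \<le> (1 + x)\<^sup>2 * t / (1 - x * sqrt t)\<^sup>2 * herm_form.q (cip (lebesgue_on (\<Omega> - {a'}))) (\<lambda>x. \<zeta> x * u x) \<and>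
         (herm_form.q (cip (lebesgue_on (\<Omega> - {a'}))) (\<lambda>x. \<zeta> x * u x) = 0 \<longrightarrow>
          herm_form.q (cip (lebesgue_on (\<Omega> - {a}))) u = 0)"
        unfolding AB_q[OF \<Omega>(1)] AB_energy_q[OF \<Omega>(1) F'(1)] s_def[symmetric]
        using form_limit_domain[OF F'(1)] by simp
    qed
  qed
qed

lemma small_parameter:
  fixes t e :: real
  assumes "0 < e"
  shows "\<exists>x>0. x * sqrt t < 1 \<and> (1 + x)\<^sup>2 * t / (1 - x * sqrt t)\<^sup>2 < t + e"
proof -
  have "((\<lambda>x. (1 + x)\<^sup>2 * t / (1 - x * sqrt t)\<^sup>2) \<longlongrightarrow> (1 + 0)\<^sup>2 * t / (1 - 0 * sqrt t)\<^sup>2) (at_right 0)"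
    by (intro tendsto_intros) auto
  then have "((\<lambda>x. (1 + x)\<^sup>2 * t / (1 - x * sqrt t)\<^sup>2) \<longlongrightarrow> t) (at_right 0)" by simp
  then have 1: "\<forall>\<^sub>F x in at_right 0. (1 + x)\<^sup>2 * t / (1 - x * sqrt t)\<^sup>2 < t + e"
    by (rule order_tendstoD(2)) (use assms in simp)
  have "((\<lambda>x. x * sqrt t) \<longlongrightarrow> 0 * sqrt t) (at_right (0::real))" by (intro tendsto_intros)
  then have 2: "\<forall>\<^sub>F x in at_right 0. x * sqrt t < 1" by (rule order_tendstoD(2)) simp
  have 3: "\<forall>\<^sub>F x in at_right (0::real). 0 < x" by (rule eventually_at_right_less)
  have "\<forall>\<^sub>F x in at_right 0. 0 < x \<and> x * sqrt t < 1 \<and> (1 + x)\<^sup>2 * t / (1 - x * sqrt t)\<^sup>2 < t + e"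
    using 1 2 3 by eventually_elim simp
  then show ?thesis using eventually_happens'[OF trivial_limit_at_right_real] by blast
qed

text \<open>The step is symmetric in the two poles, so upper and lower semicontinuity follow from it together.
  Poles outside \<open>\<Omega>\<close> are included, and this is what makes the boundary no different from the interior.\<close>

lemma continuous_ab_minmax:
  assumes \<alpha>: "0 < \<alpha>" "\<alpha> < 1" and \<Omega>: "open \<Omega>" "\<Omega> \<noteq> {}" and j: "1 \<le> j"
  shows "continuous_on UNIV (ab_minmax \<alpha> \<Omega> j)"
  unfolding continuous_on_iff
proof (intro ballI allI impI)
  fix a0 :: "real^2" and e :: real assume e: "0 < e"
  let ?L = "ab_minmax \<alpha> \<Omega> j"
  obtain x where x: "0 < x" "x * sqrt (?L a0 + e/2) < 1"
      "(1 + x)\<^sup>2 * (?L a0 + e/2) / (1 - x * sqrt (?L a0 + e/2))\<^sup>2 < (?L a0 + e/2) + e/2"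
    using small_parameter[of "e/2" "?L a0 + e/2"] e by auto
  obtain y where y: "0 < y" "y * sqrt (?L a0 - e/2) < 1"
      "(1 + y)\<^sup>2 * (?L a0 - e/2) / (1 - y * sqrt (?L a0 - e/2))\<^sup>2 < (?L a0 - e/2) + e/2"
    using small_parameter[of "e/2" "?L a0 - e/2"] e by auto
  obtain \<eta>1 where \<eta>1: "0 < \<eta>1" "\<And>a a' t. norm (a' - a) < \<eta>1 \<Longrightarrow> ?L a < t \<Longrightarrow> x * sqrt t < 1 \<Longrightarrow>
      ?L a' \<le> (1 + x)\<^sup>2 * t / (1 - x * sqrt t)\<^sup>2"
    using ab_minmax_step[OF \<alpha> x(1) \<Omega> j] by blast
  obtain \<eta>2 where \<eta>2: "0 < \<eta>2" "\<And>a a' t. norm (a' - a) < \<eta>2 \<Longrightarrow> ?L a < t \<Longrightarrow> y * sqrt t < 1 \<Longrightarrow>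
      ?L a' \<le> (1 + y)\<^sup>2 * t / (1 - y * sqrt t)\<^sup>2"
    using ab_minmax_step[OF \<alpha> y(1) \<Omega> j] by blast
  show "\<exists>d>0. \<forall>a\<in>UNIV. dist a a0 < d \<longrightarrow> dist (?L a) (?L a0) < e"
  proof (intro exI[of _ "min \<eta>1 \<eta>2"] conjI ballI impI)
    fix a assume a: "dist a a0 < min \<eta>1 \<eta>2"
    have "?L a < ?L a0 + e"
      using \<eta>1(2)[of a a0 "?L a0 + e/2"] a e x by (simp add: dist_norm)
    moreover have "?L a0 - e < ?L a"
    proof (rule ccontr)
      assume "\<not> ?thesis"
      then have "?L a < ?L a0 - e/2" using e by simp
      then have "?L a0 \<le> (1 + y)\<^sup>2 * (?L a0 - e/2) / (1 - y * sqrt (?L a0 - e/2))\<^sup>2"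
        using \<eta>2(2)[of a0 a "?L a0 - e/2"] a y(2) by (simp add: dist_norm norm_minus_commute)
      then show False using y(3) by simp
    qed
    ultimately show "dist (?L a) (?L a0) < e" by (simp add: dist_real_def)
  qed (use \<eta>1 \<eta>2 in auto)
qed

section \<open>A pole outside the domain\<close>

definition to_complex :: "real^2 \<Rightarrow> complex" where
  "to_complex x = Complex (x$1) (x$2)"

lemma to_complex_linear: "linear to_complex"
  by (rule linearI) (simp_all add: to_complex_def complex_eq_iff)

lemma to_complex_inj: "inj to_complex"
  by (rule injI) (simp add: to_complex_def vec_eq_iff forall_2)

lemma to_complex_surj: "surj to_complex"
  by (rule surjI[of _ "\<lambda>z. vector [Re z, Im z]"]) (simp add: to_complex_def complex_eq_iff)

text \<open>On a simply connected domain the angle around an outside point is a smooth function, obtained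
  from a holomorphic logarithm, and its gradient is the potential with circulation \<open>1\<close>.\<close>

lemma gauge_function:
  assumes \<Omega>: "open \<Omega>" "simply_connected \<Omega>" and b: "b \<notin> \<Omega>"
  shows "\<exists>G. smooth_on \<Omega> G \<and> (\<forall>x\<in>\<Omega>. norm (G x) = 1) \<and>
    (\<forall>x\<in>\<Omega>. \<forall>i. pd i G x = \<i> * complex_of_real (AB_potential \<beta> b x $ i) * G x)"
proof -
  let ?S = "to_complex ` \<Omega>"
  have oS: "open ?S" by (rule open_surjective_linear_image[OF \<Omega>(1) to_complex_linear to_complex_surj])
  have "\<Omega> homeomorphic ?S" by (rule linear_homeomorphic_image[OF to_complex_linear to_complex_inj])
  then have sS: "simply_connected ?S" using \<Omega>(2) by (rule homeomorphic_simply_connected)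
  have ne: "z - to_complex b \<noteq> 0" if "z \<in> ?S" for z
    using that b injD[OF to_complex_inj] by auto
  have "(\<lambda>z. z - to_complex b) holomorphic_on ?S" by (intro holomorphic_intros)
  then obtain g where g: "g holomorphic_on ?S" "\<And>z. z \<in> ?S \<Longrightarrow> z - to_complex b = exp (g z)"
    using sS ne unfolding simply_connected_eq_holomorphic_log[OF oS] by blast
  have dg: "(g has_field_derivative 1 / (z - to_complex b)) (at z)" if z: "z \<in> ?S" for z
  proof -
    obtain g' where g': "(g has_field_derivative g') (at z)"
      using g(1) oS z by (metis holomorphic_on_imp_differentiable_at field_differentiable_def)
    have "((\<lambda>z. exp (g z)) has_field_derivative exp (g z) * g') (at z)"
      using g' by (auto intro!: derivative_eq_intros)
    then have "((\<lambda>z. z - to_complex b) has_field_derivative exp (g z) * g') (at z)"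
      by (rule has_field_derivative_transform_within_open[OF _ oS z]) (simp add: g(2))
    moreover have "((\<lambda>z. z - to_complex b) has_field_derivative 1) (at z)"
      by (auto intro!: derivative_eq_intros)
    ultimately have "exp (g z) * g' = 1" by (rule DERIV_unique)
    then have "(z - to_complex b) * g' = 1" by (simp only: g(2)[OF z])
    then have "g' = 1 / (z - to_complex b)" using ne[OF z] by (simp add: nonzero_eq_divide_eq mult.commute)
    then show ?thesis using g' by simp
  qed
  define G where "G x = exp (\<i> * complex_of_real (\<beta> * Im (g (to_complex x))))" for x
  let ?D = "\<lambda>x h. G x * (\<i> * complex_of_real (\<beta> * Im (1 / (to_complex x - to_complex b) * to_complex h)))"
  have dG: "(G has_derivative ?D x) (at x)" if x: "x \<in> \<Omega>" for x
  proof -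
    have "(to_complex has_derivative to_complex) (at x)"
      using to_complex_linear by (simp add: linear_conv_bounded_linear bounded_linear_imp_has_derivative)
    moreover have "(g has_derivative (*) (1 / (to_complex x - to_complex b))) (at (to_complex x))"
      using dg[of "to_complex x"] x by (simp add: has_field_derivative_def)
    ultimately have "((\<lambda>x. g (to_complex x)) has_derivative (\<lambda>h. 1 / (to_complex x - to_complex b) * to_complex h)) (at x)"
      by (rule has_derivative_compose)
    then have 1: "((\<lambda>x. \<i> * complex_of_real (\<beta> * Im (g (to_complex x)))) has_derivative
        (\<lambda>h. \<i> * complex_of_real (\<beta> * Im (1 / (to_complex x - to_complex b) * to_complex h)))) (at x)"
      by (intro has_derivative_mult_right has_derivative_of_real has_derivative_Im)
    have "(exp has_derivative (*) (G x)) (at (\<i> * complex_of_real (\<beta> * Im (g (to_complex x)))))"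
      using DERIV_exp[of "\<i> * complex_of_real (\<beta> * Im (g (to_complex x)))"] by (simp add: has_field_derivative_def G_def)
    from has_derivative_compose[OF 1 this] show ?thesis unfolding G_def[abs_def] .
  qed
  have De: "?D x (axis i 1) = \<i> * complex_of_real (AB_potential \<beta> b x $ i) * G x" if x: "x \<in> \<Omega>" for x i
  proof -
    have n: "(norm (x - b))\<^sup>2 = (x$1 - b$1)\<^sup>2 + (x$2 - b$2)\<^sup>2" by (simp add: norm_sq_real2)
    have "\<beta> * Im (1 / (to_complex x - to_complex b) * to_complex (axis i 1)) = AB_potential \<beta> b x $ i"
    proof -
      have "i = 1 \<or> i = 2" using exhaust_2 by blast
      then show ?thesis
        by (auto simp: AB_potential_nth n to_complex_def axis_def Im_divide Re_divide cmod_power2 divide_inverse)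
    qed
    then show ?thesis by simp
  qed
  have Ck: "Ck_on k \<Omega> G" for k
  proof (induction k)
    case 0
    show ?case using dG by (auto intro!: continuous_at_imp_continuous_on has_derivative_continuous)
  next
    case (Suc k)
    show ?case
    proof (rule Ck_on_SucI[OF \<Omega>(1) dG])
      fix i
      have sub: "\<Omega> \<subseteq> - {b}" using b by auto
      have "Ck_on k \<Omega> (\<lambda>x. complex_of_real (AB_potential \<beta> b x $ i))"
        using smooth_pot_subset[OF smooth_pot_AB sub, of \<beta>] by (simp add: smooth_pot_def rsmooth_on_def smooth_on_def)
      then have "Ck_on k \<Omega> (\<lambda>x. \<i> * complex_of_real (AB_potential \<beta> b x $ i) * G x)"
        by (intro Ck_on_mult Ck_on_const \<Omega>(1) Suc)
      then show "Ck_on k \<Omega> (\<lambda>x. ?D x (axis i 1))"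
        by (rule Ck_on_cong[OF \<Omega>(1), rotated]) (rule De[symmetric])
    qed
  qed
  have "pd i G x = \<i> * complex_of_real (AB_potential \<beta> b x $ i) * G x" if "x \<in> \<Omega>" for x i
    using pd_eq[OF dG[OF that]] De[OF that] by simp
  moreover have "norm (G x) = 1" for x unfolding G_def by (simp add: norm_exp_i_times)
  ultimately show ?thesis using Ck by (intro exI[of _ G]) (simp add: smooth_on_def)
qed

text \<open>A gauge factor of modulus one is an isometry for both norms.\<close>

lemma gauge_minmax_le:
  assumes \<Omega>: "open \<Omega>" "\<Omega> \<noteq> {}" "b \<notin> \<Omega>" and A: "smooth_pot \<Omega> A" and A': "smooth_pot \<Omega> A'" and j: "1 \<le> j"
    and G: "smooth_on \<Omega> G" "\<And>x. x \<in> \<Omega> \<Longrightarrow> norm (G x) = 1"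
    and pdG: "\<And>x i. x \<in> \<Omega> \<Longrightarrow> pd i G x = \<i> * complex_of_real (A' x $ i - A x $ i) * G x"
  shows "two_forms.minmax (form_domain A' \<Omega>) (cip (lebesgue_on \<Omega>)) (energy A' \<Omega>) j \<le>
     two_forms.minmax (form_domain A \<Omega>) (cip (lebesgue_on \<Omega>)) (energy A \<Omega>) j"
proof (rule dense_ge)
  let ?M = "lebesgue_on \<Omega>"
  fix t assume t: "two_forms.minmax (form_domain A \<Omega>) (cip ?M) (energy A \<Omega>) j < t"
  have \<Omega>b: "\<Omega> - {b} = \<Omega>" using \<Omega>(3) by auto
  have Gm [measurable]: "G \<in> borel_measurable ?M"
    using \<Omega>(1) by (intro continuous_imp_measurable_on_sets_lebesgue smooth_on_continuous[OF G(1)]) auto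
  show "two_forms.minmax (form_domain A' \<Omega>) (cip ?M) (energy A' \<Omega>) j \<le> t"
  proof (rule minmax_transfer[OF two_forms_magnetic[OF \<Omega>(1) A] two_forms_magnetic[OF \<Omega>(1) A'] j
        subspaces_nonempty[OF \<Omega>(1) A \<Omega>(2)] t, where m=G])
    fix u assume u: "u \<in> form_domain A \<Omega>"
      and R: "herm_form.q (energy A \<Omega>) u \<le> t * herm_form.q (cip ?M) u"
    obtain F where F: "form_limit A \<Omega> u F" using u by (auto simp: form_domain_def)
    have [measurable]: "u \<in> borel_measurable ?M" "F \<in> borel_measurable ?M"
      using form_limit_sqint[OF F] by (auto simp: sqint_def)
    have grad: "mgrad A' (\<lambda>x. G x * \<phi> x) x = G x *s mgrad A \<phi> x + \<phi> x *s 0"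
      if \<phi>: "\<phi> \<in> test_functions \<Omega>" and x: "x \<in> \<Omega>" for \<phi> x
    proof -
      have "((\<lambda>x. G x * \<phi> x) has_derivative
          (\<lambda>h. G x * frechet_derivative \<phi> (at x) h + frechet_derivative G (at x) h * \<phi> x)) (at x)"
        by (intro has_derivative_mult test_has_derivative[OF \<phi>] smooth_on_has_derivative[OF G(1) x])
      then have p: "pd i (\<lambda>x. G x * \<phi> x) x = G x * pd i \<phi> x + pd i G x * \<phi> x" for i
        by (simp add: pd_eq) (simp add: pd_def)
      have "mpart A' i (\<lambda>x. G x * \<phi> x) x = G x * mpart A i \<phi> x" for i
        unfolding mpart_def p pdG[OF x] by (simp add: algebra_simps)
      then show ?thesis by (simp add: vec_eq_iff mgrad_nth)
    qed
    have F': "form_limit A' \<Omega> (\<lambda>x. G x * u x) (\<lambda>x. G x *s F x + u x *s 0)"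
      by (rule form_limit_multiplier[of \<Omega> b A b A' u F G "\<lambda>x. 0" 0, unfolded \<Omega>b, OF \<Omega>(1) A A' F Gm _ _ _ _ grad])
         (use G in \<open>auto intro: test_mult[OF \<Omega>(1)]\<close>)
    have "l2norm ?M (\<lambda>x. G x *s F x + u x *s 0) = l2norm ?M F"
      by (rule l2norm_cong_AE) (use G(2) in \<open>auto simp: norm_vector_smult intro!: AE_I2\<close>)
    moreover have "l2norm ?M (\<lambda>x. G x * u x) = l2norm ?M u"
      by (rule l2norm_cong_AE) (use G(2) in \<open>auto simp: norm_mult intro!: AE_I2\<close>)
    ultimately show "(\<lambda>x. G x * u x) \<in> form_domain A' \<Omega> \<and>
       herm_form.q (energy A' \<Omega>) (\<lambda>x. G x * u x) \<le> t * herm_form.q (cip ?M) (\<lambda>x. G x * u x) \<and>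
       (herm_form.q (cip ?M) (\<lambda>x. G x * u x) = 0 \<longrightarrow> herm_form.q (cip ?M) u = 0)"
      using R form_limit_domain[OF F']
      unfolding ip_q[OF \<Omega>(1) A] energy_q[OF \<Omega>(1) A] energy_q[OF \<Omega>(1) A']
        form_norm_sq_eq[OF \<Omega>(1) A F] form_norm_sq_eq[OF \<Omega>(1) A' F'] by simp
  qed
qed

text \<open>The potential of a pole outside \<open>\<Omega>\<close> is a gradient on \<open>\<Omega>\<close>, so the gauge factors with \<open>\<alpha>\<close> and
  \<open>-\<alpha>\<close> transform the magnetic problem into the Dirichlet problem and back.\<close>

lemma AB_eigenvalue_outside:
  assumes \<Omega>: "open \<Omega>" "simply_connected \<Omega>" "bounded \<Omega>" "\<Omega> \<noteq> {}" and b: "b \<notin> \<Omega>" and j: "1 \<le> j"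
  shows "ab_minmax \<alpha> \<Omega> j b = dirichlet_eigenvalue \<Omega> j"
proof -
  have \<Omega>b: "\<Omega> - {b} = \<Omega>" using b by auto
  note A0 = smooth_pot_zero[OF \<Omega>(1)]
  have A: "smooth_pot \<Omega> (AB_potential \<alpha> b)" using AB_smooth[OF \<Omega>(1), of b \<alpha>] by (simp add: \<Omega>b)
  have neg: "AB_potential (- \<alpha>) b x = - AB_potential \<alpha> b x" for x
    by (simp add: AB_potential_perp)
  obtain G where G: "smooth_on \<Omega> G" "\<And>x. x \<in> \<Omega> \<Longrightarrow> norm (G x) = 1"
    "\<And>x i. x \<in> \<Omega> \<Longrightarrow> pd i G x = \<i> * complex_of_real (AB_potential \<alpha> b x $ i) * G x"
    using gauge_function[OF \<Omega>(1,2) b, of \<alpha>] by blast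
  obtain H where H: "smooth_on \<Omega> H" "\<And>x. x \<in> \<Omega> \<Longrightarrow> norm (H x) = 1"
    "\<And>x i. x \<in> \<Omega> \<Longrightarrow> pd i H x = \<i> * complex_of_real (AB_potential (- \<alpha>) b x $ i) * H x"
    using gauge_function[OF \<Omega>(1,2) b, of "- \<alpha>"] by blast
  show ?thesis
    unfolding dirichlet_eigenvalue_eq_minmax[OF \<Omega>(1,3,4) j] ab_minmax_def \<Omega>b
  proof (rule antisym)
    show "two_forms.minmax (form_domain (AB_potential \<alpha> b) \<Omega>) (cip (lebesgue_on \<Omega>)) (energy (AB_potential \<alpha> b) \<Omega>) j
      \<le> two_forms.minmax (form_domain (\<lambda>_. 0) \<Omega>) (cip (lebesgue_on \<Omega>)) (energy (\<lambda>_. 0) \<Omega>) j"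
      by (rule gauge_minmax_le[OF \<Omega>(1,4) b A0 A j G(1,2)]) (simp_all add: G(3))
    show "two_forms.minmax (form_domain (\<lambda>_. 0) \<Omega>) (cip (lebesgue_on \<Omega>)) (energy (\<lambda>_. 0) \<Omega>) j
      \<le> two_forms.minmax (form_domain (AB_potential \<alpha> b) \<Omega>) (cip (lebesgue_on \<Omega>)) (energy (AB_potential \<alpha> b) \<Omega>) j"
      by (rule gauge_minmax_le[OF \<Omega>(1,4) b A A0 j H(1,2)]) (simp_all add: H(3) neg)
  qed
qed

section \<open>Convergence at the boundary\<close>

theorem theorem1p1:
  fixes \<Omega> :: "(real^2) set" and \<alpha> :: real and j :: nat
  assumes "open \<Omega>" and "simply_connected \<Omega>" and "bounded \<Omega>"
    and "0 < \<alpha>" and "\<alpha> < 1" and "1 \<le> j"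
  shows "(\<exists>g :: real^2 \<Rightarrow> real. continuous_on (closure \<Omega>) g \<and>
            (\<forall>a\<in>\<Omega>. g a = AB_eigenvalue \<alpha> \<Omega> j a) \<and>
            (\<forall>b\<in>frontier \<Omega>. g b = dirichlet_eigenvalue \<Omega> j)) \<and>
         (AB_eigenvalue \<alpha> \<Omega> j \<longlongrightarrow> dirichlet_eigenvalue \<Omega> j) (to_boundary \<Omega>)"
proof (cases "\<Omega> = {}")
  case True
  \<comment> \<open>the closure, the frontier and the filter are trivial\<close>
  then show ?thesis by (simp add: to_boundary_def)
next
  case False
  let ?g = "ab_minmax \<alpha> \<Omega> j"
  have cont: "continuous_on UNIV ?g"
    by (rule continuous_ab_minmax[OF assms(4,5,1) False assms(6)])
  have out: "?g b = dirichlet_eigenvalue \<Omega> j" if "b \<in> frontier \<Omega>" for b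
    using AB_eigenvalue_outside[OF assms(1-3) False _ assms(6)] that assms(1) by (simp add: frontier_def interior_open)
  have inside: "AB_eigenvalue \<alpha> \<Omega> j = ?g"
    using AB_eigenvalue_eq_minmax[OF assms(1)] by auto
  have fr: "frontier \<Omega> \<noteq> {}"
    using False assms(3) by (metis frontier_eq_empty not_bounded_UNIV)
  have "(?g \<longlongrightarrow> dirichlet_eigenvalue \<Omega> j) (to_boundary \<Omega>)"
  proof (rule tendstoI)
    fix e :: real assume e: "0 < e"
    have "uniformly_continuous_on (closure \<Omega>) ?g"
      by (rule compact_uniformly_continuous[OF continuous_on_subset[OF cont]]) (use assms(3) in \<open>auto simp: compact_closure\<close>)
    then obtain d where d: "0 < d" "\<And>x y. x \<in> closure \<Omega> \<Longrightarrow> y \<in> closure \<Omega> \<Longrightarrow> dist y x < d \<Longrightarrow> dist (?g y) (?g x) < e"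
      using e unfolding uniformly_continuous_on_def by meson
    have near: "dist (?g a) (dirichlet_eigenvalue \<Omega> j) < e" if a: "a \<in> \<Omega>" "infdist a (frontier \<Omega>) < d" for a
    proof -
      obtain b where b: "b \<in> frontier \<Omega>" "infdist a (frontier \<Omega>) = dist a b"
        using infdist_attains_inf[OF frontier_closed fr, of a] by metis
      have "dist (?g a) (?g b) < e"
        using d(2)[of b a] a b closure_subset[of \<Omega>] by (auto simp: frontier_def)
      then show ?thesis by (simp add: out[OF b(1)])
    qed
    have "\<forall>\<^sub>F y in nhds (0::real). y < d" by (rule order_tendstoD(2)[OF filterlim_ident d(1)])
    then have "\<forall>\<^sub>F a in filtercomap (\<lambda>a. infdist a (frontier \<Omega>)) (nhds 0). infdist a (frontier \<Omega>) < d"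
      by (rule eventually_filtercomapI)
    then show "\<forall>\<^sub>F a in to_boundary \<Omega>. dist (?g a) (dirichlet_eigenvalue \<Omega> j) < e"
      unfolding to_boundary_def eventually_inf_principal by eventually_elim (use near in blast)
  qed
  moreover have "continuous_on (closure \<Omega>) ?g" by (rule continuous_on_subset[OF cont]) simp
  ultimately show ?thesis using out inside by auto
qed

end
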